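(* Let $\mathfrak{g}$ be a Lie algebra over $\mathbb{K}$, $z\in\mathbb{K}$, $k,\ell\in\mathbb{N}$ ($k,\ell\ge1$) and $\xi_1,\ldots,\xi_k,\eta_1,\ldots,\eta_\ell\in\mathfrak{g}$. Then $$\xi_1\cdots\xi_k\star_z\eta_1\cdots\eta_\ell=\sum_{n=0}^{k+\ell-1}z^n\,C_n(\xi_1\cdots\xi_k,\eta_1\cdots\eta_\ell),$$ where, with $r=k+\ell-n$, the $C_n$ are given by $$C_n(\xi_1\cdots\xi_k,\eta_1\cdots\eta_\ell)=\sum_{J\in\mathcal{G}_{r}(k,\ell)}\frac{1}{J!}\sum_{\sigma\in S_k}\sum_{\tau\in S_\ell}\prod_{i=1}^{r}\widetilde{\mathrm{BCH}}_{a_i,b_i}\big(\xi_{\sigma(a_1+\cdots+a_{i-1}+1)},\ldots,\xi_{\sigma(a_1+\cdots+a_i)};\ \eta_{\tau(b_1+\cdots+b_{i-1}+1)},\ldots,\eta_{\tau(b_1+\cdots+b_i)}\big)$$ $$=\frac{1}{r!}\sum_{\sigma\in S_k,\ \tau\in S_\ell}\ \sum_{\substack{a_1,b_1,\ldots,a_r,b_r\ge0\\ a_i+b_i\ge1\\ a_1+\cdots+a_r=k\\ b_1+\cdots+b_r=\ell}}\ \prod_{i=1}^{r}\widetilde{\mathrm{BCH}}_{a_i,b_i}\big(\xi_{\sigma(a_1+\cdots+a_{i-1}+1)},\ldots,\xi_{\sigma(a_1+\cdots+a_i)};\ \eta_{\tau(b_1+\cdots+b_{i-1}+1)},\ldots,\eta_{\tau(b_1+\cdots+b_i)}\big).$$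 In the first formula $J=((a_1,b_1),\ldots,(a_r,b_r))$, and all products are taken in the symmetric tensor algebra.
   Context: $\mathbb{K}$ is $\mathbb{R}$ or $\mathbb{C}$. $\mathrm{S}^\bullet(\mathfrak{g})=\bigoplus_n \mathrm{S}^n(\mathfrak{g})$ is the symmetric tensor algebra with commutative product written without a sign, $\pi_n$ the projection onto $\mathrm{S}^n(\mathfrak{g})$, $\mathcal{U}(\mathfrak{g})$ the universal enveloping algebra with product $\odot$, and $\mathfrak{q}\colon \mathrm{S}^\bullet(\mathfrak{g})\to\mathcal{U}(\mathfrak{g})$ the linear isomorphism $\mathfrak{q}(\xi_1\cdots\xi_n)=\frac1{n!}\sum_{\sigma\in S_n}\xi_{\sigma(1)}\odot\cdots\odot\xi_{\sigma(n)}$. The Gutt star product is the bilinear product with $f\star_z g=\sum_{n=0}^{k+\ell}z^n\pi_{k+\ell-n}\big(\mathfrak{q}^{-1}(\mathfrak{q}(f)\odot\mathfrak{q}(g))\big)$ for $f\in \mathrm{S}^k(\mathfrak{g})$, $g\in \mathrm{S}^\ell(\mathfrak{g})$. BCH terms: $\mathrm{BCH}(\xi,\eta)=\log(\exp\xi\exp\eta)=\sum_{a,b}\mathrm{BCH}_{a,b}(\xi,\eta)$, where $\mathrm{BCH}_{a,b}(\xi,\eta)$ is a Lie polynomial with $a$ letters $\xi$ and $b$ letters $\eta$; fix for each $(a,b)$ an expression of it as a linear combination of iterated brackets ($\mathrm{BCH}_{1,0}=\xi$, $\mathrm{BCH}_{0,1}=\eta$, and $\mathrm{BCH}_{a,0}=0=\mathrm{BCH}_{0,a}$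 for $a\ge2$). $\widetilde{\mathrm{BCH}}_{a,b}\colon\mathfrak{g}^{a+b}\to\mathfrak{g}$ is the map $(\xi_1,\ldots,\xi_a;\eta_1,\ldots,\eta_b)\mapsto\widetilde{\mathrm{BCH}}_{a,b}(\xi_1,\ldots,\xi_a;\eta_1,\ldots,\eta_b)$ obtained by replacing in $\mathrm{BCH}_{a,b}(\xi,\eta)$ (in each bracket expression) the $i$-th $\xi$ by $\xi_i$ and the $j$-th $\eta$ by $\eta_j$. G-indices: for $r=k+\ell-n$, $\mathcal{G}_r(k,\ell)$ is the set of $r$-tuples $J=(J_1,\ldots,J_r)=((a_1,b_1),\ldots,(a_r,b_r))$ with (i) $J_i\in\{0,\ldots,k\}\times\{0,\ldots,\ell\}$; (ii) $|J_i|=a_i+b_i\ge1$ for all $i$; (iii) $\sum_i a_i=k$ and $\sum_i b_i=\ell$; (iv) the tuple is ordered: $i>j$ implies $|J_i|\ge|J_j|$, and $a_i\ge a_j$ if $|J_i|=|J_j|$; (v) if $a_i=0$ then $b_i=1$, and if $b_i=0$ then $a_i=1$. The G-factorial is $J!=\prod_{(a,b)\in\{0,\ldots,k\}\times\{0,\ldots,\ell\}}(\#_J(a,b))!$, where $\#_J(a,b)$ is the number of times $(a,b)$ appears in $J$. *)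

theory Defs
  imports Complex_Main "HOL-Library.Poly_Mapping" "HOL-Combinatorics.Permutations"
    "HOL-Algebra.QuotRing"
begin

text \<open>A ground field that is \<open>\<real>\<close> or the complex numbers is rendered by the class \<open>real_normed_field\<close>:
  by the Gelfand--Mazur theorem these are, up to isomorphism, its only models. The definitions need
  only characteristic 0.\<close>

locale lie_algebra = vector_space scale
  for scale :: "'k::field \<Rightarrow> 'g::ab_group_add \<Rightarrow> 'g" +
  fixes bracket :: "'g \<Rightarrow> 'g \<Rightarrow> 'g"
  assumes linear_left: "Vector_Spaces.linear scale scale (\<lambda>x. bracket x y)"
    and linear_right: "Vector_Spaces.linear scale scale (\<lambda>y. bracket x y)"
    and alternating: "bracket x x = 0"
    and jacobi: "bracket x (bracket y z) + bracket y (bracket z x) + bracket z (bracket x y) = 0"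

text \<open>A function on words is the noncommutative power series with these coefficients; the series
  with finite support form the free associative unital algebra on the set of letters.\<close>

type_synonym ('a, 'k) ncs = "'a list \<Rightarrow> 'k"

definition ncs_const :: "'k \<Rightarrow> ('a, 'k::zero) ncs" where
  "ncs_const c = (\<lambda>w. if w = [] then c else 0)"

definition ncs_monom :: "'a list \<Rightarrow> ('a, 'k::zero_neq_one) ncs" where
  "ncs_monom v = (\<lambda>w. if w = v then 1 else 0)"

definition ncs_mult :: "('a, 'k::semiring_0) ncs \<Rightarrow> ('a, 'k) ncs \<Rightarrow> ('a, 'k) ncs" where
  "ncs_mult f g = (\<lambda>w. \<Sum>i\<le>length w. f (take i w) * g (drop i w))"

primrec ncs_power :: "('a, 'k::semiring_1) ncs \<Rightarrow> nat \<Rightarrow> ('a, 'k) ncs" where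
  "ncs_power f 0 = ncs_const 1"
| "ncs_power f (Suc n) = ncs_mult f (ncs_power f n)"

text \<open>The exponential of a series without constant term and the logarithm of a series with
  constant term 1: under these conditions the omitted summands vanish at the word \<open>w\<close>.\<close>

definition ncs_exp :: "('a, 'k::field_char_0) ncs \<Rightarrow> ('a, 'k) ncs" where
  "ncs_exp f = (\<lambda>w. \<Sum>n\<le>length w. ncs_power f n w / fact n)"

definition ncs_log :: "('a, 'k::field_char_0) ncs \<Rightarrow> ('a, 'k) ncs" where
  "ncs_log f = (\<lambda>w. \<Sum>n=1..length w.
     (-1) ^ (n + 1) / of_nat n * ncs_power (\<lambda>v. f v - ncs_const 1 v) n w)"

datatype letter = Xi | Eta

definition bch_series :: "(letter, 'k::field_char_0) ncs" where
  "bch_series = ncs_log (ncs_mult (ncs_exp (ncs_monom [Xi])) (ncs_exp (ncs_monom [Eta])))"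

definition bch_component :: "nat \<Rightarrow> nat \<Rightarrow> (letter, 'k::field_char_0) ncs" where
  "bch_component a b =
     (\<lambda>w. if count_list w Xi = a \<and> count_list w Eta = b then bch_series w else 0)"

datatype lie_word = Letter letter | Bracket lie_word lie_word

primrec letter_count :: "letter \<Rightarrow> lie_word \<Rightarrow> nat" where
  "letter_count c (Letter d) = (if c = d then 1 else 0)"
| "letter_count c (Bracket s t) = letter_count c s + letter_count c t"

primrec lie_word_ncs :: "lie_word \<Rightarrow> (letter, 'k::ring_1) ncs" where
  "lie_word_ncs (Letter c) = ncs_monom [c]"
| "lie_word_ncs (Bracket s t) = (\<lambda>w. ncs_mult (lie_word_ncs s) (lie_word_ncs t) w
     - ncs_mult (lie_word_ncs t) (lie_word_ncs s) w)"

text \<open>\<open>lie_word_eval br x y t\<close> replaces, reading from left to right, the \<open>i\<close>-th \<open>Xi\<close> in \<open>t\<close>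
  by \<open>x i\<close> and the \<open>j\<close>-th \<open>Eta\<close> by \<open>y j\<close>, where \<open>i\<close> and \<open>j\<close> are counted from 1.\<close>

primrec lie_word_eval ::
  "('g \<Rightarrow> 'g \<Rightarrow> 'g) \<Rightarrow> lie_word \<Rightarrow> (nat \<Rightarrow> 'g) \<Rightarrow> (nat \<Rightarrow> 'g) \<Rightarrow> 'g" where
  "lie_word_eval br (Letter c) x y = (case c of Xi \<Rightarrow> x 1 | Eta \<Rightarrow> y 1)"
| "lie_word_eval br (Bracket s t) x y =
     br (lie_word_eval br s x y)
        (lie_word_eval br t (\<lambda>i. x (letter_count Xi s + i)) (\<lambda>j. y (letter_count Eta s + j)))"

text \<open>A choice, for each \<open>(a, b)\<close>, of a linear combination of iterated brackets representing
  the part of bidegree \<open>(a, b)\<close> of the series. Lie polynomials are compared inside the free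
  associative algebra, which contains the free Lie algebra.\<close>

definition bch_expressions :: "(nat \<Rightarrow> nat \<Rightarrow> lie_word \<Rightarrow>\<^sub>0 'k::field_char_0) \<Rightarrow> bool" where
  "bch_expressions E \<longleftrightarrow>
     (\<forall>a b. (\<forall>t\<in>Poly_Mapping.keys (E a b). letter_count Xi t = a \<and> letter_count Eta t = b)
        \<and> (\<lambda>w. \<Sum>t\<in>Poly_Mapping.keys (E a b). Poly_Mapping.lookup (E a b) t * lie_word_ncs t w) = bch_component a b)
     \<and> E 1 0 = Poly_Mapping.single (Letter Xi) 1
     \<and> E 0 1 = Poly_Mapping.single (Letter Eta) 1
     \<and> (\<forall>a\<ge>2. E a 0 = 0 \<and> E 0 a = 0)"

definition bch_tilde ::
  "('k::zero \<Rightarrow> 'g \<Rightarrow> 'g::ab_group_add) \<Rightarrow> ('g \<Rightarrow> 'g \<Rightarrow> 'g) \<Rightarrow> (nat \<Rightarrow> nat \<Rightarrow> lie_word \<Rightarrow>\<^sub>0 'k)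
     \<Rightarrow> nat \<Rightarrow> nat \<Rightarrow> (nat \<Rightarrow> 'g) \<Rightarrow> (nat \<Rightarrow> 'g) \<Rightarrow> 'g" where
  "bch_tilde scale br E a b x y =
     (\<Sum>t\<in>Poly_Mapping.keys (E a b). scale (Poly_Mapping.lookup (E a b) t) (lie_word_eval br t x y))"

definition free_algebra :: "('a, 'k::ring_1) ncs ring" where
  "free_algebra =
     \<lparr>carrier = {f. finite {w. f w \<noteq> 0}}, monoid.mult = ncs_mult, one = ncs_const 1,
      zero = ncs_const 0, add = (\<lambda>f g w. f w + g w)\<rparr>"

text \<open>The quotient of the free algebra on the set \<open>'g\<close> by the ideal generated by
  \<open>linear_relations\<close> is the tensor algebra; adding \<open>commutativity_relations\<close> gives the symmetric
  algebra, adding \<open>bracket_relations\<close> the universal enveloping algebra.\<close>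

definition linear_relations ::
  "('k::ring_1 \<Rightarrow> 'g \<Rightarrow> 'g::ab_group_add) \<Rightarrow> ('g, 'k) ncs set" where
  "linear_relations scale =
     {(\<lambda>w. ncs_monom [x + y] w - ncs_monom [x] w - ncs_monom [y] w) | x y. True} \<union>
     {(\<lambda>w. ncs_monom [scale c x] w - c * ncs_monom [x] w) | c x. True}"

definition commutativity_relations :: "('g, 'k::ring_1) ncs set" where
  "commutativity_relations = {(\<lambda>w. ncs_monom [x, y] w - ncs_monom [y, x] w) | x y. True}"

definition bracket_relations :: "('g \<Rightarrow> 'g \<Rightarrow> 'g) \<Rightarrow> ('g, 'k::ring_1) ncs set" where
  "bracket_relations br =
     {(\<lambda>w. ncs_monom [x, y] w - ncs_monom [y, x] w - ncs_monom [br x y] w) | x y. True}"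

definition sym_ideal :: "('k::ring_1 \<Rightarrow> 'g \<Rightarrow> 'g::ab_group_add) \<Rightarrow> ('g, 'k) ncs set" where
  "sym_ideal scale =
     Idl\<^bsub>free_algebra\<^esub> (linear_relations scale \<union> commutativity_relations)"

definition env_ideal ::
  "('k::ring_1 \<Rightarrow> 'g \<Rightarrow> 'g::ab_group_add) \<Rightarrow> ('g \<Rightarrow> 'g \<Rightarrow> 'g) \<Rightarrow> ('g, 'k) ncs set" where
  "env_ideal scale br =
     Idl\<^bsub>free_algebra\<^esub> (linear_relations scale \<union> bracket_relations br)"

definition sym_algebra ::
  "('k::ring_1 \<Rightarrow> 'g \<Rightarrow> 'g::ab_group_add) \<Rightarrow> ('g, 'k) ncs set ring" where
  "sym_algebra scale = free_algebra Quot (sym_ideal scale)"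

definition env_algebra ::
  "('k::ring_1 \<Rightarrow> 'g \<Rightarrow> 'g::ab_group_add) \<Rightarrow> ('g \<Rightarrow> 'g \<Rightarrow> 'g) \<Rightarrow> ('g, 'k) ncs set ring" where
  "env_algebra scale br = free_algebra Quot (env_ideal scale br)"

definition sym_incl :: "('k::ring_1 \<Rightarrow> 'g \<Rightarrow> 'g::ab_group_add) \<Rightarrow> 'g \<Rightarrow> ('g, 'k) ncs set" where
  "sym_incl scale x = sym_ideal scale +>\<^bsub>free_algebra\<^esub> ncs_monom [x]"

definition sym_smult ::
  "('k::ring_1 \<Rightarrow> 'g \<Rightarrow> 'g::ab_group_add) \<Rightarrow> 'k \<Rightarrow> ('g, 'k) ncs set \<Rightarrow> ('g, 'k) ncs set" where
  "sym_smult scale c X =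
     (sym_ideal scale +>\<^bsub>free_algebra\<^esub> ncs_const c) \<otimes>\<^bsub>sym_algebra scale\<^esub> X"

text \<open>The map into the quotient by \<open>J\<close> induced by a linear map \<open>\<phi>\<close> of the free algebra. It is used
  only for \<open>\<phi>\<close> mapping \<open>sym_ideal\<close> into \<open>J\<close>, so that all \<open>f\<close> in a coset \<open>X\<close> of \<open>sym_ideal\<close> give
  the same coset \<open>J + \<phi> f\<close>.\<close>

definition induced_map ::
  "('a, 'k::ring_1) ncs set \<Rightarrow> (('a, 'k) ncs \<Rightarrow> ('a, 'k) ncs) \<Rightarrow> ('a, 'k) ncs set \<Rightarrow> ('a, 'k) ncs set"
  where "induced_map J \<phi> X = (\<Union>f\<in>X. J +>\<^bsub>free_algebra\<^esub> \<phi> f)"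

definition sym_proj ::
  "('k::ring_1 \<Rightarrow> 'g \<Rightarrow> 'g::ab_group_add) \<Rightarrow> nat \<Rightarrow> ('g, 'k) ncs set \<Rightarrow> ('g, 'k) ncs set" where
  "sym_proj scale n =
     induced_map (sym_ideal scale) (\<lambda>f w. if length w = n then f w else 0)"

text \<open>\<open>gutt_q\<close> is the linear extension of
  \<open>x\<^sub>1 \<dots> x\<^sub>n \<mapsto> 1/n! \<Sum>\<sigma>. x\<^bsub>\<sigma>(1)\<^esub> \<odot> \<dots> \<odot> x\<^bsub>\<sigma>(n)\<^esub>\<close>; over a Lie algebra it is bijective by the
  Poincare--Birkhoff--Witt theorem, so that \<open>gutt_q_inv\<close> is its inverse.\<close>

definition symmetrization :: "('a, 'k::field_char_0) ncs \<Rightarrow> ('a, 'k) ncs" where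
  "symmetrization f = (\<lambda>w. \<Sum>v | f v \<noteq> 0. f v *
     (1 / fact (length v) * (\<Sum>\<sigma> | \<sigma> permutes {..<length v}. ncs_monom (permute_list \<sigma> v) w)))"

definition gutt_q ::
  "('k::field_char_0 \<Rightarrow> 'g \<Rightarrow> 'g::ab_group_add) \<Rightarrow> ('g \<Rightarrow> 'g \<Rightarrow> 'g)
     \<Rightarrow> ('g, 'k) ncs set \<Rightarrow> ('g, 'k) ncs set" where
  "gutt_q scale br = induced_map (env_ideal scale br) symmetrization"

definition gutt_q_inv ::
  "('k::field_char_0 \<Rightarrow> 'g \<Rightarrow> 'g::ab_group_add) \<Rightarrow> ('g \<Rightarrow> 'g \<Rightarrow> 'g)
     \<Rightarrow> ('g, 'k) ncs set \<Rightarrow> ('g, 'k) ncs set" where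
  "gutt_q_inv scale br = inv_into (carrier (sym_algebra scale)) (gutt_q scale br)"

definition gutt_star_homogeneous ::
  "('k::field_char_0 \<Rightarrow> 'g \<Rightarrow> 'g::ab_group_add) \<Rightarrow> ('g \<Rightarrow> 'g \<Rightarrow> 'g) \<Rightarrow> 'k \<Rightarrow> nat \<Rightarrow> nat
     \<Rightarrow> ('g, 'k) ncs set \<Rightarrow> ('g, 'k) ncs set \<Rightarrow> ('g, 'k) ncs set" where
  "gutt_star_homogeneous scale br z k l f g =
     (\<Oplus>\<^bsub>sym_algebra scale\<^esub>n\<in>{0..k + l}. sym_smult scale (z ^ n)
        (sym_proj scale (k + l - n)
          (gutt_q_inv scale br (gutt_q scale br f \<otimes>\<^bsub>env_algebra scale br\<^esub> gutt_q scale br g))))"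

text \<open>Bilinear extension: decompose both arguments into their finitely many nonzero
  homogeneous components.\<close>

definition gutt_star ::
  "('k::field_char_0 \<Rightarrow> 'g \<Rightarrow> 'g::ab_group_add) \<Rightarrow> ('g \<Rightarrow> 'g \<Rightarrow> 'g) \<Rightarrow> 'k
     \<Rightarrow> ('g, 'k) ncs set \<Rightarrow> ('g, 'k) ncs set \<Rightarrow> ('g, 'k) ncs set" where
  "gutt_star scale br z f g =
     (\<Oplus>\<^bsub>sym_algebra scale\<^esub>p\<in>{(k, l). sym_proj scale k f \<noteq> \<zero>\<^bsub>sym_algebra scale\<^esub>
            \<and> sym_proj scale l g \<noteq> \<zero>\<^bsub>sym_algebra scale\<^esub>}.
        gutt_star_homogeneous scale br z (fst p) (snd p)
          (sym_proj scale (fst p) f) (sym_proj scale (snd p) g))"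

definition G_indices :: "nat \<Rightarrow> nat \<Rightarrow> nat \<Rightarrow> (nat \<times> nat) list set" where
  "G_indices r k l =
     {J. length J = r
       \<and> set J \<subseteq> {0..k} \<times> {0..l}
       \<and> (\<forall>(a, b)\<in>set J. a + b \<ge> 1)
       \<and> (\<Sum>i<r. fst (J ! i)) = k \<and> (\<Sum>i<r. snd (J ! i)) = l
       \<and> (\<forall>i<r. \<forall>j<i.
            fst (J ! i) + snd (J ! i) \<ge> fst (J ! j) + snd (J ! j)
          \<and> (fst (J ! i) + snd (J ! i) = fst (J ! j) + snd (J ! j) \<longrightarrow> fst (J ! i) \<ge> fst (J ! j)))
       \<and> (\<forall>(a, b)\<in>set J. (a = 0 \<longrightarrow> b = 1) \<and> (b = 0 \<longrightarrow> a = 1))}"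

definition G_factorial :: "nat \<Rightarrow> nat \<Rightarrow> (nat \<times> nat) list \<Rightarrow> nat" where
  "G_factorial k l J = (\<Prod>p\<in>{0..k} \<times> {0..l}. fact (count_list J p))"

definition all_indices :: "nat \<Rightarrow> nat \<Rightarrow> nat \<Rightarrow> (nat \<times> nat) list set" where
  "all_indices r k l =
     {J. length J = r
       \<and> (\<forall>(a, b)\<in>set J. a + b \<ge> 1)
       \<and> (\<Sum>i<r. fst (J ! i)) = k \<and> (\<Sum>i<r. snd (J ! i)) = l}"

text \<open>The list \<open>J\<close> is indexed from 0, whereas \<open>\<xi>\<close> and \<open>\<eta>\<close> are indexed from 1.\<close>

definition bch_product ::
  "('k::ring_1 \<Rightarrow> 'g \<Rightarrow> 'g::ab_group_add) \<Rightarrow> ('g \<Rightarrow> 'g \<Rightarrow> 'g) \<Rightarrow> (nat \<Rightarrow> nat \<Rightarrow> lie_word \<Rightarrow>\<^sub>0 'k)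
     \<Rightarrow> (nat \<Rightarrow> 'g) \<Rightarrow> (nat \<Rightarrow> 'g) \<Rightarrow> (nat \<times> nat) list \<Rightarrow> ('g, 'k) ncs set" where
  "bch_product scale br E \<xi> \<eta> J =
     (\<Otimes>\<^bsub>sym_algebra scale\<^esub>i\<in>{..<length J}. sym_incl scale
        (bch_tilde scale br E (fst (J ! i)) (snd (J ! i))
          (\<lambda>m. \<xi> ((\<Sum>j<i. fst (J ! j)) + m)) (\<lambda>m. \<eta> ((\<Sum>j<i. snd (J ! j)) + m))))"

definition sym_product ::
  "('k::ring_1 \<Rightarrow> 'g \<Rightarrow> 'g::ab_group_add) \<Rightarrow> nat \<Rightarrow> (nat \<Rightarrow> 'g) \<Rightarrow> ('g, 'k) ncs set" where
  "sym_product scale k \<xi> = (\<Otimes>\<^bsub>sym_algebra scale\<^esub>i\<in>{1..k}. sym_incl scale (\<xi> i))"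

definition gutt_C ::
  "('k::field_char_0 \<Rightarrow> 'g \<Rightarrow> 'g::ab_group_add) \<Rightarrow> ('g \<Rightarrow> 'g \<Rightarrow> 'g) \<Rightarrow> (nat \<Rightarrow> nat \<Rightarrow> lie_word \<Rightarrow>\<^sub>0 'k)
     \<Rightarrow> nat \<Rightarrow> nat \<Rightarrow> (nat \<Rightarrow> 'g) \<Rightarrow> (nat \<Rightarrow> 'g) \<Rightarrow> nat \<Rightarrow> ('g, 'k) ncs set" where
  "gutt_C scale br E k l \<xi> \<eta> n =
     (\<Oplus>\<^bsub>sym_algebra scale\<^esub>J\<in>G_indices (k + l - n) k l.
        sym_smult scale (1 / of_nat (G_factorial k l J))
          (\<Oplus>\<^bsub>sym_algebra scale\<^esub>\<sigma>\<in>{\<sigma>. \<sigma> permutes {1..k}}.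
           \<Oplus>\<^bsub>sym_algebra scale\<^esub>\<tau>\<in>{\<tau>. \<tau> permutes {1..l}}.
             bch_product scale br E (\<xi> \<circ> \<sigma>) (\<eta> \<circ> \<tau>) J))"

end

theory Submission
  imports Defs "HOL-Computational_Algebra.Formal_Power_Series" "HOL-Computational_Algebra.Polynomial"
    "HOL-Combinatorics.Multiset_Permutations"
begin

text \<open>
  The free algebra is the ring of finitely supported functions on words, and congruences modulo the
  ideals of relations replace computations in the quotients.

  The map \<open>q\<close> is injective because the symmetric algebra carries a representation of the Lie
  algebra with \<open>x\<cdot>h\<^sup>n = \<Sum>\<^sub>j (n choose j) B\<^sub>j (ad h)\<^sup>j x h\<^bsup>n-j\<^esup>\<close>, \<open>B\<^sub>j\<close> the Bernoulli numbers: applied to 1, a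
  symmetrized monomial of degree \<open>n\<close> gives that monomial up to terms of degree below \<open>n\<close>. That
  this is a representation comes down to Euler's quadratic identity for the Bernoulli numbers.

  The identity \<open>exp X exp Y = exp BCH(X, Y)\<close> of noncommutative series is evaluated in the
  enveloping algebra at the generic elements \<open>X = \<Sum>\<^sub>i s\<^sub>i \<xi>\<^sub>i\<close>, \<open>Y = \<Sum>\<^sub>j t\<^sub>j \<eta>\<^sub>j\<close>, with commuting \<open>s\<^sub>i\<close>, \<open>t\<^sub>j\<close>
  of square zero, and the coefficients of the product of all \<open>s\<^sub>i\<close> and \<open>t\<^sub>j\<close> are compared. On the
  left this coefficient is \<open>q(\<xi>\<^sub>1 \<dots> \<xi>\<^sub>k) \<odot> q(\<eta>\<^sub>1 \<dots> \<eta>\<^sub>l)\<close>; on the right it is a sum over ordered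
  partitions of the set of all \<open>\<xi>\<^sub>i\<close> and \<open>\<eta>\<^sub>j\<close>, which is invariant under permutation of the parts
  and hence the symmetrization of the same sum formed in the symmetric algebra. Grouping the ordered
  partitions by the sizes of their parts gives the second formula, and grouping these further up to
  order gives the first.
\<close>

instantiation list :: (type) monoid_add
begin

definition zero_list :: "'a list" where "zero_list = []"

definition plus_list :: "'a list \<Rightarrow> 'a list \<Rightarrow> 'a list" where "plus_list = (@)"

instance
  by standard (simp_all add: zero_list_def plus_list_def)

end

type_synonym ('a, 'k) ncpoly = "'a list \<Rightarrow>\<^sub>0 'k"

abbreviation coef :: "('a \<Rightarrow>\<^sub>0 'b::zero) \<Rightarrow> 'a \<Rightarrow> 'b" where
  "coef \<equiv> Poly_Mapping.lookup"

abbreviation perms :: "'a set \<Rightarrow> 'a list set" where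
  "perms \<equiv> permutations_of_set"

abbreviation mon :: "'a list \<Rightarrow> 'a list \<Rightarrow>\<^sub>0 'k::zero_neq_one" where
  "mon w \<equiv> Poly_Mapping.single w 1"

definition sc :: "'k::ring_1 \<Rightarrow> (('a, 'k) ncpoly) \<Rightarrow> (('a, 'k) ncpoly)" where
  "sc c p = Poly_Mapping.single [] c * p"

lemma single_mult: "Poly_Mapping.single u a * Poly_Mapping.single v b = Poly_Mapping.single (u @ v) (a * b)"
  for a b :: "'k::semiring_0"
  by (simp add: mult_single plus_list_def)

lemma mon_mult: "mon u * mon v = (mon (u @ v) :: 'a list \<Rightarrow>\<^sub>0 'k::semiring_1)"
  by (simp add: single_mult)

lemma mon_Nil: "mon [] = (1 :: 'a list \<Rightarrow>\<^sub>0 'k::semiring_1)"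
  by (metis single_one zero_list_def)

lemma sum_single: "(\<Sum>w\<in>Poly_Mapping.keys p. Poly_Mapping.single w (coef p w)) = p"
  by (rule poly_mapping_eqI) (simp add: lookup_sum lookup_single in_keys_iff when_def)

lemma poly_mapping_additive_induct [consumes 0, case_names single add zero]:
  assumes "\<And>w c. P (Poly_Mapping.single w c)"
    and "\<And>p q. P p \<Longrightarrow> P q \<Longrightarrow> P (p + q)" and "P 0"
  shows "P (p :: 'a \<Rightarrow>\<^sub>0 'k::comm_monoid_add)"
proof -
  have "P (\<Sum>w\<in>A. Poly_Mapping.single w (coef p w))" if "finite A" for A
    using that by (induction A rule: finite_induct) (use assms in auto)
  then show ?thesis by (metis sum_single finite_keys)
qed

lemma lookup_mult_list:
  fixes p q :: "'a list \<Rightarrow>\<^sub>0 'k::semiring_0"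
  shows "coef (p * q) = ncs_mult (coef p) (coef q)"
proof (induction p rule: poly_mapping_additive_induct)
  case (single u a)
  show ?case
  proof (induction q rule: poly_mapping_additive_induct)
    case (single v b)
    show ?case
    proof
      fix w
      have "ncs_mult (coef (Poly_Mapping.single u a)) (coef (Poly_Mapping.single v b)) w
        = (\<Sum>i\<le>length w. if w = u @ v \<and> i = length u then a * b else 0)"
        unfolding ncs_mult_def
      proof (rule sum.cong)
        fix i assume "i \<in> {..length w}"
        then have "(u = take i w \<and> v = drop i w) \<longleftrightarrow> w = u @ v \<and> i = length u" by auto
        then show "coef (Poly_Mapping.single u a) (take i w) *
            coef (Poly_Mapping.single v b) (drop i w) = (if w = u @ v \<and> i = length u then a * b else 0)"
          by (auto simp: lookup_single when_def)
      qed simp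
      also have "\<dots> = coef (Poly_Mapping.single (u @ v) (a * b)) w"
        by (auto simp: lookup_single when_def)
      finally show "coef (Poly_Mapping.single u a * Poly_Mapping.single v b) w =
          ncs_mult (coef (Poly_Mapping.single u a)) (coef (Poly_Mapping.single v b)) w"
        by (simp add: single_mult)
    qed
  next
    case (add p q)
    then show ?case
      by (simp add: fun_eq_iff ncs_mult_def distrib_left lookup_add sum.distrib)
  next
    case zero
    then show ?case by (simp add: fun_eq_iff ncs_mult_def)
  qed
next
  case (add p q)
  then show ?case
    by (simp add: fun_eq_iff ncs_mult_def distrib_right lookup_add sum.distrib)
next
  case zero
  then show ?case by (simp add: fun_eq_iff ncs_mult_def)
qed

lemma lookup_one_list: "coef (1 :: 'a list \<Rightarrow>\<^sub>0 'k::zero_neq_one) = ncs_const 1"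
  by (auto simp: lookup_one ncs_const_def zero_list_def when_def)

lemma lookup_mon: "coef (mon w :: 'a list \<Rightarrow>\<^sub>0 'k::zero_neq_one) = ncs_monom w"
  by (auto simp: lookup_single ncs_monom_def when_def)

lemma lookup_sc [simp]: "coef (sc c p) w = c * coef p w"
proof -
  have "coef (sc c p) w = (\<Sum>i\<le>length w. if i = 0 then c * coef p w else 0)"
    unfolding sc_def lookup_mult_list ncs_mult_def
    by (rule sum.cong) (auto simp: lookup_single when_def)
  then show ?thesis by simp
qed

lemma sc_mult_left: "sc c p * q = sc c (p * q)"
  by (simp add: sc_def mult.assoc)

lemma sc_mult_right: "p * sc c q = sc (c::'k::comm_ring_1) (p * q)"
  by (rule poly_mapping_eqI)
    (simp add: lookup_mult_list ncs_mult_def sum_distrib_left mult_ac)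

lemma sc_single: "sc c (Poly_Mapping.single w d) = Poly_Mapping.single w (c * d)"
  by (simp add: sc_def single_mult)

lemma vector_space_sc: "vector_space (sc :: 'k::field \<Rightarrow> (('a, 'k) ncpoly) \<Rightarrow> _)"
  by standard (auto intro!: poly_mapping_eqI simp: lookup_add algebra_simps)

interpretation nc: vector_space "sc :: 'k::field \<Rightarrow> (('a, 'k) ncpoly) \<Rightarrow> _"
  by (rule vector_space_sc)

interpretation ncp: vector_space_pair "sc :: 'k::field \<Rightarrow> (('a, 'k) ncpoly) \<Rightarrow> _" "sc :: 'k::field \<Rightarrow> (('b, 'k) ncpoly) \<Rightarrow> _"
  by (simp add: vector_space_pair_def vector_space_sc)

abbreviation nclinear :: "(('a list \<Rightarrow>\<^sub>0 'k::field) \<Rightarrow> (('b, 'k) ncpoly)) \<Rightarrow> bool" where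
  "nclinear \<equiv> Vector_Spaces.linear sc sc"

lemma nclinearI:
  assumes "\<And>p q. \<phi> (p + q) = \<phi> p + \<phi> q" and "\<And>c p. \<phi> (sc c p) = sc c (\<phi> p)"
  shows "nclinear (\<phi> :: ('a list \<Rightarrow>\<^sub>0 'k::field) \<Rightarrow> (('b, 'k) ncpoly))"
  unfolding Vector_Spaces.linear_iff using assms by (simp add: vector_space_sc)

lemmas nclinear_simps = ncp.linear_add ncp.linear_diff ncp.linear_scale ncp.linear_sum ncp.linear_0

definition lin :: "('a list \<Rightarrow> ('b list \<Rightarrow>\<^sub>0 'k::field)) \<Rightarrow> (('a, 'k) ncpoly) \<Rightarrow> (('b, 'k) ncpoly)" where
  "lin \<phi> p = (\<Sum>w\<in>Poly_Mapping.keys p. sc (coef p w) (\<phi> w))"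

lemma lin_superset:
  assumes "finite A" "Poly_Mapping.keys p \<subseteq> A"
  shows "lin \<phi> p = (\<Sum>w\<in>A. sc (coef p w) (\<phi> w))"
  unfolding lin_def using assms
  by (intro sum.mono_neutral_left) (auto simp: in_keys_iff nc.scale_zero_left)

lemma linear_lin: "nclinear (lin (\<phi> :: 'a list \<Rightarrow> ('b list \<Rightarrow>\<^sub>0 'k::field)))"
proof (rule nclinearI)
  fix p q :: "('a, 'k) ncpoly" and c
  let ?A = "Poly_Mapping.keys p \<union> Poly_Mapping.keys q"
  have "Poly_Mapping.keys (p + q) \<subseteq> ?A" by (rule keys_add)
  then show "lin \<phi> (p + q) = lin \<phi> p + lin \<phi> q"
    by (simp add: lin_superset[of ?A] lookup_add nc.scale_left_distrib sum.distrib)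
  have "Poly_Mapping.keys (sc c p) \<subseteq> ?A" by (auto simp: in_keys_iff)
  then show "lin \<phi> (sc c p) = sc c (lin \<phi> p)"
    by (simp add: lin_superset[of ?A] nc.scale_sum_right)
qed

lemma lin_mon [simp]: "lin \<phi> (mon w) = \<phi> w"
  by (simp add: lin_def)

lemma expand_mon: "(p :: 'a list \<Rightarrow>\<^sub>0 'k::field) = (\<Sum>w\<in>Poly_Mapping.keys p. sc (coef p w) (mon w))"
  by (simp add: sc_single sum_single)

lemma nclinear_expand:
  assumes "nclinear \<phi>"
  shows "\<phi> p = (\<Sum>w\<in>Poly_Mapping.keys p. sc (coef p w) (\<phi> (mon w)))"
  by (subst (1) expand_mon[of p]) (simp add: ncp.linear_sum[OF assms] ncp.linear_scale[OF assms])

inductive_set gen_ideal :: "('a list \<Rightarrow>\<^sub>0 'k::field) set \<Rightarrow> (('a, 'k) ncpoly) set" for R where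
  gen: "r \<in> R \<Longrightarrow> p * r * q \<in> gen_ideal R"
| zero: "0 \<in> gen_ideal R"
| add: "a \<in> gen_ideal R \<Longrightarrow> b \<in> gen_ideal R \<Longrightarrow> a + b \<in> gen_ideal R"

lemma gen_ideal_base: "r \<in> R \<Longrightarrow> r \<in> gen_ideal R"
  using gen_ideal.gen[of r R 1 1] by simp

lemma gen_ideal_mult: "a \<in> gen_ideal R \<Longrightarrow> p * a * q \<in> gen_ideal R"
proof (induction rule: gen_ideal.induct)
  case (gen r p' q')
  have "p * (p' * r * q') * q = (p * p') * r * (q' * q)" by (simp add: mult.assoc)
  then show ?case using gen_ideal.gen[OF gen] by metis
qed (auto simp: algebra_simps intro: gen_ideal.intros)

lemma gen_ideal_mult_left: "a \<in> gen_ideal R \<Longrightarrow> p * a \<in> gen_ideal R"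
  using gen_ideal_mult[of a R p 1] by simp

lemma gen_ideal_mult_right: "a \<in> gen_ideal R \<Longrightarrow> a * p \<in> gen_ideal R"
  using gen_ideal_mult[of a R 1 p] by simp

lemma gen_ideal_subspace: "nc.subspace (gen_ideal R)"
  unfolding nc.subspace_def
  by (auto intro: gen_ideal.intros simp: sc_def gen_ideal_mult_left)

lemma gen_ideal_mono: "R \<subseteq> R' \<Longrightarrow> gen_ideal R \<subseteq> gen_ideal R'"
proof
  fix x assume "R \<subseteq> R'" "x \<in> gen_ideal R"
  from this(2) show "x \<in> gen_ideal R'"
    by (induction rule: gen_ideal.induct) (use \<open>R \<subseteq> R'\<close> in \<open>auto intro: gen_ideal.intros\<close>)
qed

lemma gen_ideal_linear_image:
  assumes lin: "nclinear \<phi>" and N: "nc.subspace N"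
    and gens: "\<And>u r v. r \<in> R \<Longrightarrow> \<phi> (mon u * r * mon v) \<in> N"
    and x: "x \<in> gen_ideal R"
  shows "\<phi> x \<in> N"
  using x
proof (induction rule: gen_ideal.induct)
  case (gen r p q)
  have 1: "nclinear (\<lambda>p. \<phi> (p * r * q))" for q
    by (rule nclinearI)
      (simp_all add: ring_distribs sc_mult_left ncp.linear_add[OF lin] ncp.linear_scale[OF lin])
  have 2: "nclinear (\<lambda>q. \<phi> (p * r * q))" for p
    by (rule nclinearI)
      (simp_all add: ring_distribs sc_mult_right ncp.linear_add[OF lin] ncp.linear_scale[OF lin])
  have "\<phi> (mon u * r * q) \<in> N" for u
    by (subst nclinear_expand[OF 2]) (intro nc.subspace_sum[OF N] nc.subspace_scale[OF N] gens gen)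
  then show ?case
    by (subst nclinear_expand[OF 1]) (intro nc.subspace_sum[OF N] nc.subspace_scale[OF N])
qed (use N lin in \<open>auto simp: nclinear_simps nc.subspace_0 nc.subspace_add\<close>)

subsection \<open>Bernoulli numbers\<close>

definition bern :: "nat \<Rightarrow> 'k::field_char_0" where
  "bern n = fps_nth (inverse (Abs_fps (\<lambda>n. 1 / fact (Suc n)))) n"

lemma bern_0 [simp]: "bern 0 = 1"
  by (simp add: bern_def)

definition bern_fps :: "'k::field_char_0 \<Rightarrow> 'k fps" where
  "bern_fps a = Abs_fps (\<lambda>n. bern n * a ^ n)"

lemma bern_fps_mult: "bern_fps a * (fps_exp a - 1) = fps_const a * fps_X"
proof -
  let ?E = "Abs_fps (\<lambda>n. 1 / fact (Suc n)) :: 'a fps"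
  have E: "fps_X * ?E = fps_exp 1 - 1"
    by (rule fps_ext) (auto simp: fps_X_mult_nth fact_reduce)
  have "Abs_fps bern = inverse ?E"
    by (rule fps_ext) (simp add: bern_def)
  moreover have "inverse ?E * ?E = 1" by (rule inverse_mult_eq_1) simp
  ultimately have "Abs_fps bern * (fps_exp 1 - 1) = (fps_X :: 'a fps)"
    unfolding E[symmetric] by (metis mult.left_commute mult.right_neutral)
  then have "(Abs_fps bern * (fps_exp 1 - 1)) oo (fps_const a * fps_X) = fps_X oo (fps_const a * fps_X)"
    by simp
  then have "(Abs_fps bern oo (fps_const a * fps_X)) * ((fps_exp 1 oo (fps_const a * fps_X)) - 1) = fps_const a * fps_X"
    by (subst (asm) fps_compose_mult_distrib) (simp_all add: fps_compose_sub_distrib)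
  moreover have "Abs_fps bern oo (fps_const a * fps_X) = bern_fps a"
    unfolding fps_compose_linear by (simp add: bern_fps_def mult.commute)
  moreover have "fps_exp 1 oo (fps_const a * fps_X) = fps_exp a"
    using fps_exp_compose_linear[of 1 a] by simp
  ultimately show ?thesis by simp
qed

lemma bern_fps_functional_equation:
  fixes a :: "'k::field_char_0"
  assumes "a \<noteq> 0" "a + 1 \<noteq> 0"
  shows "bern_fps a * bern_fps (a + 1) + fps_const a * (bern_fps 1 * bern_fps (a + 1))
    - fps_const (a + 1) * (bern_fps a * bern_fps 1) = - (fps_const a * (fps_X * bern_fps (a + 1)))"
proof -
  let ?A = "fps_exp a - 1" and ?B = "fps_exp 1 - 1 :: 'k fps" and ?D = "fps_exp (a + 1) - 1"
  let ?c = "fps_const a"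
  have nz: "?A * (?B * ?D) \<noteq> 0"
  proof -
    have "fps_exp c - 1 \<noteq> 0" if "c \<noteq> 0" for c :: 'k
    proof
      assume "fps_exp c - 1 = 0"
      then have "fps_nth (fps_exp c - 1) 1 = 0" by (metis fps_zero_nth)
      with that show False by simp
    qed
    then show ?thesis using assms by simp
  qed
  have D: "?D = ?A * ?B + ?A + ?B"
    by (simp add: fps_exp_add_mult algebra_simps)
  have c: "fps_const (a + 1) = ?c + 1" by (simp add: fps_const_add[symmetric] del: fps_const_add)
  have fa: "bern_fps a * ?A = ?c * fps_X" and fb: "bern_fps 1 * ?B = fps_X"
    and fs: "bern_fps (a + 1) * ?D = (?c + 1) * fps_X"
    using bern_fps_mult[of a] bern_fps_mult[of "1::'k"] bern_fps_mult[of "a + 1"] by (simp_all add: c del: fps_const_add)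
  define Fa Fb Fs A B D X c where defs: "Fa = bern_fps a" "Fb = bern_fps (1::'k)" "Fs = bern_fps (a + 1)"
    "A = ?A" "B = ?B" "D = ?D" "X = (fps_X :: 'k fps)" "c = ?c"
  note f = fa[folded defs] fb[folded defs] fs[folded defs] D[folded defs]
  have "(Fa * Fs + c * (Fb * Fs) - (c + 1) * (Fa * Fb)) * (A * (B * D))
    = (Fa * A) * (Fs * D) * B + c * (Fb * B) * (Fs * D) * A - (c + 1) * (Fa * A) * (Fb * B) * D"
    by (simp add: algebra_simps)
  also have "\<dots> = c * X * ((c + 1) * X) * B + c * X * ((c + 1) * X) * A - (c + 1) * (c * X) * X * D"
    by (simp only: f(1-3))
  also have "\<dots> = - (c * (X * ((c + 1) * X))) * (A * B)"
    by (simp add: f(4) algebra_simps)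
  also have "\<dots> = - (c * (X * (Fs * D))) * (A * B)"
    by (simp only: f(3))
  also have "\<dots> = - (c * (X * Fs)) * (A * (B * D))"
    by (simp add: algebra_simps)
  finally have "(Fa * Fs + c * (Fb * Fs) - (c + 1) * (Fa * Fb)) * (A * (B * D)) = - (c * (X * Fs)) * (A * (B * D))" .
  moreover have "A * (B * D) \<noteq> 0" unfolding defs by (rule nz)
  ultimately have "Fa * Fs + c * (Fb * Fs) - (c + 1) * (Fa * Fb) = - (c * (X * Fs))"
    by (metis mult_right_cancel)
  then show ?thesis by (simp only: defs \<open>fps_const (a + 1) = ?c + 1\<close>)
qed

lemma bern_fps_nth: "fps_nth (bern_fps a) n = bern n * a ^ n"
  by (simp add: bern_fps_def)

lemma bern_fps_mult_nth:
  "fps_nth (bern_fps a * bern_fps c) n = (\<Sum>p\<le>n. (bern p * a ^ p) * (bern (n - p) * c ^ (n - p)))"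
  by (simp add: fps_mult_nth bern_fps_def atLeast0AtMost)

text \<open>The functional equation of the Bernoulli generating series in two variables, homogenized
  by setting the second variable to 1 and compared coefficientwise as a polynomial in the first.\<close>

lemma bern_euler_identity:
  fixes m s :: nat
  assumes "s \<le> m"
  shows "(\<Sum>p\<le>s. bern p * bern (m + 1 - p) * of_nat ((m + 1 - p) choose (s + 1 - p)))
    + (\<Sum>p\<le>m - s. bern p * bern (m + 1 - p) * of_nat ((m + 1 - p) choose s))
    = - (bern m * of_nat (m choose s) :: 'k::field_char_0)"
proof -
  define L :: "'k poly" where "L = [:1, 1:]"
  define M where "M = m + 1"
  define Q where "Q = (\<Sum>p\<le>M. smult (bern p * bern (M - p))
     (monom 1 p * L ^ (M - p) + monom 1 1 * L ^ (M - p) - L * monom 1 p)) + smult (bern m) (monom 1 1 * L ^ m)"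
  have coL: "coeff (L ^ n) j = of_nat (n choose j)" for n j
    unfolding L_def by (cases "j \<le> n") (simp_all add: coeff_linear_poly_power coeff_eq_0 degree_power_eq)
  have *: "poly Q a = 0" if "a \<noteq> 0" "a + 1 \<noteq> 0" for a
  proof -
    have "(\<Sum>p\<le>M. (bern p * a ^ p) * (bern (M - p) * (a + 1) ^ (M - p)))
       + a * (\<Sum>p\<le>M. bern p * (bern (M - p) * (a + 1) ^ (M - p)))
       - (a + 1) * (\<Sum>p\<le>M. (bern p * a ^ p) * bern (M - p)) = - (a * (bern m * (a + 1) ^ m))"
      using arg_cong[OF bern_fps_functional_equation[OF that], of "\<lambda>f. fps_nth f M"]
      by (simp add: bern_fps_mult_nth fps_X_mult_nth M_def bern_fps_nth del: sum.atMost_Suc fps_const_add)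
    then show ?thesis
      by (simp add: Q_def L_def poly_sum poly_monom algebra_simps sum.distrib sum_subtractf sum_distrib_left)
  qed
  have "poly ([:0, 1:] * [:1, 1:] * Q) a = poly 0 a" for a
  proof -
    have "poly ([:0, 1:] * [:1, 1:] * Q) a = a * ((a + 1) * poly Q a)" by (simp add: algebra_simps)
    moreover have "a * ((a + 1) * poly Q a) = 0"
      using *[of a] by (metis mult_eq_0_iff)
    ultimately show ?thesis by simp
  qed
  then have "[:0, 1:] * [:1, 1:] * Q = 0" by (metis poly_eq_poly_eq_iff ext)
  then have "Q = 0" by (metis mult_eq_0_iff pCons_eq_0_iff one_neq_zero)
  then have "coeff Q (s + 1) = 0" by simp
  moreover have "coeff Q (s + 1) = (\<Sum>p\<le>M. bern p * bern (M - p) *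
       ((if p \<le> s + 1 then of_nat ((M - p) choose (s + 1 - p)) else 0) + of_nat ((M - p) choose s)
        - ((if p = s + 1 then 1 else 0) + (if p = s then 1 else 0)))) + bern m * of_nat (m choose s)"
    unfolding Q_def coeff_add coeff_sum coeff_smult coeff_diff
  proof (intro arg_cong2[of _ _ _ _ "(+)"] sum.cong refl arg_cong2[of _ _ _ _ "(*)"] arg_cong2[of _ _ _ _ "(-)"])
    fix p
    show "coeff (monom 1 p * L ^ (M - p)) (s + 1) = (if p \<le> s + 1 then of_nat (M - p choose (s + 1 - p)) else 0)"
      by (simp add: coeff_monom_mult coL)
    show "coeff (monom 1 1 * L ^ (M - p)) (s + 1) = of_nat (M - p choose s)"
      by (simp add: coeff_monom_mult coL)
    show "coeff (L * monom 1 p) (s + 1) = (if p = s + 1 then 1 else 0) + (if p = s then 1 else 0)"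
      by (auto simp: L_def coeff_pCons split: nat.splits)
    show "coeff (monom 1 1 * L ^ m) (s + 1) = of_nat (m choose s)"
      by (simp add: coeff_monom_mult coL)
  qed
  moreover have "(\<Sum>p\<le>M. bern p * bern (M - p) *
       ((if p \<le> s + 1 then of_nat ((M - p) choose (s + 1 - p)) else 0) + of_nat ((M - p) choose s)
        - ((if p = s + 1 then 1 else 0) + (if p = s then 1 else 0))))
    = (\<Sum>p\<le>M. if p \<le> s + 1 then bern p * bern (M - p) * of_nat ((M - p) choose (s + 1 - p)) else (0::'k))
     + (\<Sum>p\<le>M. bern p * bern (M - p) * of_nat ((M - p) choose s))
     - bern (s + 1) * bern (M - (s + 1)) - bern s * bern (M - s)"
  proof -
    have q: "(\<Sum>p\<le>M. bern p * bern (M - p) * (if p = q then 1 else 0)) = bern q * (bern (M - q) :: 'k)" if "q \<le> M" for q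
    proof -
      have "(\<Sum>p\<le>M. bern p * bern (M - p) * (if p = q then 1 else 0)) = (\<Sum>p\<le>M. if p = q then bern p * bern (M - p) else (0::'k))"
        by (rule sum.cong) auto
      with that show ?thesis by simp
    qed
    have "(\<Sum>p\<le>M. bern p * bern (M - p) * (if p = s + 1 then 1 else 0)) = bern (s + 1) * (bern (M - (s + 1)) :: 'k)"
      "(\<Sum>p\<le>M. bern p * bern (M - p) * (if p = s then 1 else 0)) = bern s * (bern (M - s) :: 'k)"
      by (intro q, use assms in \<open>simp add: M_def\<close>)+
    moreover have "(\<Sum>p\<le>M. bern p * bern (M - p) * (if p \<le> s + 1 then of_nat ((M - p) choose (s + 1 - p)) else 0)) =
      (\<Sum>p\<le>M. if p \<le> s + 1 then bern p * bern (M - p) * of_nat ((M - p) choose (s + 1 - p)) else (0::'k))"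
      by (rule sum.cong) auto
    ultimately show ?thesis
      by (simp only: distrib_left right_diff_distrib sum.distrib sum_subtractf) simp
  qed
  moreover have "(\<Sum>p\<le>M. if p \<le> s + 1 then bern p * bern (M - p) * of_nat ((M - p) choose (s + 1 - p)) else (0::'k))
     = (\<Sum>p\<le>s. bern p * bern (M - p) * of_nat ((M - p) choose (s + 1 - p))) + bern (s + 1) * bern (M - (s + 1))"
  proof -
    have "{..M} \<inter> {p. p \<le> s + 1} = {..Suc s}" using assms by (auto simp: M_def)
    then have "(\<Sum>p\<le>M. if p \<le> s + 1 then bern p * bern (M - p) * of_nat ((M - p) choose (s + 1 - p)) else (0::'k))
      = (\<Sum>p\<le>Suc s. bern p * bern (M - p) * of_nat ((M - p) choose (s + 1 - p)))"
      by (simp add: sum.If_cases del: sum.atMost_Suc)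
    then show ?thesis by simp
  qed
  moreover have "(\<Sum>p\<le>M. bern p * bern (M - p) * of_nat ((M - p) choose s))
     = (\<Sum>p\<le>m - s. bern p * bern (M - p) * of_nat ((M - p) choose s)) + bern s * (bern (M - s) :: 'k)"
  proof -
    have "(\<Sum>p\<le>M. bern p * bern (M - p) * of_nat ((M - p) choose s))
       = (\<Sum>p\<le>Suc (m - s). bern p * bern (M - p) * of_nat ((M - p) choose s) :: 'k)"
      using assms by (intro sum.mono_neutral_right) (auto simp: M_def binomial_eq_0)
    then show ?thesis using assms by (simp add: M_def Suc_diff_le mult.commute)
  qed
  ultimately show ?thesis unfolding M_def by (simp add: algebra_simps add_eq_0_iff)
qed

subsection \<open>The vector fields of left multiplication\<close>

text \<open>\<open>ssum f w\<close> is the sum of \<open>f a b\<close> over all ways to distribute the letters of \<open>w\<close> to two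
  subwords \<open>a\<close> and \<open>b\<close>.\<close>

primrec ssum :: "('a list \<Rightarrow> 'a list \<Rightarrow> 'b::comm_monoid_add) \<Rightarrow> 'a list \<Rightarrow> 'b" where
  "ssum f [] = f [] []"
| "ssum f (x # w) = ssum (\<lambda>a b. f (x # a) b) w + ssum (\<lambda>a b. f a (x # b)) w"

lemma ssum_cong:
  assumes "\<And>a b. length a + length b = length w \<Longrightarrow> f a b = g a b"
  shows "ssum f w = ssum g w"
  using assms
proof (induction w arbitrary: f g)
  case (Cons x w)
  have "ssum (\<lambda>a b. f (x # a) b) w = ssum (\<lambda>a b. g (x # a) b) w"
    by (rule Cons.IH) (simp add: Cons.prems)
  moreover have "ssum (\<lambda>a b. f a (x # b)) w = ssum (\<lambda>a b. g a (x # b)) w"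
    by (rule Cons.IH) (simp add: Cons.prems)
  ultimately show ?case by simp
qed simp

lemma ssum_zero [simp]: "ssum (\<lambda>a b. 0) w = 0"
  by (induction w) auto

lemma ssum_add: "ssum (\<lambda>a b. f a b + g a b) w = ssum f w + ssum g w"
  by (induction w arbitrary: f g) (simp_all add: add_ac)

lemma ssum_sum: "ssum (\<lambda>a b. \<Sum>i\<in>I. f i a b) w = (\<Sum>i\<in>I. ssum (f i) w)"
  by (induction w arbitrary: f) (simp_all add: sum.distrib)

lemma ssum_swap: "ssum (\<lambda>a b. f b a) w = ssum f w"
proof (induction w arbitrary: f)
  case (Cons x w)
  show ?case
    using Cons.IH[of "\<lambda>a b. f (x # a) b"] Cons.IH[of "\<lambda>a b. f a (x # b)"] by (simp add: add.commute)
qed simp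

lemma ssum_assoc:
  "ssum (\<lambda>a c. ssum (\<lambda>b d. f a b d) c) w = ssum (\<lambda>c d. ssum (\<lambda>a b. f a b d) c) w"
  by (induction w arbitrary: f) (simp_all add: ssum_add add_ac)

lemma ssum_append: "ssum f (u @ v) = ssum (\<lambda>a b. ssum (\<lambda>c d. f (a @ c) (b @ d)) v) u"
  by (induction u arbitrary: f) simp_all

lemma ssum_additive:
  assumes "\<And>x y. h (x + y) = h x + h y"
  shows "h (ssum f w) = ssum (\<lambda>a b. h (f a b)) w"
  by (induction w arbitrary: f) (simp_all add: assms)

lemma ssum_diff: "ssum (\<lambda>a b. f a b - g a b :: 'b::ab_group_add) w = ssum f w - ssum g w"
  using ssum_add[of "\<lambda>a b. f a b - g a b" g w] by simp

lemma ssum_minus: "ssum (\<lambda>a b. - f a b :: 'b::ab_group_add) w = - ssum f w"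
  using ssum_diff[of "\<lambda>a b. 0" f w] by simp

lemma ssum_mem:
  assumes "\<And>x y. x \<in> N \<Longrightarrow> y \<in> N \<Longrightarrow> x + y \<in> N"
    and "\<And>a b. length a + length b = length w \<Longrightarrow> f a b \<in> N"
  shows "ssum f w \<in> N"
  using assms(2)
proof (induction w arbitrary: f)
  case (Cons x w)
  show ?case unfolding ssum.simps by (intro assms(1) Cons.IH) (simp_all add: Cons.prems)
qed simp

lemma ssum_first_Nil:
  fixes f :: "'a list \<Rightarrow> 'a list \<Rightarrow> 'b::ab_group_add"
  assumes "0 \<in> N" "\<And>x y. x \<in> N \<Longrightarrow> y \<in> N \<Longrightarrow> x + y \<in> N"
    and "\<And>a b. length a + length b = length w \<Longrightarrow> a \<noteq> [] \<Longrightarrow> f a b \<in> N"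
  shows "ssum f w - f [] w \<in> N"
  using assms(3)
proof (induction w arbitrary: f)
  case (Cons x w)
  have "ssum (\<lambda>a b. f (x # a) b) w \<in> N"
    by (rule ssum_mem) (simp_all add: Cons.prems assms(2))
  moreover have "ssum (\<lambda>a b. f a (x # b)) w - f [] (x # w) \<in> N"
    by (rule Cons.IH) (simp_all add: Cons.prems)
  ultimately have "ssum (\<lambda>a b. f (x # a) b) w + (ssum (\<lambda>a b. f a (x # b)) w - f [] (x # w)) \<in> N"
    by (rule assms(2))
  then show ?case by (simp add: algebra_simps)
qed (simp add: assms)

locale lie_algebra_char_0 = lie_algebra scale bracket
  for scale :: "'k::field_char_0 \<Rightarrow> 'g::ab_group_add \<Rightarrow> 'g" and bracket
begin

lemma bracket_add_left: "bracket (x + y) z = bracket x z + bracket y z"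
  and bracket_scale_left: "bracket (scale c x) z = scale c (bracket x z)"
  using linear_left[of z] by (simp_all add: Vector_Spaces.linear_iff)

lemma bracket_add_right: "bracket z (x + y) = bracket z x + bracket z y"
  and bracket_scale_right: "bracket z (scale c x) = scale c (bracket z x)"
  using linear_right[of z] by (simp_all add: Vector_Spaces.linear_iff)

lemma bracket_zero_left [simp]: "bracket 0 x = 0"
  and bracket_zero_right [simp]: "bracket x 0 = 0"
  using bracket_add_left[of 0 0 x] bracket_add_right[of x 0 0] by simp_all

lemma bracket_anti: "bracket x y = - bracket y x"
proof -
  have "bracket (x + y) (x + y) = bracket x x + bracket x y + (bracket y x + bracket y y)"
    by (simp add: bracket_add_left bracket_add_right)
  then show ?thesis by (simp add: alternating eq_neg_iff_add_eq_0)
qed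

lemma bracket_minus_right: "bracket x (- y) = - bracket x y"
  using bracket_add_right[of x y "- y"] by (simp add: eq_neg_iff_add_eq_0 add.commute)

lemma bracket_derivation: "bracket x (bracket y z) = bracket (bracket x y) z + bracket y (bracket x z)"
proof -
  have "bracket z (bracket x y) = - bracket (bracket x y) z" by (rule bracket_anti)
  moreover have "bracket y (bracket z x) = - bracket y (bracket x z)"
    by (subst bracket_anti[of z x]) (rule bracket_minus_right)
  ultimately show ?thesis using jacobi[of x y z] by (simp add: algebra_simps)
qed

lemma bracket_sum_left: "bracket (\<Sum>i\<in>I. f i) z = (\<Sum>i\<in>I. bracket (f i) z)"
  by (induction I rule: infinite_finite_induct) (simp_all add: bracket_add_left)

lemma bracket_sum_right: "bracket z (\<Sum>i\<in>I. f i) = (\<Sum>i\<in>I. bracket z (f i))"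
  by (induction I rule: infinite_finite_induct) (simp_all add: bracket_add_right)

text \<open>Functions on words form a Lie algebra under \<open>cbr\<close>; \<open>adw\<close> is the adjoint action of the
  function that is the identity on words of length one.\<close>

primrec adw :: "('g list \<Rightarrow> 'g) \<Rightarrow> 'g list \<Rightarrow> 'g" where
  "adw F [] = 0"
| "adw F (y # w) = bracket y (F w) + adw (\<lambda>v. F (y # v)) w"

definition cbr :: "('g list \<Rightarrow> 'g) \<Rightarrow> ('g list \<Rightarrow> 'g) \<Rightarrow> 'g list \<Rightarrow> 'g" where
  "cbr F G w = ssum (\<lambda>a b. bracket (F a) (G b)) w"

lemma adw_add: "adw (\<lambda>w. F w + G w) w = adw F w + adw G w"
  by (induction w arbitrary: F G) (simp_all add: bracket_add_right add_ac)

lemma adw_zero [simp]: "adw (\<lambda>w. 0) w = 0"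
  by (induction w) simp_all

lemma adw_sum: "adw (\<lambda>w. \<Sum>i\<in>I. F i w) w = (\<Sum>i\<in>I. adw (F i) w)"
  by (induction I rule: infinite_finite_induct) (simp_all add: adw_add)

lemma adw_scale: "adw (\<lambda>w. scale c (F w)) w = scale c (adw F w)"
  by (induction w arbitrary: F) (simp_all add: bracket_scale_right scale_right_distrib)

lemma adw_pow_add: "(adw ^^ n) (\<lambda>w. F w + G w) w = (adw ^^ n) F w + (adw ^^ n) G w"
proof (induction n arbitrary: w)
  case (Suc n)
  have "(adw ^^ n) (\<lambda>w. F w + G w) = (\<lambda>w. (adw ^^ n) F w + (adw ^^ n) G w)"
    using Suc.IH by (rule ext)
  then show ?case by (simp add: adw_add)
qed simp

lemma adw_pow_scale: "(adw ^^ n) (\<lambda>w. scale c (F w)) w = scale c ((adw ^^ n) F w)"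
proof (induction n arbitrary: w)
  case (Suc n)
  have "(adw ^^ n) (\<lambda>w. scale c (F w)) = (\<lambda>w. scale c ((adw ^^ n) F w))"
    using Suc.IH by (rule ext)
  then show ?case by (simp add: adw_scale)
qed simp

lemma adw_pow_zero [simp]: "(adw ^^ n) (\<lambda>w. 0) w = 0"
  using adw_pow_scale[of n 0 "\<lambda>w. 0" w] by simp

lemma adw_ssum: "adw (ssum Q) w = ssum (\<lambda>a b. adw (Q a) b) w"
proof (induction w arbitrary: Q)
  case (Cons y w)
  have "bracket y (ssum Q w) = ssum (\<lambda>a b. bracket y (Q a b)) w"
    by (rule ssum_additive) (rule bracket_add_right)
  then show ?case
    by (simp add: adw_add Cons.IH ssum_add)
qed simp

lemma adw_pow_ssum: "(adw ^^ i) (ssum Q) w = ssum (\<lambda>a b. (adw ^^ i) (Q a) b) w"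
proof (induction i arbitrary: w)
  case (Suc i)
  have "(adw ^^ i) (ssum Q) = ssum (\<lambda>a. (adw ^^ i) (Q a))"
    using Suc.IH by auto
  then show ?case by (simp add: adw_ssum)
qed simp

lemma cbr_Cons: "cbr F G (y # w) = cbr (\<lambda>v. F (y # v)) G w + cbr F (\<lambda>v. G (y # v)) w"
  by (simp add: cbr_def)

lemma cbr_add_left: "cbr (\<lambda>w. F w + G w) H w = cbr F H w + cbr G H w"
  by (simp add: cbr_def bracket_add_left ssum_add)

lemma cbr_add_right: "cbr H (\<lambda>w. F w + G w) w = cbr H F w + cbr H G w"
  by (simp add: cbr_def bracket_add_right ssum_add)

lemma bracket_cbr: "bracket y (cbr F G w) = cbr (\<lambda>v. bracket y (F v)) G w + cbr F (\<lambda>v. bracket y (G v)) w"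
  unfolding cbr_def
  by (subst ssum_additive[of "bracket y"], rule bracket_add_right)
    (simp add: bracket_derivation[of y] ssum_add)

lemma adw_cbr: "adw (cbr F G) w = cbr (adw F) G w + cbr F (adw G) w"
proof (induction w arbitrary: F G)
  case Nil
  then show ?case by (simp add: cbr_def)
next
  case (Cons y w)
  show ?case
    by (simp add: cbr_Cons adw_add Cons.IH bracket_cbr cbr_add_left cbr_add_right)
qed

definition constw :: "'g \<Rightarrow> 'g list \<Rightarrow> 'g" where
  "constw x w = (if w = [] then x else 0)"

lemma adw_pow_constw_zero: "length w \<noteq> p \<Longrightarrow> (adw ^^ p) (constw x) w = 0"
proof (induction p arbitrary: w)
  case 0
  then show ?case by (simp add: constw_def)
next
  case (Suc p)
  have *: "adw F w = 0" if "\<And>v. Suc (length v) = length w \<Longrightarrow> F v = 0" for F and w :: "'g list"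
    using that by (induction w arbitrary: F) simp_all
  show ?case using Suc by (auto intro!: *)
qed

lemma adw_pow_Cons:
  "(adw ^^ n) F (v # w) = (adw ^^ n) (\<lambda>u. F (v # u)) w
    + (\<Sum>i<n. (adw ^^ i) (\<lambda>u. bracket v ((adw ^^ (n - 1 - i)) F u)) w)"
proof (induction n arbitrary: w)
  case (Suc n)
  have "(adw ^^ Suc n) F (v # w) = bracket v ((adw ^^ n) F w) + adw (\<lambda>u. (adw ^^ n) F (v # u)) w"
    by simp
  also have "adw (\<lambda>u. (adw ^^ n) F (v # u)) w = (adw ^^ Suc n) (\<lambda>u. F (v # u)) w
     + (\<Sum>i<n. (adw ^^ Suc i) (\<lambda>u. bracket v ((adw ^^ (n - 1 - i)) F u)) w)"
    by (simp add: Suc.IH adw_add adw_sum)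
  finally show ?case
    by (simp add: sum.lessThan_Suc_shift del: sum.lessThan_Suc)
qed simp

text \<open>In a formal group, \<open>x exp h\<close> is the derivative of \<open>exp\<close> at \<open>h\<close> in the direction
  \<open>ad h / (exp (ad h) - 1) x\<close>. The polarization of this power series in \<open>h\<close> is \<open>beta x\<close>.\<close>

definition beta :: "'g \<Rightarrow> 'g list \<Rightarrow> 'g" where
  "beta x w = scale (bern (length w)) ((adw ^^ length w) (constw x) w)"

lemma beta_Nil [simp]: "beta x [] = x"
  by (simp add: beta_def constw_def)

lemma beta_Cons:
  "beta x (v # b) = scale (bern (Suc (length b)))
    (\<Sum>i\<le>length b. (adw ^^ i) (\<lambda>u. bracket v ((adw ^^ (length b - i)) (constw x) u)) b)"
proof -
  have "(\<lambda>u. constw x (v # u)) = (\<lambda>u. 0)" by (simp add: constw_def fun_eq_iff)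
  then show ?thesis
    by (simp add: beta_def adw_pow_Cons lessThan_Suc_atMost del: funpow.simps)
qed

lemma adw_pow_cbr:
  "(adw ^^ i) (cbr ((adw ^^ p) F) ((adw ^^ q) G)) w
    = (\<Sum>j\<le>i. scale (of_nat (i choose j)) (cbr ((adw ^^ (p + j)) F) ((adw ^^ (q + (i - j))) G) w))"
proof (induction i arbitrary: w)
  case (Suc i)
  define Z where "Z j k v = cbr ((adw ^^ (p + j)) F) ((adw ^^ (q + k)) G) v" for j k v
  have Z: "adw (Z j k) w = Z (Suc j) k w + Z j (Suc k) w" for j k
    unfolding Z_def using adw_cbr by simp
  have IH: "(adw ^^ i) (cbr ((adw ^^ p) F) ((adw ^^ q) G))
    = (\<lambda>w. \<Sum>j\<le>i. scale (of_nat (i choose j)) (Z j (i - j) w))"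
    unfolding Z_def using Suc.IH by (rule ext)
  have "(adw ^^ Suc i) (cbr ((adw ^^ p) F) ((adw ^^ q) G)) w
    = (\<Sum>j\<le>i. scale (of_nat (i choose j)) (Z (Suc j) (i - j) w + Z j (Suc i - j) w))"
    by (simp add: IH adw_sum adw_scale Z Suc_diff_le)
  also have "\<dots> = (\<Sum>j\<le>i. scale (of_nat (i choose j)) (Z (Suc j) (i - j) w))
      + (\<Sum>j\<le>Suc i. scale (of_nat (i choose j)) (Z j (Suc i - j) w))"
    by (simp add: scale_right_distrib sum.distrib binomial_eq_0)
  also have "\<dots> = (\<Sum>j\<le>i. scale (of_nat (i choose j)) (Z (Suc j) (i - j) w))
      + (Z 0 (Suc i) w + (\<Sum>j\<le>i. scale (of_nat (i choose Suc j)) (Z (Suc j) (i - j) w)))"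
    by (subst sum.atMost_Suc_shift) simp
  also have "\<dots> = Z 0 (Suc i) w + (\<Sum>j\<le>i. scale (of_nat (Suc i choose Suc j)) (Z (Suc j) (i - j) w))"
    by (simp only: binomial_Suc_Suc of_nat_add scale_left_distrib sum.distrib add_ac)
  also have "\<dots> = (\<Sum>j\<le>Suc i. scale (of_nat (Suc i choose j)) (Z j (Suc i - j) w))"
    by (subst sum.atMost_Suc_shift) simp
  finally show ?case unfolding Z_def .
qed simp

lemma ssum_beta_beta:
  assumes m: "length w = m"
  shows "ssum (\<lambda>a b. beta x (beta y a # b)) w =
    (\<Sum>s\<le>m. scale (\<Sum>p\<le>s. bern p * bern (m + 1 - p) * of_nat ((m + 1 - p) choose (s + 1 - p)))
      (cbr ((adw ^^ s) (constw y)) ((adw ^^ (m - s)) (constw x)) w))"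
proof -
  define Z where "Z j k = cbr ((adw ^^ j) (constw y)) ((adw ^^ k) (constw x)) w" for j k
  define c where "c p = (bern p * bern (m + 1 - p) :: 'k)" for p
  define Q where "Q p i a u = bracket ((adw ^^ p) (constw y) a) ((adw ^^ (m - p - i)) (constw x) u)" for p i a u
  have "ssum (\<lambda>a b. beta x (beta y a # b)) w
    = ssum (\<lambda>a b. \<Sum>p\<le>m. scale (c p) (\<Sum>i\<le>m - p. (adw ^^ i) (Q p i a) b)) w"
  proof (rule ssum_cong)
    fix a b :: "'g list" assume ab: "length a + length b = length w"
    have 0: "(adw ^^ i) (Q p i a) b = 0" if "p \<noteq> length a" for p i
    proof -
      have "Q p i a = (\<lambda>u. 0)"
        unfolding Q_def using adw_pow_constw_zero[of a p y] that by simp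
      then show ?thesis by simp
    qed
    have "beta x (beta y a # b) = scale (bern (m + 1 - length a))
       (\<Sum>i\<le>m - length a. (adw ^^ i) (\<lambda>u. scale (bern (length a)) (Q (length a) i a u)) b)"
      using ab m by (auto simp: beta_Cons beta_def[of y] bracket_scale_left Q_def)
    also have "\<dots> = scale (c (length a)) (\<Sum>i\<le>m - length a. (adw ^^ i) (Q (length a) i a) b)"
      unfolding adw_pow_scale by (simp add: c_def mult.commute flip: scale_sum_right)
    also have "\<dots> = (\<Sum>p\<le>m. if p = length a then scale (c p) (\<Sum>i\<le>m - p. (adw ^^ i) (Q p i a) b) else 0)"
      using ab m by simp
    also have "\<dots> = (\<Sum>p\<le>m. scale (c p) (\<Sum>i\<le>m - p. (adw ^^ i) (Q p i a) b))"
      by (rule sum.cong) (simp_all add: 0)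
    finally show "beta x (beta y a # b) = \<dots>" .
  qed
  also have "\<dots> = (\<Sum>p\<le>m. scale (c p) (\<Sum>i\<le>m - p. ssum (\<lambda>a b. (adw ^^ i) (Q p i a) b) w))"
    by (simp add: ssum_sum ssum_additive[of "scale _", symmetric] scale_right_distrib)
  also have "\<dots> = (\<Sum>p\<le>m. scale (c p) (\<Sum>i\<le>m - p. \<Sum>j\<le>i. scale (of_nat (i choose j)) (Z (p + j) (m - (p + j)))))"
  proof (intro sum.cong refl arg_cong[where f = "scale _"])
    fix p i assume "p \<in> {..m}" "i \<in> {..m - p}"
    have "Q p i = (\<lambda>a u. bracket ((adw ^^ p) (constw y) a) ((adw ^^ (m - p - i)) (constw x) u))"
      by (intro ext) (rule Q_def)
    then have "ssum (Q p i) = cbr ((adw ^^ p) (constw y)) ((adw ^^ (m - p - i)) (constw x))"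
      by (simp only:) (rule ext, simp only: cbr_def)
    then have "ssum (\<lambda>a b. (adw ^^ i) (Q p i a) b) w = (\<Sum>j\<le>i. scale (of_nat (i choose j)) (Z (p + j) (m - p - i + (i - j))))"
      by (simp add: adw_pow_ssum[symmetric] adw_pow_cbr Z_def)
    also have "\<dots> = (\<Sum>j\<le>i. scale (of_nat (i choose j)) (Z (p + j) (m - (p + j))))"
      using \<open>i \<in> {..m - p}\<close> \<open>p \<in> {..m}\<close> by (intro sum.cong refl) (auto simp: add.commute)
    finally show "ssum (\<lambda>a b. (adw ^^ i) (Q p i a) b) w = \<dots>" .
  qed
  also have "\<dots> = (\<Sum>p\<le>m. \<Sum>s\<in>{p..m}. scale (c p * of_nat ((m + 1 - p) choose (s + 1 - p))) (Z s (m - s)))"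
  proof (intro sum.cong refl)
    fix p assume p: "p \<in> {..m}"
    have "(\<Sum>i\<le>m - p. \<Sum>j\<le>i. scale (of_nat (i choose j)) (Z (p + j) (m - (p + j))))
      = (\<Sum>i\<le>m - p. \<Sum>j\<le>m - p. scale (of_nat (i choose j)) (Z (p + j) (m - (p + j))))"
      by (intro sum.cong refl sum.mono_neutral_left) (auto simp: binomial_eq_0)
    also have "\<dots> = (\<Sum>j\<le>m - p. \<Sum>i\<le>m - p. scale (of_nat (i choose j)) (Z (p + j) (m - (p + j))))"
      by (rule sum.swap)
    also have "\<dots> = (\<Sum>j\<le>m - p. scale (of_nat (\<Sum>i\<le>m - p. i choose j)) (Z (p + j) (m - (p + j))))"
      by (simp add: scale_sum_left)
    also have "\<dots> = (\<Sum>j\<le>m - p. scale (of_nat ((m + 1 - p) choose (p + j + 1 - p))) (Z (p + j) (m - (p + j))))"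
    proof (intro sum.cong refl arg_cong2[of _ _ _ _ scale] arg_cong[of _ _ of_nat])
      fix j assume "j \<in> {..m - p}"
      have "(\<Sum>i\<le>m - p. i choose j) = Suc (m - p) choose Suc j"
        using sum_choose_upper[of j "m - p"] by simp
      then show "(\<Sum>i\<le>m - p. i choose j) = (m + 1 - p) choose (p + j + 1 - p)"
        using p by (simp add: Suc_diff_le)
    qed
    also have "\<dots> = (\<Sum>s\<in>{p..m}. scale (of_nat ((m + 1 - p) choose (s + 1 - p))) (Z s (m - s)))"
      using p by (intro sum.reindex_bij_witness[of _ "\<lambda>s. s - p" "\<lambda>j. p + j"]) auto
    finally show "scale (c p) (\<Sum>i\<le>m - p. \<Sum>j\<le>i. scale (of_nat (i choose j)) (Z (p + j) (m - (p + j))))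
      = (\<Sum>s\<in>{p..m}. scale (c p * of_nat ((m + 1 - p) choose (s + 1 - p))) (Z s (m - s)))"
      by (simp add: scale_sum_right)
  qed
  also have "\<dots> = (\<Sum>(p, s)\<in>(SIGMA p:{..m}. {p..m}). scale (c p * of_nat ((m + 1 - p) choose (s + 1 - p))) (Z s (m - s)))"
    by (simp add: sum.Sigma)
  also have "\<dots> = (\<Sum>(s, p)\<in>(SIGMA s:{..m}. {..s}). scale (c p * of_nat ((m + 1 - p) choose (s + 1 - p))) (Z s (m - s)))"
    by (rule sum.reindex_bij_witness[of _ prod.swap prod.swap]) auto
  also have "\<dots> = (\<Sum>s\<le>m. \<Sum>p\<le>s. scale (c p * of_nat ((m + 1 - p) choose (s + 1 - p))) (Z s (m - s)))"
    by (simp add: sum.Sigma)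
  finally show ?thesis by (simp add: scale_sum_left c_def Z_def)
qed

text \<open>The identity that makes \<open>x \<mapsto> beta x\<close> define a representation of the Lie algebra on its
  symmetric algebra.\<close>

lemma beta_commutator:
  "ssum (\<lambda>a b. beta x (beta y a # b)) w - ssum (\<lambda>a b. beta y (beta x a # b)) w = beta (bracket x y) w"
proof -
  define m where "m = length w"
  define Z where "Z j = cbr ((adw ^^ j) (constw y)) ((adw ^^ (m - j)) (constw x)) w" for j
  define e where "e s = (\<Sum>p\<le>s. bern p * bern (m + 1 - p) * of_nat ((m + 1 - p) choose (s + 1 - p)) :: 'k)" for s
  have swap: "cbr F G w = - cbr G F w" for F G
    unfolding cbr_def by (subst (2) ssum_swap[symmetric]) (simp add: bracket_anti[of "F _"] ssum_minus)
  have 1: "ssum (\<lambda>a b. beta x (beta y a # b)) w = (\<Sum>s\<le>m. scale (e s) (Z s))"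
    by (simp add: ssum_beta_beta[of w m] m_def[symmetric] e_def Z_def)
  have "ssum (\<lambda>a b. beta y (beta x a # b)) w = (\<Sum>s\<le>m. scale (e s)
      (cbr ((adw ^^ s) (constw x)) ((adw ^^ (m - s)) (constw y)) w))"
    by (simp add: ssum_beta_beta[of w m] m_def[symmetric] e_def)
  also have "\<dots> = (\<Sum>s\<le>m. - scale (e s) (Z (m - s)))"
    unfolding Z_def by (intro sum.cong refl, subst swap) simp
  also have "\<dots> = - (\<Sum>s\<le>m. scale (e (m - s)) (Z s))"
    unfolding sum_negf by (subst sum.nat_diff_reindex[symmetric, where n = "Suc m", unfolded lessThan_Suc_atMost]) simp
  finally have 2: "ssum (\<lambda>a b. beta y (beta x a # b)) w = - (\<Sum>s\<le>m. scale (e (m - s)) (Z s))" .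
  have "constw (bracket x y) = (\<lambda>w. scale (-1) (cbr (constw y) (constw x) w))"
  proof
    fix v
    show "constw (bracket x y) v = scale (-1) (cbr (constw y) (constw x) v)"
    proof (cases v)
      case Nil
      then show ?thesis by (simp add: constw_def cbr_def bracket_anti[of x])
    next
      case (Cons z v)
      have "ssum (\<lambda>a b. bracket (constw y a) (constw x b)) v = 0" if "v \<noteq> []" for v
      proof -
        have "ssum (\<lambda>a b. bracket (constw y a) (constw x b)) v = ssum (\<lambda>a b. 0) v"
          by (rule ssum_cong) (use that in \<open>auto simp: constw_def\<close>)
        then show ?thesis by simp
      qed
      with Cons show ?thesis by (simp add: cbr_def) (simp add: constw_def)
    qed
  qed
  then have "(adw ^^ m) (constw (bracket x y)) w = - (\<Sum>s\<le>m. scale (of_nat (m choose s)) (Z s))"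
    using adw_pow_cbr[of m 0 "constw y" 0 "constw x" w] by (simp only: adw_pow_scale) (simp add: Z_def)
  then have 3: "beta (bracket x y) w = (\<Sum>s\<le>m. scale (- (bern m * of_nat (m choose s))) (Z s))"
    by (simp add: beta_def m_def[symmetric] scale_sum_right sum_negf)
  have "e s + e (m - s) = - (bern m * of_nat (m choose s))" if "s \<le> m" for s
  proof -
    have "e (m - s) = (\<Sum>p\<le>m - s. bern p * bern (m + 1 - p) * of_nat ((m + 1 - p) choose s))"
      unfolding e_def
    proof (intro sum.cong refl arg_cong2[of _ _ _ _ "(*)"] arg_cong[of _ _ of_nat])
      fix p assume "p \<in> {..m - s}"
      then show "(m + 1 - p) choose (m - s + 1 - p) = (m + 1 - p) choose s"
        using that by (subst binomial_symmetric) auto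
    qed
    then show ?thesis using bern_euler_identity[OF that] by (simp add: e_def)
  qed
  then show ?thesis
    unfolding 1 2 3 by (simp add: sum.distrib[symmetric] scale_left_distrib[symmetric] del: scale_minus_left)
qed

end

subsection \<open>Congruences, degree and symmetrization\<close>

lemma gen_ideal_diff: "a \<in> gen_ideal R \<Longrightarrow> b \<in> gen_ideal R \<Longrightarrow> a - b \<in> gen_ideal R"
  and gen_ideal_uminus: "a \<in> gen_ideal R \<Longrightarrow> - a \<in> gen_ideal R"
  and gen_ideal_sc: "a \<in> gen_ideal R \<Longrightarrow> sc c a \<in> gen_ideal R"
  and gen_ideal_sum: "(\<And>i. i \<in> I \<Longrightarrow> f i \<in> gen_ideal R) \<Longrightarrow> (\<Sum>i\<in>I. f i) \<in> gen_ideal R"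
  using gen_ideal_subspace[of R]
  by (auto intro: nc.subspace_diff nc.subspace_neg nc.subspace_scale nc.subspace_sum)

lemma gen_ideal_ssum:
  "(\<And>a b. length a + length b = length w \<Longrightarrow> f a b \<in> gen_ideal R) \<Longrightarrow> ssum f w \<in> gen_ideal R"
  by (rule ssum_mem) (auto intro: gen_ideal.add)

definition eqv :: "('a list \<Rightarrow>\<^sub>0 'k::field) set \<Rightarrow> (('a, 'k) ncpoly) \<Rightarrow> (('a, 'k) ncpoly) \<Rightarrow> bool" where
  "eqv R p q \<longleftrightarrow> p - q \<in> gen_ideal R"

lemma eqv_refl [simp]: "eqv R p p"
  by (simp add: eqv_def gen_ideal.zero)

lemma eqv_sym: "eqv R p q \<Longrightarrow> eqv R q p"
  using gen_ideal_uminus[of "p - q" R] by (simp add: eqv_def)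

lemma eqv_trans [trans]: "eqv R p q \<Longrightarrow> eqv R q r \<Longrightarrow> eqv R p r"
  using gen_ideal.add[of "p - q" R "q - r"] by (simp add: eqv_def)

lemma eqv_add: "eqv R p q \<Longrightarrow> eqv R p' q' \<Longrightarrow> eqv R (p + p') (q + q')"
  using gen_ideal.add[of "p - q" R "p' - q'"] by (simp add: eqv_def algebra_simps)

lemma eqv_diff: "eqv R p q \<Longrightarrow> eqv R p' q' \<Longrightarrow> eqv R (p - p') (q - q')"
  using gen_ideal_diff[of "p - q" R "p' - q'"] by (simp add: eqv_def algebra_simps)

lemma eqv_sc: "eqv R p q \<Longrightarrow> eqv R (sc c p) (sc c q)"
  using gen_ideal_sc[of "p - q" R c] by (simp add: eqv_def nc.scale_right_diff_distrib)

lemma eqv_mult: "eqv R p q \<Longrightarrow> eqv R p' q' \<Longrightarrow> eqv R (p * p') (q * q')"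
  using gen_ideal.add[OF gen_ideal_mult_right[of "p - q" R p'] gen_ideal_mult_left[of "p' - q'" R q]]
  by (simp add: eqv_def algebra_simps)

lemma eqv_sum: "(\<And>i. i \<in> I \<Longrightarrow> eqv R (f i) (g i)) \<Longrightarrow> eqv R (\<Sum>i\<in>I. f i) (\<Sum>i\<in>I. g i)"
  unfolding eqv_def sum_subtractf[symmetric] by (rule gen_ideal_sum)

lemma eqv_mono: "R \<subseteq> R' \<Longrightarrow> eqv R p q \<Longrightarrow> eqv R' p q"
  using gen_ideal_mono[of R R'] by (auto simp: eqv_def)

lemma nclinear_compose: "nclinear f \<Longrightarrow> nclinear g \<Longrightarrow> nclinear (\<lambda>p. g (f p))"
  by (rule nclinearI) (simp_all add: ncp.linear_add ncp.linear_scale)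

lemma gen_ideal_linear_mem:
  assumes "nclinear \<phi>" "\<And>w. \<phi> (mon w) \<in> gen_ideal R"
  shows "\<phi> p \<in> gen_ideal R"
  by (subst nclinear_expand[OF assms(1)]) (intro gen_ideal_sum gen_ideal_sc assms(2))

lemma sc_ssum: "sc (c :: 'k::field) (ssum f w) = ssum (\<lambda>a b. sc c (f a b)) w"
  by (rule ssum_additive) (rule nc.scale_right_distrib)

definition below :: "nat \<Rightarrow> ('a list \<Rightarrow>\<^sub>0 'k::zero) set" where
  "below n = {p. \<forall>w. n \<le> length w \<longrightarrow> coef p w = 0}"

lemma below_subspace: "nc.subspace (below n)"
  by (auto simp: nc.subspace_def below_def lookup_add)

lemma below_mono: "m \<le> n \<Longrightarrow> below m \<subseteq> below n"
  by (auto simp: below_def)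

lemma mon_below: "length w < n \<Longrightarrow> mon w \<in> below n"
  by (auto simp: below_def lookup_single when_def)

lemma below_exists: "\<exists>n. p \<in> below n"
proof -
  have "coef p w = 0" if "Suc (Max (insert 0 (length ` Poly_Mapping.keys p))) \<le> length w" for w
  proof (rule ccontr)
    assume "coef p w \<noteq> 0"
    then have "length w \<le> Max (insert 0 (length ` Poly_Mapping.keys p))"
      by (intro Max_ge) (auto simp: in_keys_iff)
    with that show False by simp
  qed
  then show ?thesis unfolding below_def by blast
qed

lemma below_linear_image:
  assumes "nclinear \<phi>" "nc.subspace N" "\<And>w. length w < n \<Longrightarrow> \<phi> (mon w) \<in> N" "p \<in> below n"
  shows "\<phi> p \<in> N"
  by (subst nclinear_expand[OF assms(1)], intro nc.subspace_sum[OF assms(2)] nc.subspace_scale[OF assms(2)] assms(3))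
    (use assms(4) in \<open>auto simp: below_def in_keys_iff not_le[symmetric]\<close>)

definition proj :: "nat \<Rightarrow> ('a list \<Rightarrow>\<^sub>0 'k::field) \<Rightarrow> (('a, 'k) ncpoly)" where
  "proj n = lin (\<lambda>w. if length w = n then mon w else 0)"

lemma linear_proj: "nclinear (proj n)"
  unfolding proj_def by (rule linear_lin)

lemma proj_mon: "proj n (mon w) = (if length w = n then mon w else 0)"
  by (simp add: proj_def)

lemma lookup_proj: "coef (proj n p) w = (if length w = n then coef p w else 0)"
proof -
  have "coef (proj n p) w = (\<Sum>v\<in>Poly_Mapping.keys p. if v = w then
     (if length w = n then coef p w else 0) else 0)"
    unfolding proj_def lin_def lookup_sum by (rule sum.cong) (auto simp: lookup_single when_def)
  then show ?thesis by (auto simp: in_keys_iff)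
qed

definition symw :: "'a list \<Rightarrow> ('a list \<Rightarrow>\<^sub>0 'k::field_char_0)" where
  "symw v = sc (1 / fact (length v)) (\<Sum>\<sigma> | \<sigma> permutes {..<length v}. mon (permute_list \<sigma> v))"

definition symmetrize :: "('a list \<Rightarrow>\<^sub>0 'k::field_char_0) \<Rightarrow> (('a, 'k) ncpoly)" where
  "symmetrize = lin symw"

lemma linear_symmetrize: "nclinear symmetrize"
  unfolding symmetrize_def by (rule linear_lin)

lemma symmetrize_mon: "symmetrize (mon w) = symw w"
  by (simp add: symmetrize_def)

lemma symw_mset: "mset u = mset v \<Longrightarrow> symw u = (symw v :: 'a list \<Rightarrow>\<^sub>0 'k::field_char_0)"
proof -
  assume uv: "mset u = mset v"
  then have len: "length u = length v" by (rule mset_eq_length)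
  obtain \<pi> where \<pi>: "\<pi> permutes {..<length v}" "permute_list \<pi> v = u"
    using mset_eq_permutation[OF uv] by auto
  have "(\<Sum>\<sigma> | \<sigma> permutes {..<length v}. mon (permute_list \<sigma> u) :: ('a, 'k) ncpoly)
    = (\<Sum>\<sigma> | \<sigma> permutes {..<length v}. mon (permute_list (\<pi> \<circ> \<sigma>) v))"
    using \<pi> by (intro sum.cong refl) (auto simp: permute_list_compose)
  also have "\<dots> = (\<Sum>\<sigma> | \<sigma> permutes {..<length v}. mon (permute_list \<sigma> v))"
    using setum_permutations_compose_left[OF \<pi>(1), of "\<lambda>\<sigma>. mon (permute_list \<sigma> v) :: _ \<Rightarrow>\<^sub>0 'k"] by simp
  finally show ?thesis by (simp add: symw_def len)
qed

lemma sc_of_nat: "sc (of_nat n) p = of_nat n * p"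
  by (metis sc_def single_of_nat zero_list_def)

lemma sum_permutes_const:
  "(\<Sum>\<sigma> | \<sigma> permutes {..<n::nat}. p) = sc (fact n) (p :: 'a list \<Rightarrow>\<^sub>0 'k::field_char_0)"
proof -
  have "(\<Sum>\<sigma> | \<sigma> permutes {..<n}. p) = of_nat (fact n) * p"
    by (simp add: card_permutations)
  then show ?thesis by (metis sc_of_nat of_nat_fact)
qed

lemma permute_list_append_Cons:
  assumes "\<sigma> permutes {..<length u + Suc (length v)}"
  shows "\<exists>u' v'. \<forall>e. permute_list \<sigma> (u @ e # v) = u' @ e # v'"
proof -
  let ?n = "length u + Suc (length v)"
  define k where "k = inv_into UNIV \<sigma> (length u)"
  have k: "k < ?n" "\<sigma> k = length u"
    using permutes_in_image[OF permutes_inv[OF assms], of "length u"] permutes_inverses(1)[OF assms]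
    by (auto simp: k_def)
  have iff: "\<sigma> i = length u \<longleftrightarrow> i = k" for i
    using k(2) inj_eq[OF permutes_inj[OF assms]] by metis
  let ?p = "\<lambda>e. permute_list \<sigma> (u @ e # v)"
  have nth: "?p e ! i = (if i = k then e else ?p undefined ! i)" if "i < ?n" for i e
  proof -
    have 1: "?p e ! i = (u @ e # v) ! \<sigma> i" for e
      using that assms by (intro permute_list_nth) simp_all
    have 2: "(u @ e # v) ! j = (u @ undefined # v) ! j" if "j \<noteq> length u" for j
      using that by (simp add: nth_append nth_Cons')
    show ?thesis
    proof (cases "i = k")
      case True
      then show ?thesis using 1[of e] k(2) by simp
    next
      case False
      then show ?thesis using 2[of "\<sigma> i"] iff[of i] by (simp add: 1)
    qed
  qed
  have "?p e = take k (?p undefined) @ e # drop (Suc k) (?p undefined)" for e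
  proof (rule nth_equalityI)
    show "length (?p e) = length (take k (?p undefined) @ e # drop (Suc k) (?p undefined))"
      using k(1) by simp
    fix i assume "i < length (?p e)"
    then have i: "i < ?n" by simp
    show "?p e ! i = (take k (?p undefined) @ e # drop (Suc k) (?p undefined)) ! i"
      unfolding nth[OF i, of e] using i k(1) by (simp add: nth_append nth_Cons' min_def)
  qed
  then show ?thesis by blast
qed

context lie_algebra_char_0
begin

definition lin_rels :: "(('g, 'k) ncpoly) set" where
  "lin_rels = {mon [x + y] - mon [x] - mon [y] | x y. True} \<union> {mon [scale c x] - sc c (mon [x]) | c x. True}"

definition sym_rels :: "(('g, 'k) ncpoly) set" where
  "sym_rels = lin_rels \<union> {mon [x, y] - mon [y, x] | x y. True}"

definition env_rels :: "(('g, 'k) ncpoly) set" where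
  "env_rels = lin_rels \<union> {mon [x, y] - mon [y, x] - mon [bracket x y] | x y. True}"

lemma lin_rels_sym_rels: "lin_rels \<subseteq> sym_rels" and lin_rels_env_rels: "lin_rels \<subseteq> env_rels"
  by (auto simp: sym_rels_def env_rels_def)

lemma mult_lin_rels:
  "mon u * (mon [x + y] - mon [x] - mon [y]) * mon v = mon (u @ (x + y) # v) - mon (u @ x # v) - (mon (u @ y # v) :: ('g, 'k) ncpoly)"
  "mon u * (mon [scale c x] - sc c (mon [x])) * mon v = mon (u @ scale c x # v) - sc c (mon (u @ x # v))"
  by (simp_all add: ring_distribs mon_mult sc_mult_left sc_mult_right)

lemma mult_comm_rels:
  "mon u * (mon [x, y] - mon [y, x]) * mon v = (mon (u @ x # y # v) - mon (u @ y # x # v) :: ('g, 'k) ncpoly)"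
  by (simp_all add: ring_distribs mon_mult)

lemma eqv_add_letter: "eqv lin_rels (mon (u @ (x + y) # v)) (mon (u @ x # v) + mon (u @ y # v))"
proof -
  have "mon u * (mon [x + y] - mon [x] - mon [y]) * mon v \<in> gen_ideal lin_rels"
    by (rule gen_ideal.gen) (auto simp: lin_rels_def)
  then show ?thesis unfolding mult_lin_rels eqv_def by (simp add: algebra_simps)
qed

lemma eqv_scale_letter: "eqv lin_rels (mon (u @ scale c x # v)) (sc c (mon (u @ x # v)))"
proof -
  have "mon u * (mon [scale c x] - sc c (mon [x])) * mon v \<in> gen_ideal lin_rels"
    by (rule gen_ideal.gen) (auto simp: lin_rels_def)
  then show ?thesis unfolding mult_lin_rels eqv_def .
qed

lemma eqv_swap_letters: "eqv sym_rels (mon (u @ x # y # v)) (mon (u @ y # x # v))"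
proof -
  have "mon u * (mon [x, y] - mon [y, x]) * mon v \<in> gen_ideal sym_rels"
    by (rule gen_ideal.gen) (auto simp: sym_rels_def)
  then show ?thesis unfolding mult_comm_rels eqv_def .
qed

lemma eqv_zero_letter: "eqv lin_rels (mon (u @ 0 # v)) 0"
  using eqv_scale_letter[of u 0 0 v] by simp

lemma eqv_sum_letter: "eqv lin_rels (mon (u @ (\<Sum>i\<in>I. f i) # v)) (\<Sum>i\<in>I. mon (u @ f i # v))"
proof (induction I rule: infinite_finite_induct)
  case (insert i I)
  then show ?case
    using eqv_trans[OF eqv_add_letter eqv_add[OF eqv_refl insert.IH]] by simp
qed (simp_all add: eqv_zero_letter)

lemma eqv_ssum_letter: "eqv lin_rels (mon (ssum f w # v)) (ssum (\<lambda>a b. mon (f a b # v)) w)"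
proof (induction w arbitrary: f)
  case (Cons x w)
  then show ?case
    using eqv_trans[OF eqv_add_letter[of "[]", simplified] eqv_add[OF Cons.IH Cons.IH]] by simp
qed simp

lemma sym_rels_linear_image:
  assumes "nclinear \<phi>" "nc.subspace N"
    and "\<And>u x y v. \<phi> (mon (u @ (x + y) # v)) - \<phi> (mon (u @ x # v)) - \<phi> (mon (u @ y # v)) \<in> N"
    and "\<And>u c x v. \<phi> (mon (u @ scale c x # v)) - sc c (\<phi> (mon (u @ x # v))) \<in> N"
    and "\<And>u x y v. \<phi> (mon (u @ x # y # v)) - \<phi> (mon (u @ y # x # v)) \<in> N"
    and "p \<in> gen_ideal sym_rels"
  shows "\<phi> p \<in> N"
proof (rule gen_ideal_linear_image[OF assms(1,2) _ assms(6)])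
  fix u r v assume "r \<in> sym_rels"
  then consider x y where "r = mon [x + y] - mon [x] - mon [y]" | c x where "r = mon [scale c x] - sc c (mon [x])"
    | x y where "r = mon [x, y] - mon [y, x]" by (auto simp: sym_rels_def lin_rels_def)
  then show "\<phi> (mon u * r * mon v) \<in> N"
    by cases (simp_all only: mult_lin_rels mult_comm_rels ncp.linear_diff[OF assms(1)] ncp.linear_scale[OF assms(1)] assms(3-5))
qed

lemma eqv_mset: "mset u = mset v \<Longrightarrow> eqv sym_rels (mon u) (mon v)"
proof (induction u arbitrary: v)
  case (Cons x u)
  then have "x \<in> set v" by (metis list.set_intros(1) set_mset_mset)
  then obtain v1 v2 where v: "v = v1 @ x # v2" by (meson split_list)
  then have "eqv sym_rels (mon u) (mon (v1 @ v2))" using Cons by (auto intro: Cons.IH)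
  then have "eqv sym_rels (mon (x # u)) (mon (x # v1 @ v2))"
    using eqv_mult[OF eqv_refl[of _ "mon [x]"]] by (fastforce simp: mon_mult)
  also have "eqv sym_rels (mon (v0 @ x # v1 @ v2)) (mon (v0 @ v1 @ x # v2))" for v0
  proof (induction v1 arbitrary: v0)
    case (Cons y v1)
    show ?case using eqv_trans[OF eqv_swap_letters Cons.IH[of "v0 @ [y]", simplified]] by simp
  qed simp
  from this[of "[]"] have "eqv sym_rels (mon (x # v1 @ v2)) (mon v)" by (simp add: v)
  finally show ?case .
qed simp

lemma proj_sym_ideal: "p \<in> gen_ideal sym_rels \<Longrightarrow> proj n p \<in> gen_ideal sym_rels"
proof (rule sym_rels_linear_image[OF linear_proj gen_ideal_subspace])
  fix u v x y c
  show "proj n (mon (u @ (x + y) # v)) - proj n (mon (u @ x # v)) - proj n (mon (u @ y # v)) \<in> gen_ideal sym_rels"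
    using eqv_mono[OF lin_rels_sym_rels eqv_add_letter[of u x y v]] by (auto simp: proj_mon eqv_def gen_ideal.zero algebra_simps)
  show "proj n (mon (u @ scale c x # v)) - sc c (proj n (mon (u @ x # v))) \<in> gen_ideal sym_rels"
    using eqv_mono[OF lin_rels_sym_rels eqv_scale_letter[of u c x v]] by (auto simp: proj_mon eqv_def gen_ideal.zero)
  show "proj n (mon (u @ x # y # v)) - proj n (mon (u @ y # x # v)) \<in> gen_ideal sym_rels"
    using eqv_swap_letters[of u x y v] by (auto simp: proj_mon eqv_def gen_ideal.zero)
qed

lemma symw_eqv: "eqv sym_rels (symw v) (mon v)"
proof -
  have "eqv sym_rels (\<Sum>\<sigma> | \<sigma> permutes {..<length v}. mon (permute_list \<sigma> v)) (\<Sum>\<sigma> | \<sigma> permutes {..<length v}. mon v)"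
    by (rule eqv_sum) (auto intro!: eqv_mset)
  from eqv_sc[OF this, where c = "1 / fact (length v)"] show ?thesis
    unfolding sum_permutes_const by (simp add: symw_def)
qed

lemma symw_letters:
  "eqv lin_rels (symw (u @ (x + y) # v)) (symw (u @ x # v) + symw (u @ y # v))"
  "eqv lin_rels (symw (u @ scale c x # v)) (sc c (symw (u @ x # v)))"
proof -
  let ?S = "{\<sigma>. \<sigma> permutes {..<length u + Suc (length v)}}"
  have *: "eqv lin_rels (mon (permute_list \<sigma> (u @ (x + y) # v))) (mon (permute_list \<sigma> (u @ x # v)) + mon (permute_list \<sigma> (u @ y # v)))"
    "eqv lin_rels (mon (permute_list \<sigma> (u @ scale c x # v))) (sc c (mon (permute_list \<sigma> (u @ x # v))))"
    if "\<sigma> \<in> ?S" for \<sigma>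
    using permute_list_append_Cons[of \<sigma> u v] that by (auto simp: eqv_add_letter eqv_scale_letter)
  have "eqv lin_rels (\<Sum>\<sigma>\<in>?S. mon (permute_list \<sigma> (u @ (x + y) # v)))
    (\<Sum>\<sigma>\<in>?S. mon (permute_list \<sigma> (u @ x # v)) + mon (permute_list \<sigma> (u @ y # v)))"
    by (rule eqv_sum) (rule *(1))
  from eqv_sc[OF this, where c = "1 / fact (length u + Suc (length v))"]
  show "eqv lin_rels (symw (u @ (x + y) # v)) (symw (u @ x # v) + symw (u @ y # v))"
    by (simp add: symw_def sum.distrib nc.scale_right_distrib)
  have "eqv lin_rels (\<Sum>\<sigma>\<in>?S. mon (permute_list \<sigma> (u @ scale c x # v)))
    (\<Sum>\<sigma>\<in>?S. sc c (mon (permute_list \<sigma> (u @ x # v))))"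
    by (rule eqv_sum) (rule *(2))
  from eqv_sc[OF this, where c = "1 / fact (length u + Suc (length v))"]
  show "eqv lin_rels (symw (u @ scale c x # v)) (sc c (symw (u @ x # v)))"
    by (simp add: symw_def mult.commute flip: nc.scale_sum_right)
qed

lemma symmetrize_sym_ideal: "p \<in> gen_ideal sym_rels \<Longrightarrow> symmetrize p \<in> gen_ideal env_rels"
proof (rule sym_rels_linear_image[OF linear_symmetrize gen_ideal_subspace])
  fix u v x y c
  show "symmetrize (mon (u @ (x + y) # v)) - symmetrize (mon (u @ x # v)) - symmetrize (mon (u @ y # v)) \<in> gen_ideal env_rels"
    using eqv_mono[OF lin_rels_env_rels symw_letters(1)[of u x y v]] by (simp add: symmetrize_mon eqv_def algebra_simps)
  show "symmetrize (mon (u @ scale c x # v)) - sc c (symmetrize (mon (u @ x # v))) \<in> gen_ideal env_rels"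
    using eqv_mono[OF lin_rels_env_rels symw_letters(2)[of u c x v]] by (simp add: symmetrize_mon eqv_def)
  have "symw (u @ x # y # v) = (symw (u @ y # x # v) :: ('g, 'k) ncpoly)" by (rule symw_mset) simp
  then show "symmetrize (mon (u @ x # y # v)) - symmetrize (mon (u @ y # x # v)) \<in> gen_ideal env_rels"
    by (simp add: symmetrize_mon gen_ideal.zero)
qed

end

subsection \<open>Injectivity of the symmetrization map\<close>

context lie_algebra_char_0
begin

lemma adw_swap:
  assumes "\<And>u v. F (u @ c # d # v) = F (u @ d # c # v)"
  shows "adw F (u @ c # d # v) = adw F (u @ d # c # v)"
  using assms
proof (induction u arbitrary: F)
  case Nil
  have "F (c # d # w) = F (d # c # w)" for w
    using Nil[of "[]" w] by simp
  then show ?case by (simp add: add_ac)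
next
  case (Cons y u)
  have "adw (\<lambda>w. F (y # w)) (u @ c # d # v) = adw (\<lambda>w. F (y # w)) (u @ d # c # v)"
    by (rule Cons.IH) (use Cons.prems[of "y # _"] in simp)
  then show ?case using Cons.prems by simp
qed

lemma adw_add_letter:
  assumes "\<And>u v. F (u @ (c + d) # v) = F (u @ c # v) + F (u @ d # v)"
  shows "adw F (u @ (c + d) # v) = adw F (u @ c # v) + adw F (u @ d # v)"
  using assms
proof (induction u arbitrary: F)
  case Nil
  have "F ((c + d) # w) = F (c # w) + F (d # w)" for w
    using Nil[of "[]" w] by simp
  then show ?case by (simp add: adw_add bracket_add_left add_ac)
next
  case (Cons y u)
  have "adw (\<lambda>w. F (y # w)) (u @ (c + d) # v) = adw (\<lambda>w. F (y # w)) (u @ c # v) + adw (\<lambda>w. F (y # w)) (u @ d # v)"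
    by (rule Cons.IH) (use Cons.prems[of "y # _"] in simp)
  then show ?case using Cons.prems by (simp add: bracket_add_right add_ac)
qed

lemma adw_scale_letter:
  assumes "\<And>u v. F (u @ scale k c # v) = scale k (F (u @ c # v))"
  shows "adw F (u @ scale k c # v) = scale k (adw F (u @ c # v))"
  using assms
proof (induction u arbitrary: F)
  case Nil
  have "F (scale k c # w) = scale k (F (c # w))" for w
    using Nil[of "[]" w] by simp
  then show ?case by (simp add: adw_scale bracket_scale_left scale_right_distrib)
next
  case (Cons y u)
  have "adw (\<lambda>w. F (y # w)) (u @ scale k c # v) = scale k (adw (\<lambda>w. F (y # w)) (u @ c # v))"
    by (rule Cons.IH) (use Cons.prems[of "y # _"] in simp)
  then show ?case using Cons.prems by (simp add: bracket_scale_right scale_right_distrib)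
qed

lemma beta_swap: "beta x (u @ c # d # v) = beta x (u @ d # c # v)"
proof -
  have "(adw ^^ n) (constw x) (u @ c # d # v) = (adw ^^ n) (constw x) (u @ d # c # v)" for n u v
    by (induction n arbitrary: u v) (simp_all add: adw_swap constw_def)
  then show ?thesis by (simp add: beta_def del: funpow.simps)
qed

lemma beta_add_letter: "beta x (u @ (c + d) # v) = beta x (u @ c # v) + beta x (u @ d # v)"
proof -
  have "(adw ^^ n) (constw x) (u @ (c + d) # v) = (adw ^^ n) (constw x) (u @ c # v) + (adw ^^ n) (constw x) (u @ d # v)" for n u v
    by (induction n arbitrary: u v) (simp_all add: adw_add_letter constw_def)
  then show ?thesis by (simp add: beta_def scale_right_distrib del: funpow.simps)
qed

lemma beta_scale_letter: "beta x (u @ scale k c # v) = scale k (beta x (u @ c # v))"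
proof -
  have "(adw ^^ n) (constw x) (u @ scale k c # v) = scale k ((adw ^^ n) (constw x) (u @ c # v))" for n u v
    by (induction n arbitrary: u v) (simp_all add: adw_scale_letter constw_def)
  then show ?thesis by (simp add: beta_def scale_left_commute del: funpow.simps)
qed

lemma beta_add: "beta (x + y) w = beta x w + beta y w"
proof -
  have "constw (x + y) = (\<lambda>w. constw x w + constw y w)" by (auto simp: constw_def)
  then show ?thesis by (simp add: beta_def adw_pow_add scale_right_distrib)
qed

lemma beta_scale: "beta (scale c x) w = scale c (beta x w)"
proof -
  have "constw (scale c x) = (\<lambda>w. scale c (constw x w))" by (auto simp: constw_def)
  then show ?thesis by (simp add: beta_def adw_pow_scale scale_left_commute)
qed

text \<open>Left multiplication by \<open>x\<close> in the enveloping algebra, transported to the symmetric algebra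
  along the symmetrization map.\<close>

definition lmulw :: "'g \<Rightarrow> 'g list \<Rightarrow> (('g, 'k) ncpoly)" where
  "lmulw x w = ssum (\<lambda>a b. mon (beta x a # b)) w"

definition lmul :: "'g \<Rightarrow> (('g, 'k) ncpoly) \<Rightarrow> (('g, 'k) ncpoly)" where
  "lmul x = lin (lmulw x)"

lemma linear_lmul: "nclinear (lmul x)"
  unfolding lmul_def by (rule linear_lin)

lemma lmul_mon: "lmul x (mon w) = lmulw x w"
  by (simp add: lmul_def)

lemma lmulw_letter:
  "lmulw x (u @ e # v) = ssum (\<lambda>a b. ssum (\<lambda>a' b'. mon (beta x (a @ e # a') # b @ b')
     + mon (beta x (a @ a') # b @ e # b')) v) u"
  by (simp add: lmulw_def ssum_append ssum_add)

lemma lmul_sym_ideal: "p \<in> gen_ideal sym_rels \<Longrightarrow> lmul x p \<in> gen_ideal sym_rels"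
proof (rule sym_rels_linear_image[OF linear_lmul gen_ideal_subspace])
  fix u v c d k
  have add: "mon (u @ (c + d) # v) - mon (u @ c # v) - mon (u @ d # v) \<in> gen_ideal sym_rels" for u c d v
    using eqv_mono[OF lin_rels_sym_rels eqv_add_letter[of u c d v]] by (simp add: eqv_def algebra_simps)
  have scl: "mon (u @ scale k c # v) - sc k (mon (u @ c # v)) \<in> gen_ideal sym_rels" for u k c v
    using eqv_mono[OF lin_rels_sym_rels eqv_scale_letter[of u k c v]] by (simp add: eqv_def)
  have swp: "mon (u @ c # d # v) - mon (u @ d # c # v) \<in> gen_ideal sym_rels" for u c d v
    using eqv_swap_letters[of u c d v] by (simp add: eqv_def)
  show "lmul x (mon (u @ (c + d) # v)) - lmul x (mon (u @ c # v)) - lmul x (mon (u @ d # v)) \<in> gen_ideal sym_rels"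
    unfolding lmul_mon lmulw_letter ssum_diff[symmetric]
  proof (intro gen_ideal_ssum)
    fix a b a' b'
    have "(mon (beta x (a @ (c + d) # a') # b @ b') - mon (beta x (a @ c # a') # b @ b') - mon (beta x (a @ d # a') # b @ b'))
       + (mon ((beta x (a @ a') # b) @ (c + d) # b') - mon ((beta x (a @ a') # b) @ c # b')
         - mon ((beta x (a @ a') # b) @ d # b')) \<in> gen_ideal sym_rels"
      unfolding beta_add_letter
      using add[of "[]" "beta x (a @ c # a')" "beta x (a @ d # a')" "b @ b'"] add[of "beta x (a @ a') # b" c d b']
      by (intro gen_ideal.add) simp_all
    then show "mon (beta x (a @ (c + d) # a') # b @ b') + mon (beta x (a @ a') # b @ (c + d) # b')
       - (mon (beta x (a @ c # a') # b @ b') + mon (beta x (a @ a') # b @ c # b'))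
       - (mon (beta x (a @ d # a') # b @ b') + mon (beta x (a @ a') # b @ d # b')) \<in> gen_ideal sym_rels"
      by (simp add: algebra_simps)
  qed
  show "lmul x (mon (u @ scale k c # v)) - sc k (lmul x (mon (u @ c # v))) \<in> gen_ideal sym_rels"
    unfolding lmul_mon lmulw_letter sc_ssum ssum_diff[symmetric]
  proof (intro gen_ideal_ssum)
    fix a b a' b'
    have "(mon (beta x (a @ scale k c # a') # b @ b') - sc k (mon (beta x (a @ c # a') # b @ b')))
       + (mon ((beta x (a @ a') # b) @ scale k c # b') - sc k (mon ((beta x (a @ a') # b) @ c # b'))) \<in> gen_ideal sym_rels"
      unfolding beta_scale_letter
      using scl[of "[]" k "beta x (a @ c # a')" "b @ b'"] scl[of "beta x (a @ a') # b" k c b']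
      by (intro gen_ideal.add) simp_all
    then show "mon (beta x (a @ scale k c # a') # b @ b') + mon (beta x (a @ a') # b @ scale k c # b')
       - sc k (mon (beta x (a @ c # a') # b @ b') + mon (beta x (a @ a') # b @ c # b')) \<in> gen_ideal sym_rels"
      by (simp add: nc.scale_right_distrib algebra_simps)
  qed
  show "lmul x (mon (u @ c # d # v)) - lmul x (mon (u @ d # c # v)) \<in> gen_ideal sym_rels"
    unfolding lmul_mon lmulw_def ssum_append ssum.simps ssum_diff[symmetric]
  proof (rule gen_ideal_ssum)
    fix a b
    let ?f = "\<lambda>p q. mon (beta x (a @ p) # b @ q)"
    have "ssum (\<lambda>a' b'. ?f (c # d # a') b' - ?f (d # c # a') b') v
      + ssum (\<lambda>a' b'. ?f a' (c # d # b') - ?f a' (d # c # b')) v \<in> gen_ideal sym_rels"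
    proof (intro gen_ideal.add gen_ideal_ssum)
      fix a' b'
      show "?f (c # d # a') b' - ?f (d # c # a') b' \<in> gen_ideal sym_rels"
        by (simp add: beta_swap[of x a c d] gen_ideal.zero)
      show "?f a' (c # d # b') - ?f a' (d # c # b') \<in> gen_ideal sym_rels"
        using swp[of "beta x (a @ a') # b"] by simp
    qed
    then show "ssum (\<lambda>a' b'. ?f (c # d # a') b') v + ssum (\<lambda>a' b'. ?f (c # a') (d # b')) v
      + (ssum (\<lambda>a' b'. ?f (d # a') (c # b')) v + ssum (\<lambda>a' b'. ?f a' (c # d # b')) v)
      - (ssum (\<lambda>a' b'. ?f (d # c # a') b') v + ssum (\<lambda>a' b'. ?f (d # a') (c # b')) v
      + (ssum (\<lambda>a' b'. ?f (c # a') (d # b')) v + ssum (\<lambda>a' b'. ?f a' (d # c # b')) v)) \<in> gen_ideal sym_rels"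
      by (simp add: ssum_diff algebra_simps)
  qed
qed

lemma lmul_add: "eqv sym_rels (lmul (x + y) p) (lmul x p + lmul y p)"
proof -
  have "lmul (x + y) p - lmul x p - lmul y p \<in> gen_ideal sym_rels"
  proof (rule gen_ideal_linear_mem[of "\<lambda>p. lmul (x + y) p - lmul x p - lmul y p"])
    show "nclinear (\<lambda>p. lmul (x + y) p - lmul x p - lmul y p)"
      by (intro ncp.linear_compose_sub linear_lmul)
    fix w
    show "lmul (x + y) (mon w) - lmul x (mon w) - lmul y (mon w) \<in> gen_ideal sym_rels"
      unfolding lmul_mon lmulw_def ssum_diff[symmetric]
    proof (rule gen_ideal_ssum)
      fix a b
      show "mon (beta (x + y) a # b) - mon (beta x a # b) - mon (beta y a # b) \<in> gen_ideal sym_rels"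
        using eqv_mono[OF lin_rels_sym_rels eqv_add_letter[of "[]" "beta x a" "beta y a" b]]
        by (simp add: beta_add eqv_def algebra_simps)
    qed
  qed
  then show ?thesis by (simp add: eqv_def algebra_simps)
qed

lemma lmul_scale: "eqv sym_rels (lmul (scale c x) p) (sc c (lmul x p))"
  unfolding eqv_def
proof (rule gen_ideal_linear_mem[of "\<lambda>p. lmul (scale c x) p - sc c (lmul x p)"])
  show "nclinear (\<lambda>p. lmul (scale c x) p - sc c (lmul x p))"
    by (intro ncp.linear_compose_sub ncp.linear_compose_scale_right linear_lmul)
  fix w
  show "lmul (scale c x) (mon w) - sc c (lmul x (mon w)) \<in> gen_ideal sym_rels"
    unfolding lmul_mon lmulw_def sc_ssum ssum_diff[symmetric]
  proof (rule gen_ideal_ssum)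
    fix a b
    show "mon (beta (scale c x) a # b) - sc c (mon (beta x a # b)) \<in> gen_ideal sym_rels"
      using eqv_mono[OF lin_rels_sym_rels eqv_scale_letter[of "[]" c "beta x a" b]]
      by (simp add: beta_scale eqv_def)
  qed
qed

lemma lmul_lmul_mon:
  "lmul x (lmul y (mon w)) = ssum (\<lambda>e d. ssum (\<lambda>a c. mon (beta x (beta y a # c) # d)) e) w
     + ssum (\<lambda>e d. ssum (\<lambda>a c. mon (beta x c # beta y a # d)) e) w"
proof -
  have "lmul x (lmul y (mon w)) = ssum (\<lambda>a b. lmul x (mon (beta y a # b))) w"
    unfolding lmul_mon[of y] lmulw_def[of y] by (rule ssum_additive) (rule ncp.linear_add[OF linear_lmul])
  also have "\<dots> = ssum (\<lambda>a b. ssum (\<lambda>c d. mon (beta x (beta y a # c) # d)) b + ssum (\<lambda>c d. mon (beta x c # beta y a # d)) b) w"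
    by (simp add: lmul_mon lmulw_def)
  also have "\<dots> = ssum (\<lambda>e d. ssum (\<lambda>a c. mon (beta x (beta y a # c) # d)) e) w
     + ssum (\<lambda>e d. ssum (\<lambda>a c. mon (beta x c # beta y a # d)) e) w"
    unfolding ssum_add ssum_assoc ..
  finally show ?thesis .
qed

lemma lmul_commutator: "eqv sym_rels (lmul x (lmul y p) - lmul y (lmul x p)) (lmul (bracket x y) p)"
proof -
  let ?\<phi> = "\<lambda>p. lmul x (lmul y p) - lmul y (lmul x p) - lmul (bracket x y) p"
  have "?\<phi> p \<in> gen_ideal sym_rels"
  proof (rule gen_ideal_linear_mem[of ?\<phi>])
    show "nclinear ?\<phi>"
      by (intro ncp.linear_compose_sub linear_lmul nclinear_compose[OF linear_lmul linear_lmul])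
    fix w
    let ?A = "\<lambda>x y e d. ssum (\<lambda>a c. mon (beta x (beta y a # c) # d) :: ('g, 'k) ncpoly) e"
    let ?B = "\<lambda>x y e d. ssum (\<lambda>a c. mon (beta x c # beta y a # d) :: ('g, 'k) ncpoly) e"
    have "ssum (\<lambda>e d. ?A x y e d - ?A y x e d - mon (beta (bracket x y) e # d)) w
      + ssum (\<lambda>e d. ?B x y e d - ?B y x e d) w \<in> gen_ideal sym_rels"
    proof (intro gen_ideal.add gen_ideal_ssum)
      fix e d
      let ?s = "\<lambda>x y. ssum (\<lambda>a c. beta x (beta y a # c)) e"
      have A: "eqv sym_rels (mon (?s x y # d)) (?A x y e d)" for x y
        by (rule eqv_mono[OF lin_rels_sym_rels eqv_ssum_letter])
      have "?s x y = ?s y x + beta (bracket x y) e"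
        using beta_commutator[of x y e] by (simp add: algebra_simps)
      then have "eqv sym_rels (mon (?s x y # d)) (mon (?s y x # d) + mon (beta (bracket x y) e # d))"
        using eqv_mono[OF lin_rels_sym_rels eqv_add_letter[of "[]"]] by simp
      also have "eqv sym_rels \<dots> (?A y x e d + mon (beta (bracket x y) e # d))"
        by (rule eqv_add[OF A eqv_refl])
      finally have "eqv sym_rels (?A x y e d) (?A y x e d + mon (beta (bracket x y) e # d))"
        by (rule eqv_trans[OF eqv_sym[OF A]])
      then show "?A x y e d - ?A y x e d - mon (beta (bracket x y) e # d) \<in> gen_ideal sym_rels"
        by (simp add: eqv_def algebra_simps)
      have "?B y x e d = ssum (\<lambda>a c. mon (beta y a # beta x c # d)) e"
        by (rule ssum_swap)
      then have "?B x y e d - ?B y x e d = ssum (\<lambda>a c. mon (beta x c # beta y a # d) - mon (beta y a # beta x c # d)) e"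
        by (simp add: ssum_diff)
      also have "\<dots> \<in> gen_ideal sym_rels"
        using eqv_swap_letters[of "[]"] by (intro gen_ideal_ssum) (simp add: eqv_def)
      finally show "?B x y e d - ?B y x e d \<in> gen_ideal sym_rels" .
    qed
    moreover have "ssum (\<lambda>e d. ?A x y e d - ?A y x e d - mon (beta (bracket x y) e # d)) w
      + ssum (\<lambda>e d. ?B x y e d - ?B y x e d) w = ?\<phi> (mon w)"
      unfolding lmul_lmul_mon lmul_mon[of "bracket x y"] lmulw_def ssum_diff by (simp add: algebra_simps)
    ultimately show "?\<phi> (mon w) \<in> gen_ideal sym_rels" by metis
  qed
  then show ?thesis by (simp add: eqv_def)
qed

primrec env_repw :: "'g list \<Rightarrow> (('g, 'k) ncpoly)" where
  "env_repw [] = mon []"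
| "env_repw (x # w) = lmul x (env_repw w)"

definition env_rep :: "(('g, 'k) ncpoly) \<Rightarrow> (('g, 'k) ncpoly)" where
  "env_rep = lin env_repw"

lemma linear_env_rep: "nclinear env_rep"
  unfolding env_rep_def by (rule linear_lin)

lemma env_rep_Cons: "env_rep (mon [x] * p) = lmul x (env_rep p)"
proof -
  have 1: "nclinear (\<lambda>p. env_rep (mon [x] * p))"
    by (rule nclinearI) (simp_all add: ring_distribs sc_mult_right ncp.linear_add[OF linear_env_rep] ncp.linear_scale[OF linear_env_rep])
  have 2: "nclinear (\<lambda>p. lmul x (env_rep p))"
    by (intro nclinear_compose[OF linear_env_rep linear_lmul])
  show ?thesis
    by (subst nclinear_expand[OF 1], subst nclinear_expand[OF 2]) (simp add: mon_mult env_rep_def)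
qed

lemma env_rep_env_ideal: "p \<in> gen_ideal env_rels \<Longrightarrow> env_rep p \<in> gen_ideal sym_rels"
proof (rule gen_ideal_linear_image[OF linear_env_rep gen_ideal_subspace])
  fix u r v assume "r \<in> env_rels"
  show "env_rep (mon u * r * mon v) \<in> gen_ideal sym_rels"
  proof (induction u)
    case Nil
    note diff = ncp.linear_diff[OF linear_env_rep] and scl = ncp.linear_scale[OF linear_env_rep]
    consider x y where "r = mon [x + y] - mon [x] - mon [y]" | c x where "r = mon [scale c x] - sc c (mon [x])"
      | x y where "r = mon [x] * mon [y] - mon [y] * mon [x] - mon [bracket x y]"
      using \<open>r \<in> env_rels\<close> by (auto simp: env_rels_def lin_rels_def mon_mult)
    then show ?case
    proof cases
      case 1
      then show ?thesis
        using lmul_add[of x y "env_rep (mon v)"]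
        by (simp add: mon_Nil left_diff_distrib distrib_right diff ncp.linear_add[OF linear_env_rep]
            env_rep_Cons eqv_def diff_diff_eq)
    next
      case 2
      then show ?thesis
        using lmul_scale[of c x "env_rep (mon v)"]
        by (simp add: mon_Nil left_diff_distrib diff env_rep_Cons eqv_def sc_mult_left scl)
    next
      case 3
      then show ?thesis
        using lmul_commutator[of x y "env_rep (mon v)"]
        by (simp add: mon_Nil left_diff_distrib diff env_rep_Cons eqv_def mult.assoc)
    qed
  next
    case (Cons x u)
    have "mon (x # u) * r * mon v = mon [x] * (mon u * r * mon v)"
      by (simp add: mon_mult flip: mult.assoc)
    then show ?case using Cons by (simp add: env_rep_Cons lmul_sym_ideal)
  qed
qed

lemma lmulw_below: "lmulw x w - mon (x # w) \<in> below (Suc (length w))"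
proof -
  let ?f = "\<lambda>a b. mon (beta x a # b) :: ('g, 'k) ncpoly"
  have "ssum ?f w - ?f [] w \<in> below (Suc (length w))"
    by (rule ssum_first_Nil)
      (auto simp: neq_Nil_conv intro: mon_below nc.subspace_0[OF below_subspace] nc.subspace_add[OF below_subspace])
  then show ?thesis by (simp add: lmulw_def)
qed

lemma env_repw_below: "env_repw w - mon w \<in> below (length w)"
proof (induction w)
  case (Cons x w)
  have "lmul x (env_repw w - mon w) \<in> below (Suc (length w))"
  proof (rule below_linear_image[OF linear_lmul below_subspace _ Cons.IH])
    fix v :: "'g list" assume v: "length v < length w"
    have "lmulw x v - mon (x # v) \<in> below (Suc (length w))" "mon (x # v) \<in> below (Suc (length w))"
      using lmulw_below[of x v] below_mono[of "Suc (length v)" "Suc (length w)"] v by (auto intro: mon_below)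
    from nc.subspace_add[OF below_subspace this] show "lmul x (mon v) \<in> below (Suc (length w))"
      by (simp add: lmul_mon)
  qed
  from nc.subspace_add[OF below_subspace this lmulw_below[of x w]] show ?case
    by (simp add: ncp.linear_diff[OF linear_lmul] lmul_mon)
qed (simp add: nc.subspace_0[OF below_subspace])

lemma env_rep_below:
  assumes "p \<in> below (Suc n)"
  shows "env_rep p - p \<in> below n"
proof (rule below_linear_image[of "\<lambda>p. env_rep p - p", OF _ below_subspace _ assms])
  show "nclinear (\<lambda>p. env_rep p - p)"
    by (intro ncp.linear_compose_sub linear_env_rep) (rule nclinearI, simp_all)
  fix w :: "'g list" assume "length w < Suc n"
  then show "env_rep (mon w) - mon w \<in> below n"
    using env_repw_below[of w] below_mono[of "length w" n] by (auto simp: env_rep_def)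
qed

lemma proj_sym: "proj n (symmetrize p) = symmetrize (proj n (p :: ('g, 'k) ncpoly))"
proof -
  have 1: "nclinear (\<lambda>p. proj n (symmetrize p))" and 2: "nclinear (\<lambda>p. symmetrize (proj n p))"
    by (intro nclinear_compose[OF linear_symmetrize linear_proj]
        nclinear_compose[OF linear_proj linear_symmetrize])+
  have "proj n (symw w) = (symmetrize (if length w = n then mon w else 0) :: ('g, 'k) ncpoly)" for w
    by (simp add: symw_def symmetrize_mon proj_mon ncp.linear_scale[OF linear_proj] ncp.linear_sum[OF linear_proj]
        ncp.linear_0[OF linear_symmetrize])
  then show ?thesis
    unfolding nclinear_expand[OF 1, of p] nclinear_expand[OF 2, of p] by (simp add: symmetrize_mon proj_mon)
qed

lemma eqv_linear_id:
  assumes "nclinear \<phi>" "\<And>w. eqv R (\<phi> (mon w)) (mon w)"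
  shows "eqv R (\<phi> p) p"
  by (subst nclinear_expand[OF assms(1)], subst (5) expand_mon) (intro eqv_sum eqv_sc assms(2))

text \<open>The injectivity part of the Poincare--Birkhoff--Witt theorem.\<close>

theorem symmetrize_injective:
  assumes "symmetrize p \<in> gen_ideal env_rels"
  shows "p \<in> gen_ideal sym_rels"
proof -
  have "p \<in> gen_ideal sym_rels" if "p \<in> below n" "symmetrize p \<in> gen_ideal env_rels" for n p
    using that
  proof (induction n arbitrary: p)
    case 0
    then have "p = 0" by (intro poly_mapping_eqI) (simp add: below_def)
    then show ?case by (simp add: gen_ideal.zero)
  next
    case (Suc n)
    have "symmetrize p \<in> below (Suc n)"
    proof (rule below_linear_image[OF linear_symmetrize below_subspace _ Suc.prems(1)])
      fix w :: "'g list" assume "length w < Suc n"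
      then show "symmetrize (mon w) \<in> below (Suc n)"
        unfolding symmetrize_mon symw_def
        by (intro nc.subspace_scale[OF below_subspace] nc.subspace_sum[OF below_subspace] mon_below) simp
    qed
    then have "env_rep (symmetrize p) - symmetrize p \<in> below n" by (rule env_rep_below)
    then have "proj n (env_rep (symmetrize p) - symmetrize p) = 0"
      by (intro poly_mapping_eqI) (simp add: lookup_proj below_def)
    then have "proj n (env_rep (symmetrize p)) = symmetrize (proj n p)"
      by (simp add: ncp.linear_diff[OF linear_proj] proj_sym)
    moreover have "proj n (env_rep (symmetrize p)) \<in> gen_ideal sym_rels"
      by (intro proj_sym_ideal env_rep_env_ideal Suc.prems)
    moreover have "eqv sym_rels (symmetrize (proj n p)) (proj n p)"
      by (rule eqv_linear_id[OF linear_symmetrize]) (simp add: symmetrize_mon symw_eqv)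
    ultimately have pn: "proj n p \<in> gen_ideal sym_rels"
      using gen_ideal_diff[of "symmetrize (proj n p)" sym_rels "symmetrize (proj n p) - proj n p"] by (simp add: eqv_def)
    have "p - proj n p \<in> gen_ideal sym_rels"
    proof (rule Suc.IH)
      show "p - proj n p \<in> below n"
        using Suc.prems(1) by (auto simp: below_def lookup_minus lookup_proj le_Suc_eq)
      show "symmetrize (p - proj n p) \<in> gen_ideal env_rels"
        unfolding ncp.linear_diff[OF linear_symmetrize] by (intro gen_ideal_diff Suc.prems(2) symmetrize_sym_ideal pn)
    qed
    from gen_ideal.add[OF this pn] show ?case by simp
  qed
  then show ?thesis using assms below_exists by blast
qed

end

subsection \<open>Noncommutative power series\<close>

lemma ncs_mult_Nil: "ncs_mult f g [] = f [] * g []"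
  by (simp add: ncs_mult_def)

lemma ncs_mult_Cons: "ncs_mult f g (x # w) = f [] * g (x # w) + ncs_mult (\<lambda>v. f (x # v)) g w"
  by (simp add: ncs_mult_def sum.atMost_Suc_shift del: sum.atMost_Suc)

lemma ncs_mult_add_left: "ncs_mult (\<lambda>w. f w + g w) h w = ncs_mult f h w + ncs_mult g h w"
  by (simp add: ncs_mult_def distrib_right sum.distrib)

lemma ncs_mult_scale_left: "ncs_mult (\<lambda>w. c * f w) h w = c * ncs_mult f h w"
  by (simp add: ncs_mult_def sum_distrib_left mult.assoc)

lemma ncs_mult_assoc_app: "ncs_mult (ncs_mult f g) h w = ncs_mult f (ncs_mult g h) w"
proof (induction w arbitrary: f)
  case (Cons x w)
  have "ncs_mult (ncs_mult f g) h (x # w) = f [] * g [] * h (x # w)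
    + ncs_mult (\<lambda>v. f [] * g (x # v) + ncs_mult (\<lambda>v. f (x # v)) g v) h w"
    by (simp add: ncs_mult_Cons ncs_mult_Nil)
  also have "\<dots> = f [] * ncs_mult g h (x # w) + ncs_mult (ncs_mult (\<lambda>v. f (x # v)) g) h w"
    by (simp add: ncs_mult_add_left ncs_mult_scale_left ncs_mult_Cons distrib_left mult.assoc add.assoc)
  finally show ?case by (simp add: Cons.IH ncs_mult_Cons)
qed (simp add: ncs_mult_Nil mult.assoc)

lemma ncs_mult_assoc: "ncs_mult (ncs_mult f g) h = ncs_mult f (ncs_mult g h)"
  by (rule ext) (rule ncs_mult_assoc_app)

lemma ncs_mult_one_left: "ncs_mult (ncs_const 1) (f :: ('a, 'k::semiring_1) ncs) = f"
proof
  fix w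
  have "ncs_mult (\<lambda>v. 0) f w = 0" for w by (simp add: ncs_mult_def)
  then show "ncs_mult (ncs_const 1) f w = f w"
    by (cases w) (simp_all add: ncs_mult_Nil ncs_mult_Cons ncs_const_def)
qed

lemma ncs_mult_one_right: "ncs_mult (f :: ('a, 'k::semiring_1) ncs) (ncs_const 1) w = f w"
  by (induction w arbitrary: f) (simp_all add: ncs_mult_Nil ncs_mult_Cons ncs_const_def)

lemma ncs_power_add: "ncs_power (f :: ('a, 'k::semiring_1) ncs) (m + n) = ncs_mult (ncs_power f m) (ncs_power f n)"
  by (induction m) (simp_all add: ncs_mult_one_left ncs_mult_assoc)

lemma ncs_power_eq_0:
  "f [] = (0 :: 'k::semiring_1) \<Longrightarrow> length w < n \<Longrightarrow> ncs_power f n w = 0"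
proof (induction n arbitrary: w)
  case (Suc n)
  show ?case
    unfolding ncs_power.simps ncs_mult_def
  proof (rule sum.neutral, rule ballI)
    fix i assume "i \<in> {..length w}"
    show "f (take i w) * ncs_power f n (drop i w) = 0"
    proof (cases "i = 0")
      case False
      then have "ncs_power f n (drop i w) = 0"
        using Suc.prems \<open>i \<in> _\<close> by (intro Suc.IH) auto
      then show ?thesis by simp
    qed (simp add: Suc.prems)
  qed
qed simp

text \<open>If \<open>f\<close> has no constant term, the summands omitted at the word \<open>w\<close> vanish.\<close>

definition fps_subst :: "('a, 'k::field_char_0) ncs \<Rightarrow> 'k fps \<Rightarrow> ('a, 'k) ncs" where
  "fps_subst f a = (\<lambda>w. \<Sum>n\<le>length w. fps_nth a n * ncs_power f n w)"

lemma fps_subst_atMost: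
  "f [] = 0 \<Longrightarrow> length w \<le> L \<Longrightarrow> fps_subst f a w = (\<Sum>n\<le>L. fps_nth a n * ncs_power f n w)"
  unfolding fps_subst_def by (rule sum.mono_neutral_left) (auto simp: ncs_power_eq_0)

lemma fps_subst_mult:
  fixes f :: "('a, 'k::field_char_0) ncs"
  assumes f: "f [] = 0"
  shows "fps_subst f (a * b) = ncs_mult (fps_subst f a) (fps_subst f b)"
proof
  fix w :: "'a list"
  let ?L = "length w"
  have "ncs_mult (fps_subst f a) (fps_subst f b) w = (\<Sum>i\<le>?L. \<Sum>m\<le>?L. \<Sum>n\<le>?L.
      fps_nth a m * fps_nth b n * (ncs_power f m (take i w) * ncs_power f n (drop i w)))"
    unfolding ncs_mult_def
    by (intro sum.cong refl) (simp add: fps_subst_atMost[where f = f, OF f, where L = ?L] sum_product mult_ac)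
  also have "\<dots> = (\<Sum>m\<le>?L. \<Sum>i\<le>?L. \<Sum>n\<le>?L. fps_nth a m * fps_nth b n * (ncs_power f m (take i w) * ncs_power f n (drop i w)))"
    by (rule sum.swap)
  also have "\<dots> = (\<Sum>m\<le>?L. \<Sum>n\<le>?L. \<Sum>i\<le>?L. fps_nth a m * fps_nth b n * (ncs_power f m (take i w) * ncs_power f n (drop i w)))"
    by (intro sum.cong refl sum.swap)
  also have "\<dots> = (\<Sum>m\<le>?L. \<Sum>n\<le>?L. fps_nth a m * fps_nth b n * ncs_power f (m + n) w)"
    by (simp add: ncs_power_add ncs_mult_def sum_distrib_left)
  also have "\<dots> = (\<Sum>(m, n)\<in>{..?L} \<times> {..?L}. fps_nth a m * fps_nth b n * ncs_power f (m + n) w)"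
    by (simp add: sum.cartesian_product)
  also have "\<dots> = (\<Sum>(m, n)\<in>{(m, n). m + n \<le> ?L}. fps_nth a m * fps_nth b n * ncs_power f (m + n) w)"
    by (rule sum.mono_neutral_right) (auto simp: ncs_power_eq_0[where f = f, OF f] not_le[symmetric] intro: ccontr)
  also have "\<dots> = (\<Sum>k\<le>?L. \<Sum>i\<le>k. fps_nth a i * fps_nth b (k - i) * ncs_power f k w)"
    by (simp add: sum.triangle_reindex_eq)
  also have "\<dots> = fps_subst f (a * b) w"
    by (simp add: fps_subst_def fps_mult_nth sum_distrib_right atLeast0AtMost)
  finally show "fps_subst f (a * b) w = ncs_mult (fps_subst f a) (fps_subst f b) w" ..
qed

lemma fps_subst_one: "fps_subst (f :: ('a, 'k::field_char_0) ncs) 1 = ncs_const 1"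
proof
  fix w
  have "fps_subst f 1 w = (\<Sum>n\<le>length w. if n = 0 then ncs_const 1 w else 0)"
    unfolding fps_subst_def by (intro sum.cong refl) auto
  then show "fps_subst f 1 w = ncs_const 1 w" by simp
qed

lemma fps_subst_power: "f [] = 0 \<Longrightarrow> ncs_power (fps_subst f a) n = fps_subst f (a ^ n)"
  by (induction n) (simp_all add: fps_subst_one fps_subst_mult)

lemma fps_subst_compose:
  fixes f :: "('a, 'k::field_char_0) ncs"
  assumes f: "f [] = 0" and b: "fps_nth b 0 = 0"
  shows "fps_subst (fps_subst f b) a = fps_subst f (fps_compose a b)"
proof
  fix w :: "'a list"
  let ?L = "length w"
  have "fps_subst (fps_subst f b) a w = (\<Sum>n\<le>?L. \<Sum>m\<le>?L. fps_nth a n * fps_nth (b ^ n) m * ncs_power f m w)"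
    unfolding fps_subst_def[of "fps_subst f b"] fps_subst_power[where f = f, OF f]
    by (simp add: fps_subst_def sum_distrib_left mult.assoc)
  also have "\<dots> = (\<Sum>m\<le>?L. \<Sum>n\<le>?L. fps_nth a n * fps_nth (b ^ n) m * ncs_power f m w)"
    by (rule sum.swap)
  also have "\<dots> = (\<Sum>m\<le>?L. \<Sum>n\<le>m. fps_nth a n * fps_nth (b ^ n) m * ncs_power f m w)"
    by (intro sum.cong refl sum.mono_neutral_right) (auto simp: startsby_zero_power_prefix[OF b])
  also have "\<dots> = fps_subst f (fps_compose a b) w"
    by (simp add: fps_subst_def fps_compose_nth sum_distrib_right atLeast0AtMost)
  finally show "fps_subst (fps_subst f b) a w = fps_subst f (fps_compose a b) w" .
qed

lemma ncs_exp_log: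
  fixes e :: "('a, 'k::field_char_0) ncs"
  assumes "e [] = 1"
  shows "ncs_exp (ncs_log e) = e"
proof
  fix w
  define h where "h = (\<lambda>v. e v - ncs_const 1 v)"
  have h: "h [] = 0" using assms by (simp add: h_def ncs_const_def)
  have log: "ncs_log e = fps_subst h (fps_ln 1)"
  proof
    fix w
    have "fps_subst h (fps_ln 1) w = (\<Sum>n=1..length w. fps_nth (fps_ln 1) n * ncs_power h n w)"
      unfolding fps_subst_def by (rule sum.mono_neutral_right) (auto simp: fps_ln_def)
    also have "\<dots> = ncs_log e w"
      unfolding ncs_log_def h_def
    proof (rule sum.cong)
      fix n :: nat assume "n \<in> {1..length w}"
      then obtain m where "n = Suc m" by (cases n) auto
      then show "fps_nth (fps_ln 1) n * ncs_power (\<lambda>v. e v - ncs_const 1 v) n w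
        = (-1) ^ (n + 1) / of_nat n * ncs_power (\<lambda>v. e v - ncs_const 1 v) n w"
        by (simp add: fps_ln_def)
    qed simp
    finally show "ncs_log e w = fps_subst h (fps_ln 1) w" ..
  qed
  have "fps_ln (1::'k) = fps_inv (fps_exp 1 - 1)" by (rule fps_ln_fps_exp_inv) simp
  then have "(fps_exp 1 - 1) oo fps_ln (1::'k) = fps_X"
    by (simp add: fps_inv_right)
  then have exp_ln: "fps_exp 1 oo fps_ln (1::'k) = 1 + fps_X"
    by (simp add: fps_compose_sub_distrib algebra_simps)
  have "ncs_exp (ncs_log e) w = fps_subst (fps_subst h (fps_ln 1)) (fps_exp 1) w"
    by (simp add: log ncs_exp_def fps_subst_def)
  also have "\<dots> = fps_subst h (1 + fps_X) w"
    by (subst fps_subst_compose[of h "fps_ln 1" "fps_exp 1", OF h]) (simp_all add: exp_ln)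
  also have "\<dots> = (\<Sum>n\<in>{..length w}. if n = 0 then ncs_const 1 w else if n = 1 then h w else 0)"
    unfolding fps_subst_def by (intro sum.cong refl) (auto simp: ncs_mult_one_right)
  also have "\<dots> = (\<Sum>n\<le>Suc (length w). if n = 0 then ncs_const 1 w else if n = 1 then h w else 0)"
    using h by (intro sum.mono_neutral_left) (auto simp: Suc_le_eq)
  also have "\<dots> = e w"
    by (subst sum.atMost_Suc_shift) (simp add: h_def)
  finally show "ncs_exp (ncs_log e) w = e w" .
qed

lemma ncs_power_monom_singleton:
  "ncs_power (ncs_monom [c]) n w = (if w = replicate n c then 1 else (0::'k::semiring_1))"
proof (induction n arbitrary: w)
  case 0
  then show ?case by (simp add: ncs_const_def)
next
  case (Suc n)
  have "ncs_mult (\<lambda>v. ncs_monom [c] (x # v)) g w = (if x = c then g w else 0)" for x w and g :: "('a, 'k) ncs"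
    by (cases w) (simp_all add: ncs_mult_Nil ncs_mult_Cons ncs_monom_def, simp_all add: ncs_mult_def)
  moreover have "ncs_monom [c] [] = (0::'k)" by (simp add: ncs_monom_def)
  ultimately show ?case
    by (cases w) (auto simp: ncs_mult_Nil ncs_mult_Cons Suc.IH)
qed

lemma ncs_exp_monom_singleton:
  "ncs_exp (ncs_monom [c]) w = (if set w \<subseteq> {c} then 1 / fact (length w) else (0::'k::field_char_0))"
proof -
  have "ncs_exp (ncs_monom [c]) w = (\<Sum>n\<le>length w. if n = length w then (if set w \<subseteq> {c} then 1 / fact (length w) else (0::'k)) else 0)"
    unfolding ncs_exp_def
  proof (intro sum.cong refl)
    fix n
    have "w = replicate n c \<longleftrightarrow> n = length w \<and> set w \<subseteq> {c}"
      by (auto simp: subset_iff split: if_splits intro: replicate_length_same[symmetric])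
    then show "ncs_power (ncs_monom [c]) n w / fact n
      = (if n = length w then (if set w \<subseteq> {c} then 1 / fact (length w) else (0::'k)) else 0)"
      by (auto simp: ncs_power_monom_singleton)
  qed
  then show ?thesis by simp
qed

lemma ncs_exp_bch: "ncs_exp bch_series = ncs_mult (ncs_exp (ncs_monom [Xi])) (ncs_exp (ncs_monom [Eta]) :: (letter, 'k::field_char_0) ncs)"
  unfolding bch_series_def by (rule ncs_exp_log) (simp add: ncs_mult_Nil ncs_exp_monom_singleton)

lemma sum_permutations_of_set_split:
  assumes "finite S"
  shows "(\<Sum>u\<in>perms S. \<Sum>i\<le>card S. h (take i u) (drop i u))
    = (\<Sum>A\<in>Pow S. \<Sum>y\<in>perms A. \<Sum>z\<in>perms (S - A). h y z)"
proof -
  have "(\<Sum>u\<in>perms S. \<Sum>i\<le>card S. h (take i u) (drop i u))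
     = (\<Sum>(u, i)\<in>perms S \<times> {..card S}. h (take i u) (drop i u))"
    by (simp add: sum.cartesian_product)
  also have "\<dots> = (\<Sum>(A, y, z)\<in>(SIGMA A:Pow S. perms A \<times> perms (S - A)). h y z)"
  proof (rule sum.reindex_bij_witness[of _ "\<lambda>(A, y, z). (y @ z, length y)" "\<lambda>(u, i). (set (take i u), take i u, drop i u)"])
    fix p assume "p \<in> perms S \<times> {..card S}"
    then obtain u i where p: "p = (u, i)" "set u = S" "distinct u" "i \<le> card S"
      by (auto simp: permutations_of_set_def)
    then have len: "length u = card S" by (metis distinct_card)
    show "(case case p of (u, i) \<Rightarrow> (set (take i u), take i u, drop i u) of (A, y, z) \<Rightarrow> (y @ z, length y)) = p"
      using p len by simp
    have "set (take i u) \<inter> set (drop i u) = {}" "set (take i u) \<union> set (drop i u) = S"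
      using p by (simp_all add: set_take_disj_set_drop_if_distinct flip: set_append)
    then have "set (drop i u) = S - set (take i u)" "set (take i u) \<subseteq> S" by auto
    then show "(case p of (u, i) \<Rightarrow> (set (take i u), take i u, drop i u))
      \<in> (SIGMA A:Pow S. perms A \<times> perms (S - A))"
      using p by (simp add: permutations_of_set_def)
    show "(case case p of (u, i) \<Rightarrow> (set (take i u), take i u, drop i u) of (A, y, z) \<Rightarrow> h y z)
      = (case p of (u, i) \<Rightarrow> h (take i u) (drop i u))" using p by simp
  next
    fix q assume "q \<in> (SIGMA A:Pow S. perms A \<times> perms (S - A))"
    then obtain A y z where q: "q = (A, y, z)" "A \<subseteq> S" "set y = A" "distinct y" "set z = S - A" "distinct z"
      by (auto simp: permutations_of_set_def)
    show "(case case q of (A, y, z) \<Rightarrow> (y @ z, length y) of (u, i) \<Rightarrow> (set (take i u), take i u, drop i u)) = q"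
      using q by simp
    have "length y \<le> card S" using q assms by (metis card_mono distinct_card)
    then show "(case q of (A, y, z) \<Rightarrow> (y @ z, length y)) \<in> perms S \<times> {..card S}"
      using q by (auto simp: permutations_of_set_def)
  qed
  also have "\<dots> = (\<Sum>A\<in>Pow S. \<Sum>y\<in>perms A. \<Sum>z\<in>perms (S - A). h y z)"
    using assms unfolding sum.cartesian_product by (intro sum.Sigma[symmetric]) auto
  finally show ?thesis .
qed

lemma sum_permutations_of_set_split_card:
  assumes "finite S" "a \<le> card S"
  shows "(\<Sum>u\<in>perms S. h (take a u) (drop a u))
    = (\<Sum>A | A \<subseteq> S \<and> card A = a. \<Sum>y\<in>perms A. \<Sum>z\<in>perms (S - A). h y z)"
proof -
  have "(\<Sum>u\<in>perms S. h (take a u) (drop a u))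
    = (\<Sum>u\<in>perms S. \<Sum>i\<le>card S. if length (take i u) = a then h (take i u) (drop i u) else 0)"
  proof (intro sum.cong refl)
    fix u assume "u \<in> perms S"
    then have "length u = card S" by (rule length_finite_permutations_of_set)
    then have "(\<Sum>i\<le>card S. if length (take i u) = a then h (take i u) (drop i u) else 0)
      = (\<Sum>i\<le>card S. if i = a then h (take i u) (drop i u) else 0)"
      by (intro sum.cong refl) auto
    then show "h (take a u) (drop a u) = (\<Sum>i\<le>card S. if length (take i u) = a then h (take i u) (drop i u) else 0)"
      using assms(2) by simp
  qed
  also have "\<dots> = (\<Sum>A\<in>Pow S. \<Sum>y\<in>perms A. \<Sum>z\<in>perms (S - A). if length y = a then h y z else 0)"
    by (rule sum_permutations_of_set_split[OF assms(1), of "\<lambda>y z. if length y = a then h y z else 0"])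
  also have "\<dots> = (\<Sum>A\<in>Pow S. if card A = a then (\<Sum>y\<in>perms A. \<Sum>z\<in>perms (S - A). h y z) else 0)"
    by (intro sum.cong refl) (auto simp: length_finite_permutations_of_set)
  also have "\<dots> = (\<Sum>A | A \<subseteq> S \<and> card A = a. \<Sum>y\<in>perms A. \<Sum>z\<in>perms (S - A). h y z)"
    using assms(1) by (simp add: sum.inter_filter[symmetric] Pow_def)
  finally show ?thesis .
qed

text \<open>The noncommutative series \<open>f\<close>, evaluated at the generic elements whose multilinear
  components are the \<open>val s\<close> with \<open>tag s\<close> the letter concerned, in the multidegree \<open>S\<close>.\<close>

definition multilin_eval :: "('l \<Rightarrow> 'a) \<Rightarrow> ('l \<Rightarrow> 'g) \<Rightarrow> ('a, 'k::field) ncs \<Rightarrow> 'l set \<Rightarrow> (('g, 'k) ncpoly)" where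
  "multilin_eval tag val f S = (\<Sum>u\<in>perms S. sc (f (map tag u)) (mon (map val u)))"

lemma multilin_eval_mult:
  assumes "finite S"
  shows "multilin_eval tag val (ncs_mult f g) S = (\<Sum>A\<in>Pow S. multilin_eval tag val f A * multilin_eval tag val g (S - A))"
proof -
  have "multilin_eval tag val (ncs_mult f g) S = (\<Sum>u\<in>perms S. \<Sum>i\<le>card S.
     sc (f (map tag (take i u))) (mon (map val (take i u))) * sc (g (map tag (drop i u))) (mon (map val (drop i u))))"
    unfolding multilin_eval_def
  proof (intro sum.cong refl)
    fix u assume "u \<in> perms S"
    then have "length u = card S" by (rule length_finite_permutations_of_set)
    then show "sc (ncs_mult f g (map tag u)) (mon (map val u)) = (\<Sum>i\<le>card S.
     sc (f (map tag (take i u))) (mon (map val (take i u))) * sc (g (map tag (drop i u))) (mon (map val (drop i u))))"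
      by (simp add: ncs_mult_def nc.scale_sum_left sc_mult_left sc_mult_right mon_mult take_map drop_map mult.commute
          flip: map_append)
  qed
  also have "\<dots> = (\<Sum>A\<in>Pow S. multilin_eval tag val f A * multilin_eval tag val g (S - A))"
    unfolding multilin_eval_def
    by (subst sum_permutations_of_set_split[OF assms, of "\<lambda>y z. sc (f (map tag y)) (mon (map val y)) * sc (g (map tag z)) (mon (map val z))"])
      (simp add: sum_product)
  finally show ?thesis .
qed

lemma multilin_eval_one: "multilin_eval tag val (ncs_const 1) S = (if S = {} then 1 else 0)"
proof (cases "finite S")
  case True
  have "multilin_eval tag val (ncs_const 1) S = (\<Sum>u\<in>perms S. if u = [] then 1 else 0)"
    unfolding multilin_eval_def by (intro sum.cong) (auto simp: ncs_const_def mon_Nil)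
  also have "\<dots> = (if S = {} then 1 else 0)"
  proof (cases "S = {}")
    case False
    then show ?thesis by (auto simp: permutations_of_set_def intro!: sum.neutral split: if_splits)
  qed simp
  finally show ?thesis .
qed (auto simp: multilin_eval_def permutations_of_set_infinite)

lemma multilin_eval_diff:
  "multilin_eval tag val (\<lambda>w. f w - g w) S = multilin_eval tag val f S - multilin_eval tag val g S"
  by (simp add: multilin_eval_def nc.scale_left_diff_distrib sum_subtractf)

lemma multilin_eval_sum:
  "multilin_eval tag val (\<lambda>w. \<Sum>i\<in>I. c i * f i w) S = (\<Sum>i\<in>I. sc (c i) (multilin_eval tag val (f i) S))"
  unfolding multilin_eval_def nc.scale_sum_left nc.scale_sum_right
  by (subst sum.swap) simp

lemma multilin_eval_cong:
  "(\<And>u. u \<in> perms S \<Longrightarrow> f (map tag u) = g (map tag u)) \<Longrightarrow> multilin_eval tag val f S = multilin_eval tag val g S"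
  unfolding multilin_eval_def by (rule sum.cong) auto

lemma multilin_eval_exp:
  "multilin_eval tag val (ncs_exp (ncs_monom [c])) S
    = (if tag ` S \<subseteq> {c} then sc (1 / fact (card S)) (\<Sum>u\<in>perms S. mon (map val u) :: _ \<Rightarrow>\<^sub>0 'k::field_char_0) else 0)"
proof -
  have "ncs_exp (ncs_monom [c]) (map tag u) = (if tag ` S \<subseteq> {c} then 1 / fact (card S) else (0::'k))"
    if "u \<in> perms S" for u
  proof -
    have "set u = S" "length u = card S"
      using that by (auto simp: permutations_of_set_def length_finite_permutations_of_set)
    then show ?thesis by (simp add: ncs_exp_monom_singleton)
  qed
  then show ?thesis by (simp add: multilin_eval_def nc.scale_sum_right)
qed

subsection \<open>The product of symmetrized monomials\<close>

lemma sum_permutations_of_set_split_card2: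
  assumes "finite A" "a \<le> card A" "finite B" "b \<le> card B"
  shows "(\<Sum>xs\<in>perms A. \<Sum>ys\<in>perms B. h (take a xs) (drop a xs) (take b ys) (drop b ys))
    = (\<Sum>A' | A' \<subseteq> A \<and> card A' = a. \<Sum>B' | B' \<subseteq> B \<and> card B' = b.
        \<Sum>x\<in>perms A'. \<Sum>y\<in>perms B'.
        \<Sum>x'\<in>perms (A - A'). \<Sum>y'\<in>perms (B - B'). h x x' y y')"
proof -
  let ?A = "{A'. A' \<subseteq> A \<and> card A' = a}" and ?B = "{B'. B' \<subseteq> B \<and> card B' = b}"
  have "(\<Sum>xs\<in>perms A. \<Sum>ys\<in>perms B. h (take a xs) (drop a xs) (take b ys) (drop b ys))
    = (\<Sum>A'\<in>?A. \<Sum>x\<in>perms A'. \<Sum>x'\<in>perms (A - A').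
       \<Sum>B'\<in>?B. \<Sum>y\<in>perms B'. \<Sum>y'\<in>perms (B - B'). h x x' y y')"
    by (subst sum_permutations_of_set_split_card[OF assms(1,2), symmetric])
      (intro sum.cong refl sum_permutations_of_set_split_card[OF assms(3,4)])
  also have "\<dots> = (\<Sum>A'\<in>?A. \<Sum>x\<in>perms A'. \<Sum>B'\<in>?B.
       \<Sum>x'\<in>perms (A - A'). \<Sum>y\<in>perms B'. \<Sum>y'\<in>perms (B - B'). h x x' y y')"
    by (intro sum.cong refl sum.swap)
  also have "\<dots> = (\<Sum>A'\<in>?A. \<Sum>B'\<in>?B. \<Sum>x\<in>perms A'.
       \<Sum>x'\<in>perms (A - A'). \<Sum>y\<in>perms B'. \<Sum>y'\<in>perms (B - B'). h x x' y y')"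
    by (intro sum.cong refl sum.swap)
  also have "\<dots> = (\<Sum>A'\<in>?A. \<Sum>B'\<in>?B. \<Sum>x\<in>perms A'.
       \<Sum>y\<in>perms B'. \<Sum>x'\<in>perms (A - A'). \<Sum>y'\<in>perms (B - B'). h x x' y y')"
    by (intro sum.cong refl sum.swap)
  finally show ?thesis .
qed

definition covers :: "'a set \<Rightarrow> 'a set list \<Rightarrow> bool" where
  "covers A L \<longleftrightarrow> (\<forall>i. length (filter (\<lambda>S. i \<in> S) L) = (if i \<in> A then 1 else 0))"

lemma covers_Nil: "covers A [] \<longleftrightarrow> A = {}"
  by (auto simp: covers_def)

lemma covers_Cons: "covers A (S # L) \<longleftrightarrow> S \<subseteq> A \<and> covers (A - S) L"
proof
  assume *: "covers A (S # L)"
  have "i \<in> A" if "i \<in> S" for i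
    using *[unfolded covers_def, rule_format, of i] that by (auto split: if_splits)
  moreover have "length (filter (\<lambda>S. i \<in> S) L) = (if i \<in> A - S then 1 else 0)" for i
    using *[unfolded covers_def, rule_format, of i] by (auto split: if_splits)
  ultimately show "S \<subseteq> A \<and> covers (A - S) L" by (auto simp: covers_def)
next
  assume *: "S \<subseteq> A \<and> covers (A - S) L"
  have "length (filter (\<lambda>S. i \<in> S) (S # L)) = (if i \<in> A then 1 else 0)" for i
    using *[unfolded covers_def, THEN conjunct2, rule_format, of i] * by auto
  then show "covers A (S # L)" by (simp add: covers_def)
qed

lemma covers_mset: "mset L = mset L' \<Longrightarrow> covers A L \<longleftrightarrow> covers A L'"
  unfolding covers_def by (metis size_mset mset_filter)

lemma covers_subset: "covers A L \<Longrightarrow> S \<in> set L \<Longrightarrow> S \<subseteq> A"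
  by (induction L arbitrary: A) (auto simp: covers_Cons)

definition ordparts :: "nat \<Rightarrow> 'a set \<Rightarrow> 'b set \<Rightarrow> ('a set \<times> 'b set) list set" where
  "ordparts r A B = {P. length P = r \<and> covers A (map fst P) \<and> covers B (map snd P)}"

lemma finite_ordparts: "finite A \<Longrightarrow> finite B \<Longrightarrow> finite (ordparts r A B)"
proof (rule finite_subset)
  assume "finite A" "finite B"
  then show "finite {P. set P \<subseteq> Pow A \<times> Pow B \<and> length P = r}"
    by (intro finite_lists_length_eq) simp
  show "ordparts r A B \<subseteq> {P. set P \<subseteq> Pow A \<times> Pow B \<and> length P = r}"
  proof
    fix P assume P: "P \<in> ordparts r A B"
    have "p \<in> Pow A \<times> Pow B" if "p \<in> set P" for p
      using P that covers_subset[of A "map fst P" "fst p"] covers_subset[of B "map snd P" "snd p"]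
      by (simp add: ordparts_def mem_Times_iff)
    then have "set P \<subseteq> Pow A \<times> Pow B" by blast
    then show "P \<in> {P. set P \<subseteq> Pow A \<times> Pow B \<and> length P = r}"
      using P by (simp add: ordparts_def)
  qed
qed

lemma ordparts_0: "ordparts 0 A B = (if A = {} \<and> B = {} then {[]} else {})"
  by (auto simp: ordparts_def covers_Nil)

lemma sum_ordparts_Suc:
  assumes "finite A" "finite B"
  shows "(\<Sum>P\<in>ordparts (Suc r) A B. h P)
    = (\<Sum>A'\<in>Pow A. \<Sum>B'\<in>Pow B. \<Sum>P\<in>ordparts r (A - A') (B - B'). h ((A', B') # P))"
proof -
  have "(\<Sum>A'\<in>Pow A. \<Sum>B'\<in>Pow B. \<Sum>P\<in>ordparts r (A - A') (B - B'). h ((A', B') # P))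
    = (\<Sum>x\<in>(SIGMA A':Pow A. SIGMA B':Pow B. ordparts r (A - A') (B - B')). h ((fst x, fst (snd x)) # snd (snd x)))"
    using assms by (simp add: sum.Sigma finite_ordparts case_prod_unfold)
  also have "\<dots> = (\<Sum>P\<in>ordparts (Suc r) A B. h P)"
    by (rule sum.reindex_bij_witness[of _ "\<lambda>P. (fst (hd P), snd (hd P), tl P)" "\<lambda>x. (fst x, fst (snd x)) # snd (snd x)"])
      (auto simp: ordparts_def length_Suc_conv covers_Cons)
  finally show ?thesis ..
qed

lemma ordparts_mset: "mset P = mset P' \<Longrightarrow> P \<in> ordparts r A B \<longleftrightarrow> P' \<in> ordparts r A B"
proof -
  assume *: "mset P = mset P'"
  then have "length P = length P'" by (rule mset_eq_length)
  moreover have "covers A (map fst P) = covers A (map fst P')" "covers B (map snd P) = covers B (map snd P')"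
    by (intro covers_mset, simp add: *)+
  ultimately show ?thesis by (simp add: ordparts_def)
qed

lemma sum_ordparts_permute:
  assumes "\<pi> permutes {..<r}"
  shows "(\<Sum>P\<in>ordparts r A B. h (permute_list \<pi> P)) = (\<Sum>P\<in>ordparts r A B. h P)"
proof (rule sum.reindex_bij_witness[of _ "permute_list (inv_into UNIV \<pi>)" "permute_list \<pi>"])
  have inv: "inv_into UNIV \<pi> permutes {..<r}" by (rule permutes_inv[OF assms])
  have mem: "permute_list \<rho> P \<in> ordparts r A B" if "P \<in> ordparts r A B" "\<rho> permutes {..<r}" for P \<rho>
  proof -
    have "length P = r" using that(1) by (simp add: ordparts_def)
    then have "mset (permute_list \<rho> P) = mset P" using that(2) by simp
    then show ?thesis using ordparts_mset that(1) by blast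
  qed
  fix P assume P: "P \<in> ordparts r A B"
  then have len: "length P = r" by (simp add: ordparts_def)
  show "permute_list (inv_into UNIV \<pi>) (permute_list \<pi> P) = P"
    using permute_list_compose[of "inv_into UNIV \<pi>" P \<pi>] inv len permutes_inv_o(1)[OF assms] by simp
  show "permute_list \<pi> (permute_list (inv_into UNIV \<pi>) P) = P"
    using permute_list_compose[of \<pi> P "inv_into UNIV \<pi>"] assms len permutes_inv_o(2)[OF assms] by simp
  show "permute_list \<pi> P \<in> ordparts r A B" "permute_list (inv_into UNIV \<pi>) P \<in> ordparts r A B"
    using mem P assms inv by auto
qed simp

definition labels :: "nat set \<Rightarrow> nat set \<Rightarrow> (letter \<times> nat) set" where
  "labels A B = Pair Xi ` A \<union> Pair Eta ` B"

lemma finite_labels: "finite A \<Longrightarrow> finite B \<Longrightarrow> finite (labels A B)"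
  by (simp add: labels_def)

lemma card_labels: "finite A \<Longrightarrow> finite B \<Longrightarrow> card (labels A B) = card A + card B"
  unfolding labels_def by (subst card_Un_disjoint) (auto simp: card_image inj_on_def)

lemma labels_diff: "labels A B - labels A' B' = labels (A - A') (B - B')"
  by (auto simp: labels_def)

lemma labels_eq_empty: "labels A B = {} \<longleftrightarrow> A = {} \<and> B = {}"
  by (auto simp: labels_def)

lemma labels_of_set: "labels {i. (Xi, i) \<in> T} {j. (Eta, j) \<in> T} = T"
proof -
  have "(c, i) \<in> labels {i. (Xi, i) \<in> T} {j. (Eta, j) \<in> T} \<longleftrightarrow> (c, i) \<in> T" for c i
    by (cases c) (auto simp: labels_def)
  then show ?thesis by auto
qed

lemma sum_Pow_labels: "(\<Sum>T\<in>Pow (labels A B). h T) = (\<Sum>A'\<in>Pow A. \<Sum>B'\<in>Pow B. h (labels A' B'))"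
  unfolding sum.cartesian_product
proof (rule sum.reindex_bij_witness[of _ "\<lambda>(A, B). labels A B" "\<lambda>T. ({i. (Xi, i) \<in> T}, {j. (Eta, j) \<in> T})"])
  fix p assume "p \<in> Pow A \<times> Pow B"
  then show "({i. (Xi, i) \<in> (case p of (A, B) \<Rightarrow> labels A B)}, {j. (Eta, j) \<in> (case p of (A, B) \<Rightarrow> labels A B)}) = p"
    and "(case p of (A, B) \<Rightarrow> labels A B) \<in> Pow (labels A B)"
    by (auto simp: labels_def)
qed (auto simp: labels_of_set, auto simp: labels_def)

definition seq_of :: "(nat \<Rightarrow> 'g) \<Rightarrow> nat list \<Rightarrow> nat \<Rightarrow> 'g" where
  "seq_of f xs = (\<lambda>i. f (xs ! (i - 1)))"

lemma lie_word_eval_cong: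
  assumes "\<And>i. 1 \<le> i \<Longrightarrow> i \<le> letter_count Xi t \<Longrightarrow> x i = x' i"
    and "\<And>j. 1 \<le> j \<Longrightarrow> j \<le> letter_count Eta t \<Longrightarrow> y j = y' j"
  shows "lie_word_eval br t x y = lie_word_eval br t x' y'"
  using assms
proof (induction t arbitrary: x x' y y')
  case (Letter c)
  then show ?case by (cases c) auto
next
  case (Bracket s t)
  have "lie_word_eval br s x y = lie_word_eval br s x' y'"
    by (rule Bracket.IH(1)) (auto intro: Bracket.prems)
  moreover have "lie_word_eval br t (\<lambda>i. x (letter_count Xi s + i)) (\<lambda>j. y (letter_count Eta s + j))
     = lie_word_eval br t (\<lambda>i. x' (letter_count Xi s + i)) (\<lambda>j. y' (letter_count Eta s + j))"
    by (rule Bracket.IH(2)) (auto intro: Bracket.prems)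
  ultimately show ?case by simp
qed

lemma letter_count_pos: "letter_count Xi t + letter_count Eta t \<ge> 1"
proof (induction t)
  case (Letter c)
  then show ?case by (cases c) auto
qed auto

lemma symw_distinct:
  assumes "distinct v"
  shows "symw (map f v) = (sc (1 / fact (length v)) (\<Sum>u\<in>perms (set v). mon (map f u)) :: _ \<Rightarrow>\<^sub>0 'k::field_char_0)"
proof -
  let ?n = "length v"
  have inj: "inj_on (\<lambda>\<sigma>. permute_list \<sigma> v) {\<sigma>. \<sigma> permutes {..<?n}}"
  proof (rule inj_onI, rule ext)
    fix \<sigma> \<tau> i assume *: "\<sigma> \<in> {\<sigma>. \<sigma> permutes {..<?n}}" "\<tau> \<in> {\<sigma>. \<sigma> permutes {..<?n}}" "permute_list \<sigma> v = permute_list \<tau> v"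
    show "\<sigma> i = \<tau> i"
    proof (cases "i < ?n")
      case True
      then have "v ! \<sigma> i = v ! \<tau> i" using * permute_list_nth by (metis mem_Collect_eq)
      moreover have "\<sigma> i < ?n" "\<tau> i < ?n" using * True permutes_in_image by (metis lessThan_iff mem_Collect_eq)+
      ultimately show ?thesis using assms by (simp add: nth_eq_iff_index_eq)
    next
      case False
      then show ?thesis using * by (simp add: permutes_not_in)
    qed
  qed
  have "(\<lambda>\<sigma>. permute_list \<sigma> v) ` {\<sigma>. \<sigma> permutes {..<?n}} = perms (set v)"
  proof (rule card_subset_eq)
    show "(\<lambda>\<sigma>. permute_list \<sigma> v) ` {\<sigma>. \<sigma> permutes {..<?n}} \<subseteq> perms (set v)"
      using assms by (auto simp: permutations_of_set_def)
    show "card ((\<lambda>\<sigma>. permute_list \<sigma> v) ` {\<sigma>. \<sigma> permutes {..<?n}}) = card (perms (set v))"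
      using assms by (simp add: card_image[OF inj] card_permutations distinct_card)
  qed simp
  then have "(\<Sum>u\<in>perms (set v). mon (map f u) :: _ \<Rightarrow>\<^sub>0 'k) = (\<Sum>\<sigma> | \<sigma> permutes {..<?n}. mon (map f (permute_list \<sigma> v)))"
    using sum.reindex[OF inj, of "\<lambda>u. mon (map f u)"] by (simp add: comp_def)
  also have "\<dots> = (\<Sum>\<sigma> | \<sigma> permutes {..<?n}. mon (permute_list \<sigma> (map f v)))"
    by (intro sum.cong refl) (simp add: permute_list_map)
  finally show ?thesis by (simp add: symw_def)
qed

locale gutt = lie_algebra_char_0 scale bracket
  for scale :: "'k::field_char_0 \<Rightarrow> 'g::ab_group_add \<Rightarrow> 'g" and bracket +
  fixes E :: "nat \<Rightarrow> nat \<Rightarrow> lie_word \<Rightarrow>\<^sub>0 'k" and \<xi> \<eta> :: "nat \<Rightarrow> 'g"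
  assumes E: "bch_expressions E"
begin

lemma E_keys: "t \<in> Poly_Mapping.keys (E a b) \<Longrightarrow> letter_count Xi t = a \<and> letter_count Eta t = b"
  using E by (auto simp: bch_expressions_def)

lemma E_component: "(\<lambda>w. \<Sum>t\<in>Poly_Mapping.keys (E a b). Poly_Mapping.lookup (E a b) t * lie_word_ncs t w) = bch_component a b"
  using E by (auto simp: bch_expressions_def)

lemma E_zero: "a \<ge> 2 \<Longrightarrow> E a 0 = 0" "b \<ge> 2 \<Longrightarrow> E 0 b = 0"
  using E by (auto simp: bch_expressions_def)

lemma E_0_0: "E 0 0 = 0"
proof -
  have "t \<notin> Poly_Mapping.keys (E 0 0)" for t
    using E_keys[of t 0 0] letter_count_pos[of t] by auto
  then have "Poly_Mapping.keys (E 0 0) = {}" by blast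
  then show ?thesis by simp
qed

definition label_val :: "letter \<times> nat \<Rightarrow> 'g" where
  "label_val p = (case fst p of Xi \<Rightarrow> \<xi> (snd p) | Eta \<Rightarrow> \<eta> (snd p))"

definition ev :: "(letter, 'k) ncs \<Rightarrow> nat set \<Rightarrow> nat set \<Rightarrow> (('g, 'k) ncpoly)" where
  "ev f A B = multilin_eval fst label_val f (labels A B)"

lemma ev_mult:
  "finite A \<Longrightarrow> finite B \<Longrightarrow>
    ev (ncs_mult f g) A B = (\<Sum>A'\<in>Pow A. \<Sum>B'\<in>Pow B. ev f A' B' * ev g (A - A') (B - B'))"
  unfolding ev_def by (simp add: multilin_eval_mult finite_labels sum_Pow_labels labels_diff)

lemma sum_permutations_labels:
  "(\<Sum>u\<in>perms (Pair c ` A). h (map label_val u)) = (\<Sum>u\<in>perms A. h (map (\<lambda>i. label_val (c, i)) u))"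
proof -
  have "perms (Pair c ` A) = map (Pair c) ` perms A"
    by (rule permutations_of_set_image_inj) (simp add: inj_on_def)
  moreover have "inj_on (map (Pair c)) (perms A)"
    by (rule inj_on_subset[OF inj_mapI]) (auto simp: inj_def)
  ultimately show ?thesis by (simp add: sum.reindex comp_def)
qed

lemma ev_exp_Xi:
  "ev (ncs_exp (ncs_monom [Xi])) A B
    = (if B = {} then sc (1 / fact (card A)) (\<Sum>u\<in>perms A. mon (map \<xi> u)) else 0)"
proof -
  have "fst ` labels A B \<subseteq> {Xi} \<longleftrightarrow> B = {}" by (auto simp: labels_def image_Un image_image)
  then show ?thesis
    using sum_permutations_labels[of "mon :: 'g list \<Rightarrow> ('g, 'k) ncpoly" Xi A]
    by (simp add: ev_def multilin_eval_exp) (simp add: labels_def label_val_def card_image inj_on_def)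
qed

lemma ev_exp_Eta:
  "ev (ncs_exp (ncs_monom [Eta])) A B
    = (if A = {} then sc (1 / fact (card B)) (\<Sum>u\<in>perms B. mon (map \<eta> u)) else 0)"
proof -
  have "fst ` labels A B \<subseteq> {Eta} \<longleftrightarrow> A = {}" by (auto simp: labels_def image_Un image_image)
  then show ?thesis
    using sum_permutations_labels[of "mon :: 'g list \<Rightarrow> ('g, 'k) ncpoly" Eta B]
    by (simp add: ev_def multilin_eval_exp) (simp add: labels_def label_val_def card_image inj_on_def)
qed

lemma ev_exp_exp:
  assumes "finite A" "finite B"
  shows "ev (ncs_mult (ncs_exp (ncs_monom [Xi])) (ncs_exp (ncs_monom [Eta]))) A B
    = sc (1 / fact (card A)) (\<Sum>u\<in>perms A. mon (map \<xi> u))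
      * sc (1 / fact (card B)) (\<Sum>u\<in>perms B. mon (map \<eta> u))" (is "_ = ?X * ?Y")
proof -
  have "ev (ncs_mult (ncs_exp (ncs_monom [Xi])) (ncs_exp (ncs_monom [Eta]))) A B
    = (\<Sum>A'\<in>Pow A. \<Sum>B'\<in>Pow B. if A' = A then if B' = {} then ?X * ?Y else 0 else 0)"
    unfolding ev_mult[OF assms]
  proof (intro sum.cong refl)
    fix A' B' assume "A' \<in> Pow A" "B' \<in> Pow B"
    then show "ev (ncs_exp (ncs_monom [Xi])) A' B' * ev (ncs_exp (ncs_monom [Eta])) (A - A') (B - B')
      = (if A' = A then if B' = {} then ?X * ?Y else 0 else 0)"
      by (auto simp: ev_exp_Xi ev_exp_Eta)
  qed
  also have "\<dots> = (\<Sum>A'\<in>Pow A. if A' = A then ?X * ?Y else 0)"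
    using assms by (intro sum.cong refl) (simp add: sum.delta')
  finally show ?thesis using assms by simp
qed

text \<open>The value of a Lie word at the generic elements, in the multidegree given by \<open>A\<close> and \<open>B\<close>.\<close>

definition lie_sum :: "lie_word \<Rightarrow> nat set \<Rightarrow> nat set \<Rightarrow> 'g" where
  "lie_sum t A B = (if card A = letter_count Xi t \<and> card B = letter_count Eta t
     then \<Sum>xs\<in>perms A. \<Sum>ys\<in>perms B. lie_word_eval bracket t (seq_of \<xi> xs) (seq_of \<eta> ys)
     else 0)"

lemma lie_sum_Bracket:
  assumes fin: "finite A" "finite B"
  shows "lie_sum (Bracket s t) A B = (\<Sum>A'\<in>Pow A. \<Sum>B'\<in>Pow B. bracket (lie_sum s A' B') (lie_sum t (A - A') (B - B')))"
proof (cases "card A = letter_count Xi s + letter_count Xi t \<and> card B = letter_count Eta s + letter_count Eta t")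
  case True
  let ?a = "letter_count Xi s" and ?b = "letter_count Eta s"
  let ?e = "\<lambda>t xs ys. lie_word_eval bracket t (seq_of \<xi> xs) (seq_of \<eta> ys)"
  have eval: "?e (Bracket s t) xs ys = bracket (?e s (take ?a xs) (take ?b ys)) (?e t (drop ?a xs) (drop ?b ys))"
    if "xs \<in> perms A" "ys \<in> perms B" for xs ys
  proof -
    have len: "length xs = card A" "length ys = card B"
      using that by (auto simp: length_finite_permutations_of_set)
    have "?e s xs ys = ?e s (take ?a xs) (take ?b ys)"
      by (rule lie_word_eval_cong) (auto simp: seq_of_def)
    moreover have "lie_word_eval bracket t (\<lambda>i. seq_of \<xi> xs (?a + i)) (\<lambda>j. seq_of \<eta> ys (?b + j)) = ?e t (drop ?a xs) (drop ?b ys)"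
      using len True by (intro lie_word_eval_cong) (auto simp: seq_of_def)
    ultimately show ?thesis by simp
  qed
  have "lie_sum (Bracket s t) A B = (\<Sum>xs\<in>perms A. \<Sum>ys\<in>perms B.
      bracket (?e s (take ?a xs) (take ?b ys)) (?e t (drop ?a xs) (drop ?b ys)))"
    using True by (simp add: lie_sum_def eval del: lie_word_eval.simps)
  also have "\<dots> = (\<Sum>A' | A' \<subseteq> A \<and> card A' = ?a. \<Sum>B' | B' \<subseteq> B \<and> card B' = ?b.
      \<Sum>x\<in>perms A'. \<Sum>y\<in>perms B'.
      \<Sum>x'\<in>perms (A - A'). \<Sum>y'\<in>perms (B - B'). bracket (?e s x y) (?e t x' y'))"
    using True fin by (intro sum_permutations_of_set_split_card2) auto
  also have "\<dots> = (\<Sum>A' | A' \<subseteq> A \<and> card A' = ?a. \<Sum>B' | B' \<subseteq> B \<and> card B' = ?b.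
      bracket (lie_sum s A' B') (lie_sum t (A - A') (B - B')))"
    using True fin
    by (intro sum.cong refl) (auto simp: lie_sum_def bracket_sum_left bracket_sum_right card_Diff_subset finite_subset)
  also have "\<dots> = (\<Sum>A'\<in>Pow A. \<Sum>B' | B' \<subseteq> B \<and> card B' = ?b.
      bracket (lie_sum s A' B') (lie_sum t (A - A') (B - B')))"
    using fin by (intro sum.mono_neutral_left) (auto simp: lie_sum_def)
  also have "\<dots> = (\<Sum>A'\<in>Pow A. \<Sum>B'\<in>Pow B. bracket (lie_sum s A' B') (lie_sum t (A - A') (B - B')))"
    using fin by (intro sum.cong refl sum.mono_neutral_left) (auto simp: lie_sum_def)
  finally show ?thesis .
next
  case False
  have "bracket (lie_sum s A' B') (lie_sum t (A - A') (B - B')) = 0" if "A' \<subseteq> A" "B' \<subseteq> B" for A' B'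
  proof (rule ccontr)
    assume "bracket (lie_sum s A' B') (lie_sum t (A - A') (B - B')) \<noteq> 0"
    then have "lie_sum s A' B' \<noteq> 0" "lie_sum t (A - A') (B - B') \<noteq> 0" by auto
    then have "card A' = letter_count Xi s" "card B' = letter_count Eta s"
      "card (A - A') = letter_count Xi t" "card (B - B') = letter_count Eta t"
      by (auto simp: lie_sum_def split: if_splits)
    moreover have "card A = card A' + card (A - A')" "card B = card B' + card (B - B')"
      using that fin by (simp_all add: card_Diff_subset finite_subset card_mono)
    ultimately show False using False by simp
  qed
  then have "(\<Sum>A'\<in>Pow A. \<Sum>B'\<in>Pow B. bracket (lie_sum s A' B') (lie_sum t (A - A') (B - B'))) = 0"
    by (simp add: sum.neutral)
  moreover have "lie_sum (Bracket s t) A B = 0" using False by (auto simp: lie_sum_def)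
  ultimately show ?thesis by simp
qed

lemma eqv_bracket_letters: "eqv env_rels (mon [x] * mon [y] - mon [y] * mon [x]) (mon [bracket x y])"
proof -
  have "mon [x, y] - mon [y, x] - mon [bracket x y] \<in> gen_ideal env_rels"
    by (rule gen_ideal_base) (auto simp: env_rels_def)
  then show ?thesis by (simp add: eqv_def mon_mult)
qed

lemma eqv_lin_env: "eqv lin_rels p q \<Longrightarrow> eqv env_rels p q"
  by (rule eqv_mono[OF lin_rels_env_rels])

lemma eqv_lin_sum: "eqv lin_rels (\<Sum>i\<in>I. mon [f i]) (mon [\<Sum>i\<in>I. f i])"
  using eqv_sym[OF eqv_sum_letter[where u = "[]" and v = "[]" and f = f and I = I]] by simp

lemma eqv_env_scale: "eqv env_rels (sc c (mon [x])) (mon [scale c x])"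
  using eqv_sym[OF eqv_lin_env[OF eqv_scale_letter[where u = "[]" and v = "[]" and c = c and x = x]]] by simp

lemma ev_monom_Letter:
  assumes fin: "finite A" "finite B"
  shows "eqv env_rels (ev (ncs_monom [c]) A B) (mon [lie_sum (Letter c) A B])"
proof (cases "labels A B \<in> {{(c, i)} | i. True}")
  case True
  then obtain i where i: "labels A B = {(c, i)}" by blast
  then have "(c = Xi \<longrightarrow> A = {i} \<and> B = {}) \<and> (c = Eta \<longrightarrow> A = {} \<and> B = {i})"
    by (auto simp: labels_def)
  then show ?thesis
    using i by (cases c) (auto simp: ev_def multilin_eval_def ncs_monom_def lie_sum_def seq_of_def label_val_def)
next
  case False
  have "map fst u \<noteq> [c]" if "u \<in> perms (labels A B)" for u
  proof
    assume "map fst u = [c]"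
    then obtain i where "u = [(c, i)]" by auto
    then have "labels A B = {(c, i)}" using that by (auto simp: permutations_of_set_def)
    then show False using False by blast
  qed
  then have "ev (ncs_monom [c]) A B = 0" by (simp add: ev_def multilin_eval_def ncs_monom_def)
  moreover have "lie_sum (Letter c) A B = 0"
  proof (rule ccontr)
    assume "lie_sum (Letter c) A B \<noteq> 0"
    then have "card A = (if c = Xi then 1 else 0) \<and> card B = (if c = Eta then 1 else 0)"
      by (auto simp: lie_sum_def split: if_splits)
    then show False using False fin by (cases c) (auto simp: card_1_singleton_iff labels_def)
  qed
  ultimately show ?thesis using eqv_sym[OF eqv_lin_env[OF eqv_zero_letter[of "[]" "[]"]]] by simp
qed

lemma ev_lie_word:
  "finite A \<Longrightarrow> finite B \<Longrightarrow> eqv env_rels (ev (lie_word_ncs t) A B) (mon [lie_sum t A B])"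
proof (induction t arbitrary: A B)
  case (Letter c)
  then show ?case using ev_monom_Letter by simp
next
  case (Bracket s t)
  let ?s = "\<lambda>A B. ev (lie_word_ncs s) A B" and ?t = "\<lambda>A B. ev (lie_word_ncs t) A B"
  let ?b = "\<lambda>A' B'. bracket (lie_sum s A' B') (lie_sum t (A - A') (B - B'))"
  let ?c = "\<lambda>A' B'. ?s A' B' * ?t (A - A') (B - B') - ?t (A - A') (B - B') * ?s A' B'"
  have "ev (lie_word_ncs (Bracket s t)) A B = (\<Sum>A'\<in>Pow A. \<Sum>B'\<in>Pow B. ?s A' B' * ?t (A - A') (B - B'))
    - (\<Sum>A'\<in>Pow A. \<Sum>B'\<in>Pow B. ?t A' B' * ?s (A - A') (B - B'))"
    unfolding ev_mult[OF Bracket.prems, symmetric] by (simp add: ev_def multilin_eval_diff)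
  moreover have "(\<Sum>A'\<in>Pow A. \<Sum>B'\<in>Pow B. ?t A' B' * ?s (A - A') (B - B'))
     = (\<Sum>A'\<in>Pow A. \<Sum>B'\<in>Pow B. ?t (A - A') (B - B') * ?s A' B')"
    unfolding sum.cartesian_product
    by (rule sum.reindex_bij_witness[of _ "\<lambda>(A', B'). (A - A', B - B')" "\<lambda>(A', B'). (A - A', B - B')"])
      (auto simp: double_diff)
  ultimately have eq: "ev (lie_word_ncs (Bracket s t)) A B = (\<Sum>A'\<in>Pow A. \<Sum>B'\<in>Pow B. ?c A' B')"
    by (simp only: sum_subtractf)
  have "eqv env_rels (\<Sum>A'\<in>Pow A. \<Sum>B'\<in>Pow B. ?c A' B') (\<Sum>A'\<in>Pow A. \<Sum>B'\<in>Pow B. mon [?b A' B'])"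
  proof (intro eqv_sum)
    fix A' B' assume "A' \<in> Pow A" "B' \<in> Pow B"
    then have "finite A'" "finite B'" using Bracket.prems by (auto intro: finite_subset)
    then have "eqv env_rels (?s A' B') (mon [lie_sum s A' B'])" "eqv env_rels (?t (A - A') (B - B')) (mon [lie_sum t (A - A') (B - B')])"
      using Bracket.prems by (simp_all add: Bracket.IH)
    then have "eqv env_rels (?c A' B')
      (mon [lie_sum s A' B'] * mon [lie_sum t (A - A') (B - B')] - mon [lie_sum t (A - A') (B - B')] * mon [lie_sum s A' B'])"
      by (intro eqv_diff eqv_mult)
    then show "eqv env_rels (?c A' B') (mon [?b A' B'])"
      by (rule eqv_trans) (rule eqv_bracket_letters)
  qed
  moreover have "eqv env_rels (\<Sum>A'\<in>Pow A. \<Sum>B'\<in>Pow B. mon [?b A' B']) (\<Sum>A'\<in>Pow A. mon [\<Sum>B'\<in>Pow B. ?b A' B'])"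
    by (rule eqv_sum) (rule eqv_lin_env[OF eqv_lin_sum])
  moreover have "eqv env_rels (\<Sum>A'\<in>Pow A. mon [\<Sum>B'\<in>Pow B. ?b A' B']) (mon [lie_sum (Bracket s t) A B])"
    unfolding lie_sum_Bracket[OF Bracket.prems] by (rule eqv_lin_env[OF eqv_lin_sum])
  ultimately show ?case
    unfolding eq by (blast intro: eqv_trans)
qed

definition bch_sum :: "nat set \<Rightarrow> nat set \<Rightarrow> 'g" where
  "bch_sum A B = (\<Sum>xs\<in>perms A. \<Sum>ys\<in>perms B.
     bch_tilde scale bracket E (card A) (card B) (seq_of \<xi> xs) (seq_of \<eta> ys))"

lemma bch_sum_lie_sum:
  "bch_sum A B = (\<Sum>t\<in>Poly_Mapping.keys (E (card A) (card B)). scale (Poly_Mapping.lookup (E (card A) (card B)) t) (lie_sum t A B))"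
proof -
  let ?f = "\<lambda>xs ys t. scale (Poly_Mapping.lookup (E (card A) (card B)) t) (lie_word_eval bracket t (seq_of \<xi> xs) (seq_of \<eta> ys))"
  have "bch_sum A B = (\<Sum>xs\<in>perms A. \<Sum>t\<in>Poly_Mapping.keys (E (card A) (card B)). \<Sum>ys\<in>perms B. ?f xs ys t)"
    unfolding bch_sum_def bch_tilde_def by (intro sum.cong refl sum.swap)
  also have "\<dots> = (\<Sum>t\<in>Poly_Mapping.keys (E (card A) (card B)). \<Sum>xs\<in>perms A. \<Sum>ys\<in>perms B. ?f xs ys t)"
    by (rule sum.swap)
  finally have "bch_sum A B = \<dots>" .
  then show ?thesis by (auto simp: lie_sum_def scale_sum_right E_keys intro!: sum.cong)
qed

lemma ev_bch:
  assumes fin: "finite A" "finite B"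
  shows "eqv env_rels (ev bch_series A B) (mon [bch_sum A B])"
proof -
  let ?E = "E (card A) (card B)"
  have "ev bch_series A B = ev (bch_component (card A) (card B)) A B"
    unfolding ev_def
  proof (rule multilin_eval_cong)
    fix u assume u: "u \<in> perms (labels A B)"
    have "count_list (map fst u) c = card {p \<in> labels A B. fst p = c}" for c
    proof -
      have "count_list (map fst u) c = length (filter (\<lambda>p. fst p = c) u)"
        by (induction u) auto
      also have "\<dots> = card (set (filter (\<lambda>p. fst p = c) u))"
        using u by (intro distinct_card[symmetric]) (simp add: permutations_of_set_def)
      finally show ?thesis using u by (simp add: permutations_of_set_def)
    qed
    moreover have "{p \<in> labels A B. fst p = Xi} = Pair Xi ` A" "{p \<in> labels A B. fst p = Eta} = Pair Eta ` B"
      by (auto simp: labels_def)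
    ultimately show "bch_series (map fst u) = bch_component (card A) (card B) (map fst u)"
      by (simp add: bch_component_def card_image inj_on_def)
  qed
  also have "\<dots> = (\<Sum>t\<in>Poly_Mapping.keys ?E. sc (Poly_Mapping.lookup ?E t) (ev (lie_word_ncs t) A B))"
    unfolding E_component[symmetric] ev_def by (rule multilin_eval_sum)
  also have "eqv env_rels \<dots> (\<Sum>t\<in>Poly_Mapping.keys ?E. sc (Poly_Mapping.lookup ?E t) (mon [lie_sum t A B]))"
    by (intro eqv_sum eqv_sc ev_lie_word fin)
  also have "eqv env_rels \<dots> (\<Sum>t\<in>Poly_Mapping.keys ?E. mon [scale (Poly_Mapping.lookup ?E t) (lie_sum t A B)])"
    by (rule eqv_sum) (rule eqv_env_scale)
  also have "eqv env_rels \<dots> (mon [bch_sum A B])"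
    unfolding bch_sum_lie_sum by (rule eqv_lin_env[OF eqv_lin_sum])
  finally show ?thesis .
qed

definition part_word :: "(nat set \<times> nat set) list \<Rightarrow> 'g list" where
  "part_word P = map (\<lambda>(A, B). bch_sum A B) P"

definition part_sum :: "nat \<Rightarrow> nat set \<Rightarrow> nat set \<Rightarrow> (('g, 'k) ncpoly)" where
  "part_sum r A B = (\<Sum>P\<in>ordparts r A B. mon (part_word P))"

lemma ev_bch_power:
  "finite A \<Longrightarrow> finite B \<Longrightarrow> eqv env_rels (ev (ncs_power bch_series r) A B) (part_sum r A B)"
proof (induction r arbitrary: A B)
  case 0
  then show ?case
    by (simp add: ev_def multilin_eval_one labels_eq_empty part_sum_def ordparts_0 part_word_def mon_Nil)
next
  case (Suc r)
  have "part_sum (Suc r) A B = (\<Sum>A'\<in>Pow A. \<Sum>B'\<in>Pow B. mon [bch_sum A' B'] * part_sum r (A - A') (B - B'))"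
    using Suc.prems by (simp add: part_sum_def sum_ordparts_Suc part_word_def sum_distrib_left mon_mult)
  moreover have "eqv env_rels (ev (ncs_power bch_series (Suc r)) A B)
      (\<Sum>A'\<in>Pow A. \<Sum>B'\<in>Pow B. mon [bch_sum A' B'] * part_sum r (A - A') (B - B'))"
    unfolding ncs_power.simps ev_mult[OF Suc.prems]
  proof (intro eqv_sum eqv_mult)
    fix A' B' assume "A' \<in> Pow A" "B' \<in> Pow B"
    then have "finite A'" "finite B'" using Suc.prems by (auto intro: finite_subset)
    then show "eqv env_rels (ev bch_series A' B') (mon [bch_sum A' B'])" by (rule ev_bch)
    show "eqv env_rels (ev (ncs_power bch_series r) (A - A') (B - B')) (part_sum r (A - A') (B - B'))"
      using Suc.prems by (intro Suc.IH) auto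
  qed
  ultimately show ?case by simp
qed

lemma symmetrize_part_sum: "symmetrize (part_sum r A B) = part_sum r A B"
proof -
  have "symmetrize (part_sum r A B) = (\<Sum>P\<in>ordparts r A B. symw (part_word P))"
    by (simp add: part_sum_def ncp.linear_sum[OF linear_symmetrize] symmetrize_mon)
  also have "\<dots> = (\<Sum>P\<in>ordparts r A B. sc (1 / fact r) (\<Sum>\<pi> | \<pi> permutes {..<r}. mon (part_word (permute_list \<pi> P))))"
    by (intro sum.cong refl)
      (simp add: symw_def part_word_def ordparts_def permute_list_map)
  also have "\<dots> = sc (1 / fact r) (\<Sum>\<pi> | \<pi> permutes {..<r}. \<Sum>P\<in>ordparts r A B. mon (part_word (permute_list \<pi> P)))"
    unfolding nc.scale_sum_right[symmetric] by (subst sum.swap) simp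
  also have "\<dots> = sc (1 / fact r) (\<Sum>\<pi> | \<pi> permutes {..<r}. part_sum r A B)"
  proof (rule arg_cong[of _ _ "sc _"], rule sum.cong)
    fix \<pi> assume "\<pi> \<in> {\<pi>. \<pi> permutes {..<r}}"
    then have "\<pi> permutes {..<r}" by simp
    then show "(\<Sum>P\<in>ordparts r A B. mon (part_word (permute_list \<pi> P))) = part_sum r A B"
      unfolding part_sum_def by (rule sum_ordparts_permute)
  qed simp
  finally show ?thesis by (simp only: sum_permutes_const nc.scale_scale) simp
qed

lemma ev_exp_bch:
  assumes "finite A" "finite B"
  shows "eqv env_rels (ev (ncs_exp bch_series) A B) (\<Sum>r\<le>card A + card B. sc (1 / fact r) (part_sum r A B))"
proof -
  have "ev (ncs_exp bch_series) A B = ev (\<lambda>w. \<Sum>r\<le>card A + card B. 1 / fact r * ncs_power bch_series r w) A B"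
    unfolding ev_def
  proof (rule multilin_eval_cong)
    fix u assume "u \<in> perms (labels A B)"
    then have "length u = card A + card B"
      using assms by (simp add: length_finite_permutations_of_set card_labels)
    then show "ncs_exp bch_series (map fst u) = (\<Sum>r\<le>card A + card B. 1 / fact r * ncs_power bch_series r (map fst u) :: 'k)"
      by (simp add: ncs_exp_def)
  qed
  also have "\<dots> = (\<Sum>r\<le>card A + card B. sc (1 / fact r) (ev (ncs_power bch_series r) A B))"
    unfolding ev_def by (rule multilin_eval_sum)
  also have "eqv env_rels \<dots> (\<Sum>r\<le>card A + card B. sc (1 / fact r) (part_sum r A B))"
    by (intro eqv_sum eqv_sc ev_bch_power assms)
  finally show ?thesis .
qed

theorem symmetrized_product:
  "eqv env_rels (symmetrize (mon (map \<xi> [1..<Suc k])) * symmetrize (mon (map \<eta> [1..<Suc l])))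
    (symmetrize (\<Sum>r\<le>k + l. sc (1 / fact r) (part_sum r {1..k} {1..l})))"
proof -
  have symw_upt: "symw (map f [1..<Suc n]) = (sc (1 / fact n) (\<Sum>u\<in>perms {1..n}. mon (map f u)) :: ('g, 'k) ncpoly)"
    for f n
  proof -
    have "set [1..<Suc n] = {1..n}" by auto
    then show ?thesis using symw_distinct[of "[1..<Suc n]" f] by (simp del: upt_Suc One_nat_def)
  qed
  have "symmetrize (mon (map \<xi> [1..<Suc k])) * symmetrize (mon (map \<eta> [1..<Suc l]))
    = ev (ncs_mult (ncs_exp (ncs_monom [Xi])) (ncs_exp (ncs_monom [Eta]))) {1..k} {1..l}"
    by (simp add: ev_exp_exp symmetrize_mon symw_upt del: upt_Suc One_nat_def)
  also have "\<dots> = ev (ncs_exp bch_series) {1..k} {1..l}"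
    by (simp add: ncs_exp_bch)
  also have "eqv env_rels \<dots> (\<Sum>r\<le>k + l. sc (1 / fact r) (part_sum r {1..k} {1..l}))"
    using ev_exp_bch[of "{1..k}" "{1..l}"] by simp
  also have "\<dots> = symmetrize (\<Sum>r\<le>k + l. sc (1 / fact r) (part_sum r {1..k} {1..l}))"
    by (simp add: ncp.linear_sum[OF linear_symmetrize] ncp.linear_scale[OF linear_symmetrize] symmetrize_part_sum)
  finally show ?thesis .
qed

end

subsection \<open>Summation over block types\<close>

lemma sum_permutes_interval:
  "(\<Sum>\<sigma> | \<sigma> permutes {1..n}. h (map \<sigma> [1..<Suc n])) = (\<Sum>xs\<in>perms {1..n::nat}. h xs)"
proof -
  have inj: "inj_on (\<lambda>\<sigma>. map \<sigma> [1..<Suc n]) {\<sigma>. \<sigma> permutes {1..n}}"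
  proof (rule inj_onI, rule ext)
    fix \<sigma> \<tau> i assume *: "\<sigma> \<in> {\<sigma>. \<sigma> permutes {1..n}}" "\<tau> \<in> {\<sigma>. \<sigma> permutes {1..n}}" "map \<sigma> [1..<Suc n] = map \<tau> [1..<Suc n]"
    show "\<sigma> i = \<tau> i"
    proof (cases "i \<in> {1..n}")
      case True
      then have "i \<in> set [1..<Suc n]" by auto
      then show ?thesis using *(3) map_eq_conv by metis
    next
      case False
      then show ?thesis using * by (metis mem_Collect_eq permutes_not_in)
    qed
  qed
  have "(\<lambda>\<sigma>. map \<sigma> [1..<Suc n]) ` {\<sigma>. \<sigma> permutes {1..n}} = perms {1..n}"
  proof (rule card_subset_eq)
    show "(\<lambda>\<sigma>. map \<sigma> [1..<Suc n]) ` {\<sigma>. \<sigma> permutes {1..n}} \<subseteq> perms {1..n}"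
    proof safe
      fix \<sigma> assume \<sigma>: "\<sigma> permutes {1..n}"
      have "set [1..<Suc n] = {1..n}" by auto
      then show "map \<sigma> [1..<Suc n] \<in> perms {1..n}"
        using permutes_image[OF \<sigma>] permutes_inj_on[OF \<sigma>, of "{1..n}"]
        by (simp add: permutations_of_set_def distinct_map del: upt_Suc)
    qed
    show "card ((\<lambda>\<sigma>. map \<sigma> [1..<Suc n]) ` {\<sigma>. \<sigma> permutes {1..n}}) = card (perms {1..n})"
      by (simp add: card_image[OF inj] card_permutations del: upt_Suc One_nat_def)
  qed simp
  then show ?thesis using sum.reindex[OF inj, of h] by (simp add: comp_def del: upt_Suc One_nat_def)
qed

lemma sum_nth_lessThan: "(\<Sum>i<length J. f (J ! i)) = sum_list (map f J)"
  using sum_list_sum_nth[of "map f J"] by (simp add: atLeast0LessThan)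

lemma all_indices_alt:
  "all_indices r k l = {J. length J = r \<and> (\<forall>p\<in>set J. fst p + snd p \<ge> 1) \<and> sum_list (map fst J) = k \<and> sum_list (map snd J) = l}"
  unfolding all_indices_def by (auto simp: sum_nth_lessThan case_prod_unfold)

lemma sum_list_map_mset: "mset J = mset J' \<Longrightarrow> sum_list (map f J) = (sum_list (map f J') :: nat)"
  by (metis mset_map sum_mset_sum_list)

lemma all_indices_mset: "mset J = mset J' \<Longrightarrow> J \<in> all_indices r k l \<Longrightarrow> J' \<in> all_indices r k l"
  using sum_list_map_mset[of J J' fst] sum_list_map_mset[of J J' snd] mset_eq_setD[of J J'] mset_eq_length[of J J']
  by (simp add: all_indices_alt)

lemma all_indices_box: "J \<in> all_indices r k l \<Longrightarrow> set J \<subseteq> {0..k} \<times> {0..l}"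
proof
  fix p assume "J \<in> all_indices r k l" "p \<in> set J"
  then show "p \<in> {0..k} \<times> {0..l}"
    using member_le_sum_list[of "fst p" "map fst J"] member_le_sum_list[of "snd p" "map snd J"]
    by (auto simp: all_indices_alt mem_Times_iff)
qed

lemma finite_all_indices: "finite (all_indices r k l)"
proof (rule finite_subset)
  show "all_indices r k l \<subseteq> {J. set J \<subseteq> {0..k} \<times> {0..l} \<and> length J = r}"
    using all_indices_box[of _ r k l] by (auto simp: all_indices_alt)
  show "finite {J. set J \<subseteq> {0..k} \<times> {0..l} \<and> length J = r}"
    by (rule finite_lists_length_eq) simp
qed

text \<open>A numerical key that realizes the order of condition (iv) on the entries of a G-index.\<close>

definition index_key :: "nat \<times> nat \<Rightarrow> nat" where
  "index_key p = (fst p + snd p) * (fst p + snd p + 1) + fst p"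

lemma index_key_le:
  "index_key p \<le> index_key q \<longleftrightarrow> fst p + snd p \<le> fst q + snd q \<and> (fst q + snd q = fst p + snd p \<longrightarrow> fst p \<le> fst q)"
proof -
  have lt: "index_key p < index_key q" if "fst p + snd p < fst q + snd q" for p q
  proof -
    let ?s = "fst p + snd p" and ?t = "fst q + snd q"
    have "index_key p < (?s + 1) * (?s + 2)" by (simp add: index_key_def)
    also have "\<dots> \<le> ?t * (?t + 1)" using that by (intro mult_le_mono) auto
    also have "\<dots> \<le> index_key q" by (simp add: index_key_def)
    finally show ?thesis .
  qed
  show ?thesis
  proof (cases "fst p + snd p" "fst q + snd q" rule: linorder_cases)
    case equal
    then have "index_key p \<le> index_key q \<longleftrightarrow> fst p \<le> fst q" unfolding index_key_def by simp
    with equal show ?thesis by simp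
  qed (use lt[of p q] lt[of q p] in auto)
qed

lemma inj_index_key: "inj index_key"
proof
  fix p q assume "index_key p = index_key q"
  then have "index_key p \<le> index_key q" "index_key q \<le> index_key p" by simp_all
  then have "fst p + snd p = fst q + snd q" "fst p = fst q" unfolding index_key_le by linarith+
  then show "p = q" by (simp add: prod_eq_iff)
qed

definition admissible :: "(nat \<times> nat) list \<Rightarrow> bool" where
  "admissible J \<longleftrightarrow> (\<forall>p\<in>set J. (fst p = 0 \<longrightarrow> snd p = 1) \<and> (snd p = 0 \<longrightarrow> fst p = 1))"

lemma G_indices_alt: "G_indices r k l = {J \<in> all_indices r k l. admissible J \<and> sorted (map index_key J)}"
proof (rule Set.set_eqI)
  fix J
  have "sorted (map index_key J) \<longleftrightarrow> (\<forall>i<length J. \<forall>j<i. index_key (J ! j) \<le> index_key (J ! i))"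
    by (auto simp: sorted_iff_nth_mono_less)
  also have "\<dots> \<longleftrightarrow> (\<forall>i<length J. \<forall>j<i.
            fst (J ! i) + snd (J ! i) \<ge> fst (J ! j) + snd (J ! j)
          \<and> (fst (J ! i) + snd (J ! i) = fst (J ! j) + snd (J ! j) \<longrightarrow> fst (J ! i) \<ge> fst (J ! j)))"
    by (simp only: index_key_le)
  finally have sorted: "sorted (map index_key J) \<longleftrightarrow> \<dots>" .
  have "J \<in> G_indices r k l \<longleftrightarrow> set J \<subseteq> {0..k} \<times> {0..l} \<and> J \<in> all_indices r k l \<and> admissible J \<and> sorted (map index_key J)"
  proof (cases "length J = r")
    case True
    show ?thesis
      unfolding G_indices_def all_indices_def admissible_def sorted mem_Collect_eq case_prod_unfold True[symmetric]
      by (rule iffI; elim conjE; intro conjI; assumption)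
  qed (simp add: G_indices_def all_indices_def)
  then show "J \<in> G_indices r k l \<longleftrightarrow> J \<in> {J \<in> all_indices r k l. admissible J \<and> sorted (map index_key J)}"
    using all_indices_box[of J r k l] by blast
qed

lemma G_factorial_mset:
  assumes "set J \<subseteq> {0..k} \<times> {0..l}"
  shows "G_factorial k l J = (\<Prod>x\<in>set_mset (mset J). fact (count (mset J) x))"
  unfolding G_factorial_def using assms
  by (intro prod.mono_neutral_cong_right) (auto simp: count_mset count_list_0_iff)

lemma G_factorial_card:
  assumes "J \<in> all_indices r k l"
  shows "G_factorial k l J * card (permutations_of_multiset (mset J)) = fact r"
  using card_permutations_of_multiset[of "mset J"] all_indices_box[OF assms] assms
  by (simp add: G_factorial_mset all_indices_alt)

lemma covers_sum_card: "finite A \<Longrightarrow> covers A L \<Longrightarrow> sum_list (map card L) = card A"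
proof (induction L arbitrary: A)
  case (Cons S L)
  then have "S \<subseteq> A" "covers (A - S) L" by (auto simp: covers_Cons)
  moreover from this have "sum_list (map card L) = card (A - S)" using Cons by simp
  ultimately show ?case using Cons.prems(1) by (simp add: card_Diff_subset finite_subset card_mono)
qed (simp add: covers_Nil)

definition part_type :: "('a set \<times> 'b set) list \<Rightarrow> (nat \<times> nat) list" where
  "part_type P = map (\<lambda>p. (card (fst p), card (snd p))) P"

context gutt
begin

lemma bch_tilde_cong:
  assumes "\<And>i. 1 \<le> i \<Longrightarrow> i \<le> a \<Longrightarrow> x i = x' i" "\<And>j. 1 \<le> j \<Longrightarrow> j \<le> b \<Longrightarrow> y j = y' j"
  shows "bch_tilde scale bracket E a b x y = bch_tilde scale bracket E a b x' y'"
  unfolding bch_tilde_def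
  by (intro sum.cong refl arg_cong[of _ _ "scale _"] lie_word_eval_cong) (use assms E_keys in auto)

primrec blocks :: "(nat \<times> nat) list \<Rightarrow> nat list \<Rightarrow> nat list \<Rightarrow> 'g list" where
  "blocks [] xs ys = []"
| "blocks (p # J) xs ys = bch_tilde scale bracket E (fst p) (snd p) (seq_of \<xi> (take (fst p) xs)) (seq_of \<eta> (take (snd p) ys))
     # blocks J (drop (fst p) xs) (drop (snd p) ys)"

lemma blocks_conv_map:
  assumes "sum_list (map fst J) \<le> length xs" "sum_list (map snd J) \<le> length ys"
    and "\<And>i. 1 \<le> i \<Longrightarrow> i \<le> sum_list (map fst J) \<Longrightarrow> x i = \<xi> (xs ! (i - 1))"
    and "\<And>j. 1 \<le> j \<Longrightarrow> j \<le> sum_list (map snd J) \<Longrightarrow> y j = \<eta> (ys ! (j - 1))"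
  shows "map (\<lambda>i. bch_tilde scale bracket E (fst (J ! i)) (snd (J ! i))
      (\<lambda>m. x ((\<Sum>j<i. fst (J ! j)) + m)) (\<lambda>m. y ((\<Sum>j<i. snd (J ! j)) + m))) [0..<length J] = blocks J xs ys"
  using assms
proof (induction J arbitrary: xs ys x y)
  case (Cons p J)
  let ?b = "\<lambda>J x y i. bch_tilde scale bracket E (fst (J ! i)) (snd (J ! i))
      (\<lambda>m. x ((\<Sum>j<i. fst (J ! j)) + m)) (\<lambda>m. y ((\<Sum>j<i. snd (J ! j)) + m))"
  have "map (?b (p # J) x y) [0..<length (p # J)] = ?b (p # J) x y 0 # map (\<lambda>i. ?b (p # J) x y (Suc i)) [0..<length J]"
    by (simp only: length_Cons upt_conv_Cons zero_less_Suc list.map map_Suc_upt[symmetric] map_map comp_def)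
  also have "map (\<lambda>i. ?b (p # J) x y (Suc i)) [0..<length J]
      = map (?b J (\<lambda>i. x (fst p + i)) (\<lambda>j. y (snd p + j))) [0..<length J]"
    by (simp add: sum.lessThan_Suc_shift add.assoc del: sum.lessThan_Suc)
  also have "\<dots> = blocks J (drop (fst p) xs) (drop (snd p) ys)"
    using Cons.prems by (intro Cons.IH) (auto simp: add.commute)
  also have "?b (p # J) x y 0 = bch_tilde scale bracket E (fst p) (snd p) (seq_of \<xi> (take (fst p) xs)) (seq_of \<eta> (take (snd p) ys))"
    using Cons.prems(3,4) by simp (intro bch_tilde_cong, auto simp: seq_of_def)
  finally show ?case by simp
qed simp

definition typed_sum :: "(nat \<times> nat) list \<Rightarrow> nat set \<Rightarrow> nat set \<Rightarrow> (('g, 'k) ncpoly)" where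
  "typed_sum J A B = (\<Sum>P\<in>ordparts (length J) A B. if part_type P = J then mon (part_word P) else 0)"

lemma typed_sum_Cons:
  assumes "finite A" "finite B"
  shows "typed_sum (p # J) A B = (\<Sum>A' | A' \<subseteq> A \<and> card A' = fst p. \<Sum>B' | B' \<subseteq> B \<and> card B' = snd p.
    mon [bch_sum A' B'] * typed_sum J (A - A') (B - B'))"
proof -
  let ?f = "\<lambda>A' B'. mon [bch_sum A' B'] * typed_sum J (A - A') (B - B')"
  have "typed_sum (p # J) A B = (\<Sum>A'\<in>Pow A. \<Sum>B'\<in>Pow B. if card A' = fst p \<and> card B' = snd p then ?f A' B' else 0)"
    unfolding typed_sum_def[of "p # J"] length_Cons sum_ordparts_Suc[OF assms]
    by (intro sum.cong refl)
      (auto simp: part_type_def part_word_def typed_sum_def sum_distrib_left mon_mult prod_eq_iff intro!: sum.cong)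
  also have "\<dots> = (\<Sum>A'\<in>Pow A. \<Sum>B' | B' \<subseteq> B \<and> card B' = snd p. if card A' = fst p then ?f A' B' else 0)"
    using assms by (intro sum.cong refl sum.mono_neutral_cong_right) auto
  also have "\<dots> = (\<Sum>A' | A' \<subseteq> A \<and> card A' = fst p. \<Sum>B' | B' \<subseteq> B \<and> card B' = snd p. ?f A' B')"
    using assms by (intro sum.mono_neutral_cong_right) auto
  finally show ?thesis .
qed

lemma sum_blocks_typed_sum:
  assumes "finite A" "finite B" "card A = sum_list (map fst J)" "card B = sum_list (map snd J)"
  shows "eqv lin_rels (\<Sum>xs\<in>perms A. \<Sum>ys\<in>perms B. mon (blocks J xs ys)) (typed_sum J A B)"
  using assms
proof (induction J arbitrary: A B)
  case Nil
  then show ?case by (simp add: typed_sum_def ordparts_0 part_type_def part_word_def)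
next
  case (Cons p J)
  define h where "h x x' y y' = mon [bch_tilde scale bracket E (fst p) (snd p) (seq_of \<xi> x) (seq_of \<eta> y)] * (mon (blocks J x' y') :: ('g, 'k) ncpoly)" for x x' y y'
  have "(\<Sum>xs\<in>perms A. \<Sum>ys\<in>perms B. mon (blocks (p # J) xs ys))
    = (\<Sum>xs\<in>perms A. \<Sum>ys\<in>perms B. h (take (fst p) xs) (drop (fst p) xs) (take (snd p) ys) (drop (snd p) ys))"
    by (simp add: h_def mon_mult)
  also have "\<dots> = (\<Sum>A' | A' \<subseteq> A \<and> card A' = fst p. \<Sum>B' | B' \<subseteq> B \<and> card B' = snd p.
        \<Sum>x\<in>perms A'. \<Sum>y\<in>perms B'.
        \<Sum>x'\<in>perms (A - A'). \<Sum>y'\<in>perms (B - B'). h x x' y y')"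
    using Cons.prems by (intro sum_permutations_of_set_split_card2) auto
  finally have eq: "(\<Sum>xs\<in>perms A. \<Sum>ys\<in>perms B. mon (blocks (p # J) xs ys)) = \<dots>" .
  show ?case
    unfolding eq typed_sum_Cons[OF Cons.prems(1,2)]
  proof (rule eqv_sum, rule eqv_sum)
    fix A' B' assume "A' \<in> {A'. A' \<subseteq> A \<and> card A' = fst p}" "B' \<in> {B'. B' \<subseteq> B \<and> card B' = snd p}"
    then have AB: "A' \<subseteq> A" "card A' = fst p" "B' \<subseteq> B" "card B' = snd p" by auto
    then have fin: "finite A'" "finite B'" using Cons.prems by (auto intro: finite_subset)
    let ?x = "\<lambda>x y. bch_tilde scale bracket E (fst p) (snd p) (seq_of \<xi> x) (seq_of \<eta> y)"
    have "eqv lin_rels (\<Sum>x\<in>perms A'. \<Sum>y\<in>perms B'. mon [?x x y])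
       (\<Sum>x\<in>perms A'. mon [\<Sum>y\<in>perms B'. ?x x y])"
      by (rule eqv_sum) (rule eqv_lin_sum)
    moreover have "eqv lin_rels (\<Sum>x\<in>perms A'. mon [\<Sum>y\<in>perms B'. ?x x y]) (mon [bch_sum A' B'])"
      unfolding bch_sum_def AB by (rule eqv_lin_sum)
    ultimately have 1: "eqv lin_rels (\<Sum>x\<in>perms A'. \<Sum>y\<in>perms B'. mon [?x x y]) (mon [bch_sum A' B'])"
      by (rule eqv_trans)
    have 2: "eqv lin_rels (\<Sum>x'\<in>perms (A - A'). \<Sum>y'\<in>perms (B - B'). mon (blocks J x' y'))
       (typed_sum J (A - A') (B - B'))"
      using Cons.prems AB fin by (intro Cons.IH) (auto simp: card_Diff_subset)
    have "(\<Sum>x'\<in>perms (A - A'). \<Sum>y'\<in>perms (B - B'). h x x' y y')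
      = mon [?x x y] * (\<Sum>x'\<in>perms (A - A'). \<Sum>y'\<in>perms (B - B'). mon (blocks J x' y'))" for x y
      by (simp add: h_def sum_distrib_left)
    then have "(\<Sum>x\<in>perms A'. \<Sum>y\<in>perms B'.
        \<Sum>x'\<in>perms (A - A'). \<Sum>y'\<in>perms (B - B'). h x x' y y')
      = (\<Sum>x\<in>perms A'. \<Sum>y\<in>perms B'. mon [?x x y])
        * (\<Sum>x'\<in>perms (A - A'). \<Sum>y'\<in>perms (B - B'). mon (blocks J x' y'))"
      by (simp only: sum_distrib_right)
    then show "eqv lin_rels (\<Sum>x\<in>perms A'. \<Sum>y\<in>perms B'.
        \<Sum>x'\<in>perms (A - A'). \<Sum>y'\<in>perms (B - B'). h x x' y y')
      (mon [bch_sum A' B'] * typed_sum J (A - A') (B - B'))"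
      using eqv_mult[OF 1 2] by simp
  qed
qed

lemma typed_sum_mset:
  assumes "mset J = mset J'"
  shows "eqv sym_rels (typed_sum J A B) (typed_sum J' A B)"
proof -
  have len: "length J = length J'" using assms by (rule mset_eq_length)
  obtain \<pi> where \<pi>: "\<pi> permutes {..<length J'}" "permute_list \<pi> J' = J"
    using mset_eq_permutation[OF assms] by auto
  have pinj: "permute_list \<pi> u = permute_list \<pi> v \<longleftrightarrow> u = v" if "length u = length J'" "length v = length J'" for u v :: "(nat \<times> nat) list"
  proof
    assume *: "permute_list \<pi> u = permute_list \<pi> v"
    have "permute_list (inv_into UNIV \<pi>) (permute_list \<pi> w) = w" if "length w = length J'" for w :: "(nat \<times> nat) list"
      using permute_list_compose[of "inv_into UNIV \<pi>" w \<pi>] permutes_inv[OF \<pi>(1)] permutes_inv_o(1)[OF \<pi>(1)] that by simp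
    then show "u = v" using that * by metis
  qed simp
  have "typed_sum J A B = (\<Sum>P\<in>ordparts (length J') A B. if part_type (permute_list \<pi> P) = J then mon (part_word (permute_list \<pi> P)) else 0)"
    unfolding typed_sum_def len by (rule sum_ordparts_permute[OF \<pi>(1), symmetric])
  also have "eqv sym_rels \<dots> (typed_sum J' A B)"
    unfolding typed_sum_def
  proof (rule eqv_sum)
    fix P assume "P \<in> ordparts (length J') A B"
    then have lP: "length P = length J'" by (simp add: ordparts_def)
    have "part_type (permute_list \<pi> P) = permute_list \<pi> (part_type P)"
      unfolding part_type_def using \<pi>(1) lP by (simp add: permute_list_map)
    then have "part_type (permute_list \<pi> P) = J \<longleftrightarrow> part_type P = J'"
      using pinj[of "part_type P" J'] \<pi>(2) lP by (simp add: part_type_def)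
    moreover have "mset (part_word (permute_list \<pi> P)) = mset (part_word P)"
      unfolding part_word_def using \<pi>(1) lP by (simp flip: permute_list_map)
    ultimately show "eqv sym_rels (if part_type (permute_list \<pi> P) = J then mon (part_word (permute_list \<pi> P)) else 0)
       (if part_type P = J' then mon (part_word P) else 0)"
      by (simp add: eqv_mset)
  qed
  finally show ?thesis .
qed

lemma bch_sum_zero: "E (card A) (card B) = 0 \<Longrightarrow> bch_sum A B = 0"
  by (simp add: bch_sum_lie_sum)

lemma part_word_zero:
  assumes "p \<in> set (part_type P)" "E (fst p) (snd p) = 0"
  shows "eqv lin_rels (mon (part_word P)) 0"
proof -
  obtain q where q: "q \<in> set P" "p = (card (fst q), card (snd q))"
    using assms(1) by (auto simp: part_type_def)
  then obtain P1 P2 where "P = P1 @ q # P2" by (meson split_list)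
  then have "part_word P = part_word P1 @ 0 # part_word P2"
    using bch_sum_zero[of "fst q" "snd q"] assms(2) q by (simp add: part_word_def case_prod_unfold)
  then show ?thesis by (simp add: eqv_zero_letter)
qed

lemma typed_sum_not_admissible:
  assumes "J \<in> all_indices r k l" "\<not> admissible J"
  shows "eqv lin_rels (typed_sum J A B) 0"
proof -
  obtain p where p: "p \<in> set J" "(fst p = 0 \<and> snd p \<noteq> 1) \<or> (snd p = 0 \<and> fst p \<noteq> 1)"
    using assms(2) by (auto simp: admissible_def)
  moreover have "fst p + snd p \<ge> 1" using assms(1) p by (simp add: all_indices_alt)
  ultimately have "fst p = 0 \<and> snd p \<ge> 2 \<or> snd p = 0 \<and> fst p \<ge> 2" by linarith
  then have "E (fst p) (snd p) = 0" using E_zero by metis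
  then have "eqv lin_rels (typed_sum J A B) (\<Sum>P\<in>ordparts (length J) A B. 0)"
    unfolding typed_sum_def using p(1) by (intro eqv_sum) (auto simp: part_word_zero)
  then show ?thesis by simp
qed

lemma part_sum_typed_sum:
  "eqv lin_rels (part_sum r {1..k} {1..l}) (\<Sum>J\<in>all_indices r k l. typed_sum J {1..k} {1..l})"
proof -
  let ?O = "ordparts r {1..k} {1..l}"
  have "(\<Sum>J\<in>all_indices r k l. typed_sum J {1..k} {1..l})
     = (\<Sum>J\<in>all_indices r k l. \<Sum>P\<in>?O. if part_type P = J then mon (part_word P) else 0)"
    by (intro sum.cong refl) (simp add: typed_sum_def all_indices_def)
  also have "\<dots> = (\<Sum>P\<in>?O. \<Sum>J\<in>all_indices r k l. if part_type P = J then mon (part_word P) else 0)"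
    by (rule sum.swap)
  also have "\<dots> = (\<Sum>P\<in>?O. if part_type P \<in> all_indices r k l then mon (part_word P) else 0)"
    by (simp add: sum.delta' finite_all_indices)
  finally have eq: "(\<Sum>J\<in>all_indices r k l. typed_sum J {1..k} {1..l}) = \<dots>" .
  show ?thesis
    unfolding eq part_sum_def
  proof (rule eqv_sum)
    fix P assume P: "P \<in> ?O"
    show "eqv lin_rels (mon (part_word P)) (if part_type P \<in> all_indices r k l then mon (part_word P) else 0)"
    proof (cases "part_type P \<in> all_indices r k l")
      case False
      have "sum_list (map fst (part_type P)) = k" "sum_list (map snd (part_type P)) = l"
        using P covers_sum_card[of "{1..k}" "map fst P"] covers_sum_card[of "{1..l}" "map snd P"]
        by (simp_all add: ordparts_def part_type_def comp_def)
      then obtain p where p: "p \<in> set (part_type P)" "fst p = 0" "snd p = 0"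
        using False P by (auto simp: all_indices_alt ordparts_def part_type_def not_le)
      then have "E (fst p) (snd p) = 0" by (simp add: E_0_0)
      then show ?thesis using part_word_zero[OF p(1)] False by simp
    qed simp
  qed
qed

theorem typed_sum_G_indices:
  "eqv sym_rels (sc (1 / fact r) (\<Sum>J\<in>all_indices r k l. typed_sum J A B))
    (\<Sum>J\<in>G_indices r k l. sc (1 / of_nat (G_factorial k l J)) (typed_sum J A B))"
proof -
  let ?V = "{J \<in> all_indices r k l. admissible J}"
  let ?T = "\<lambda>J. typed_sum J A B"
  have "eqv sym_rels (\<Sum>J\<in>all_indices r k l. ?T J) (\<Sum>J\<in>all_indices r k l. if admissible J then ?T J else 0)"
    using eqv_mono[OF lin_rels_sym_rels typed_sum_not_admissible] by (intro eqv_sum) auto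
  also have "(\<Sum>J\<in>all_indices r k l. if admissible J then ?T J else 0) = (\<Sum>J\<in>?V. ?T J)"
    by (simp add: sum.inter_filter finite_all_indices)
  also have "\<dots> = (\<Sum>J0\<in>G_indices r k l. \<Sum>J\<in>{J \<in> ?V. sort_key index_key J = J0}. ?T J)"
  proof (rule sum.group[symmetric])
    show "sort_key index_key ` ?V \<subseteq> G_indices r k l"
    proof safe
      fix J assume J: "J \<in> all_indices r k l" "admissible J"
      have "sort_key index_key J \<in> all_indices r k l" by (rule all_indices_mset[OF _ J(1)]) simp
      then show "sort_key index_key J \<in> G_indices r k l"
        using J(2) by (simp add: G_indices_alt admissible_def)
    qed
  qed (simp_all add: finite_all_indices G_indices_alt)
  also have "eqv sym_rels \<dots> (\<Sum>J\<in>G_indices r k l. sc (of_nat (card (permutations_of_multiset (mset J)))) (?T J))"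
  proof (rule eqv_sum)
    fix J0 assume J0: "J0 \<in> G_indices r k l"
    have "J \<in> ?V \<and> sort_key index_key J = J0 \<longleftrightarrow> mset J = mset J0" for J
    proof
      assume *: "mset J = mset J0"
      then have "J \<in> all_indices r k l" using J0 all_indices_mset[of J0 J] by (simp add: G_indices_alt)
      moreover have "admissible J" using J0 mset_eq_setD[OF *] by (simp add: G_indices_alt admissible_def)
      moreover have "sort_key index_key J = J0"
        using * J0 inj_index_key by (intro sort_key_inj_key_eq) (auto simp: G_indices_alt intro: inj_on_subset)
      ultimately show "J \<in> ?V \<and> sort_key index_key J = J0" by simp
    qed auto
    then have set: "{J \<in> ?V. sort_key index_key J = J0} = permutations_of_multiset (mset J0)"
      by (auto simp: permutations_of_multiset_def)
    have "eqv sym_rels (\<Sum>J\<in>permutations_of_multiset (mset J0). ?T J) (\<Sum>J\<in>permutations_of_multiset (mset J0). ?T J0)"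
      by (rule eqv_sum) (auto simp: permutations_of_multiset_def intro: typed_sum_mset)
    then show "eqv sym_rels (\<Sum>J\<in>{J \<in> ?V. sort_key index_key J = J0}. ?T J) (sc (of_nat (card (permutations_of_multiset (mset J0)))) (?T J0))"
      unfolding set by (simp add: sc_of_nat)
  qed
  finally have "eqv sym_rels (sc (1 / fact r) (\<Sum>J\<in>all_indices r k l. ?T J))
     (sc (1 / fact r) (\<Sum>J\<in>G_indices r k l. sc (of_nat (card (permutations_of_multiset (mset J)))) (?T J)))"
    by (rule eqv_sc)
  also have "sc (1 / fact r) (\<Sum>J\<in>G_indices r k l. sc (of_nat (card (permutations_of_multiset (mset J)))) (?T J))
     = (\<Sum>J\<in>G_indices r k l. sc (1 / of_nat (G_factorial k l J)) (?T J))"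
    unfolding nc.scale_sum_right nc.scale_scale
  proof (intro sum.cong refl arg_cong2[of _ _ _ _ sc])
    fix J assume "J \<in> G_indices r k l"
    then have "G_factorial k l J * card (permutations_of_multiset (mset J)) = fact r"
      by (intro G_factorial_card) (simp add: G_indices_alt)
    then have *: "of_nat (G_factorial k l J) * of_nat (card (permutations_of_multiset (mset J))) = (fact r :: 'k)"
      by (metis of_nat_fact of_nat_mult)
    then have "of_nat (G_factorial k l J) \<noteq> (0::'k)" by (metis fact_nonzero mult_zero_left)
    then show "1 / fact r * of_nat (card (permutations_of_multiset (mset J))) = 1 / (of_nat (G_factorial k l J) :: 'k)"
      using * by (simp add: field_simps)
  qed
  finally show ?thesis .
qed

end

subsection \<open>The quotient algebras\<close>

lemma carrier_free_algebra: "carrier (free_algebra :: ('a, 'k::ring_1) ncs ring) = (\<Union>p. {coef p})"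
proof -
  have "f \<in> (\<Union>p. {coef p})" if "finite {w. f w \<noteq> 0}" for f :: "('a, 'k) ncs"
    using lookup_Abs_poly_mapping[OF that] by (metis UN_iff UNIV_I singletonI)
  then show ?thesis by (auto simp: free_algebra_def)
qed

lemma lookup_carrier [simp]: "coef p \<in> carrier free_algebra"
  by (auto simp: carrier_free_algebra)

lemma free_algebra_cases:
  assumes "f \<in> carrier free_algebra"
  obtains p where "f = coef p"
  using assms by (auto simp: carrier_free_algebra)

lemma free_algebra_mult: "coef p \<otimes>\<^bsub>free_algebra\<^esub> coef q = coef (p * q)"
  by (simp add: free_algebra_def lookup_mult_list)

lemma free_algebra_add: "coef p \<oplus>\<^bsub>free_algebra\<^esub> coef q = coef (p + q)"
  by (simp add: free_algebra_def fun_eq_iff lookup_add)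

lemma free_algebra_one: "\<one>\<^bsub>free_algebra\<^esub> = coef 1"
  by (simp add: free_algebra_def lookup_one_list)

lemma free_algebra_zero: "\<zero>\<^bsub>free_algebra\<^esub> = coef 0"
  by (simp add: free_algebra_def ncs_const_def fun_eq_iff)

lemmas free_algebra_ops = free_algebra_mult free_algebra_add free_algebra_one free_algebra_zero

lemma ring_free_algebra: "ring (free_algebra :: ('a, 'k::ring_1) ncs ring)"
proof (rule ringI)
  show "abelian_group (free_algebra :: ('a, 'k) ncs ring)"
  proof (rule abelian_groupI)
    fix x :: "('a, 'k) ncs" assume "x \<in> carrier free_algebra"
    then obtain p where "x = coef p" by (rule free_algebra_cases)
    then have "coef (- p) \<oplus>\<^bsub>free_algebra\<^esub> x = \<zero>\<^bsub>free_algebra\<^esub>" by (simp add: free_algebra_ops)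
    then show "\<exists>y\<in>carrier free_algebra. y \<oplus>\<^bsub>free_algebra\<^esub> x = \<zero>\<^bsub>free_algebra\<^esub>" using lookup_carrier by blast
  qed (auto elim!: free_algebra_cases simp: free_algebra_ops add_ac)
  show "monoid (free_algebra :: ('a, 'k) ncs ring)"
    by (rule monoidI) (auto elim!: free_algebra_cases simp: free_algebra_ops mult.assoc)
qed (auto elim!: free_algebra_cases simp: free_algebra_ops ring_distribs)

definition lookup_ideal :: "('a list \<Rightarrow>\<^sub>0 'k::field) set \<Rightarrow> ('a, 'k) ncs set" where
  "lookup_ideal R = coef ` gen_ideal R"

lemma lookup_mem_ideal: "coef p \<in> lookup_ideal R \<longleftrightarrow> p \<in> gen_ideal R"
  by (auto simp: lookup_ideal_def dest: poly_mapping.lookup_inject[THEN iffD1])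

lemma ideal_lookup_ideal: "ideal (lookup_ideal R) free_algebra"
proof -
  interpret F: ring "free_algebra :: ('a, 'k::field) ncs ring" by (rule ring_free_algebra)
  show ?thesis
  proof (rule idealI[OF ring_free_algebra])
    show "subgroup (lookup_ideal R) (add_monoid free_algebra)"
    proof (rule F.add.subgroupI)
      fix a assume "a \<in> lookup_ideal R"
      then obtain p where p: "a = coef p" "p \<in> gen_ideal R" by (auto simp: lookup_ideal_def)
      have "\<ominus>\<^bsub>free_algebra\<^esub> a = coef (- p)"
        by (rule F.minus_equality) (simp_all add: p free_algebra_ops)
      then show "\<ominus>\<^bsub>free_algebra\<^esub> a \<in> lookup_ideal R"
        using p by (simp add: lookup_mem_ideal gen_ideal_uminus)
    qed (auto simp: lookup_ideal_def free_algebra_ops gen_ideal.add intro: gen_ideal.zero)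
  qed (auto elim!: free_algebra_cases simp: lookup_ideal_def free_algebra_ops gen_ideal_mult_left gen_ideal_mult_right)
qed

lemma genideal_free_algebra: "Idl\<^bsub>free_algebra\<^esub> (coef ` R) = lookup_ideal R"
proof
  interpret F: ring "free_algebra :: ('a, 'k::field) ncs ring" by (rule ring_free_algebra)
  show "Idl\<^bsub>free_algebra\<^esub> (coef ` R) \<subseteq> lookup_ideal R"
    by (rule F.genideal_minimal[OF ideal_lookup_ideal]) (auto simp: lookup_mem_ideal gen_ideal_base)
  have sub: "coef ` R \<subseteq> carrier free_algebra" by auto
  interpret I: ideal "Idl\<^bsub>free_algebra\<^esub> (coef ` R)" free_algebra
    by (rule F.genideal_ideal[OF sub])
  have "coef p \<in> Idl\<^bsub>free_algebra\<^esub> (coef ` R)" if "p \<in> gen_ideal R" for p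
    using that
  proof (induction rule: gen_ideal.induct)
    case (gen r p q)
    then have "coef r \<in> Idl\<^bsub>free_algebra\<^esub> (coef ` R)"
      using F.genideal_self[OF sub] by blast
    then have "coef p \<otimes>\<^bsub>free_algebra\<^esub> coef r \<otimes>\<^bsub>free_algebra\<^esub> coef q
      \<in> Idl\<^bsub>free_algebra\<^esub> (coef ` R)"
      by (intro I.I_l_closed I.I_r_closed lookup_carrier)
    then show ?case by (simp add: free_algebra_ops)
  next
    case zero
    show ?case using I.zero_closed unfolding free_algebra_zero .
  next
    case (add a b)
    from I.a_closed[OF add.IH] show ?case by (simp add: free_algebra_ops)
  qed
  then show "lookup_ideal R \<subseteq> Idl\<^bsub>free_algebra\<^esub> (coef ` R)"
    by (auto simp: lookup_ideal_def)
qed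

definition cls :: "('a list \<Rightarrow>\<^sub>0 'k::field) set \<Rightarrow> (('a, 'k) ncpoly) \<Rightarrow> ('a, 'k) ncs set" where
  "cls R p = lookup_ideal R +>\<^bsub>free_algebra\<^esub> coef p"

abbreviation quot :: "('a list \<Rightarrow>\<^sub>0 'k::field) set \<Rightarrow> ('a, 'k) ncs set ring" where
  "quot R \<equiv> free_algebra Quot lookup_ideal R"

lemma mem_cls: "f \<in> cls R p \<longleftrightarrow> (\<exists>q. f = coef q \<and> eqv R q p)"
proof
  assume "f \<in> cls R p"
  then obtain r where "r \<in> gen_ideal R" "f = coef (r + p)"
    by (auto simp: cls_def a_r_coset_def' lookup_ideal_def free_algebra_ops)
  then show "\<exists>q. f = coef q \<and> eqv R q p" by (auto simp: eqv_def)
next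
  assume "\<exists>q. f = coef q \<and> eqv R q p"
  then obtain q where q: "f = coef q" "q - p \<in> gen_ideal R" by (auto simp: eqv_def)
  then have "f = coef (q - p) \<oplus>\<^bsub>free_algebra\<^esub> coef p" by (simp add: free_algebra_ops)
  then show "f \<in> cls R p" using q(2) by (auto simp: cls_def a_r_coset_def' lookup_ideal_def)
qed

lemma cls_eq_iff: "cls R p = cls R q \<longleftrightarrow> eqv R p q"
proof
  assume "cls R p = cls R q"
  moreover have "coef p \<in> cls R p" unfolding mem_cls using eqv_refl by blast
  ultimately have "coef p \<in> cls R q" by simp
  then obtain p' where "coef p = coef p'" "eqv R p' q"
    unfolding mem_cls by blast
  then show "eqv R p q" by (simp add: poly_mapping.lookup_inject)
next
  assume "eqv R p q"
  then show "cls R p = cls R q"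
    by (auto simp: mem_cls; meson eqv_trans eqv_sym)
qed

lemma carrier_quot: "carrier (quot R) = (\<Union>p. {cls R p})"
  by (auto simp: FactRing_def A_RCOSETS_def' cls_def elim!: free_algebra_cases intro: bexI[OF refl lookup_carrier])

lemma cls_carrier [simp]: "cls R p \<in> carrier (quot R)"
  by (auto simp: carrier_quot)

lemma quot_cases:
  assumes "X \<in> carrier (quot R)"
  obtains p where "X = cls R p"
  using assms by (auto simp: carrier_quot)

lemma ring_quot: "ring (quot R)"
  by (rule ideal.quotient_is_ring[OF ideal_lookup_ideal])

lemma quot_mult: "cls R p \<otimes>\<^bsub>quot R\<^esub> cls R q = cls R (p * q)"
  and quot_add: "cls R p \<oplus>\<^bsub>quot R\<^esub> cls R q = cls R (p + q)"
  and quot_one: "\<one>\<^bsub>quot R\<^esub> = cls R 1"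
proof -
  note hom = ideal.rcos_ring_hom[OF ideal_lookup_ideal[of R]]
  show "cls R p \<otimes>\<^bsub>quot R\<^esub> cls R q = cls R (p * q)"
    using ring_hom_mult[OF hom lookup_carrier lookup_carrier, of p q] by (simp add: cls_def free_algebra_ops)
  show "cls R p \<oplus>\<^bsub>quot R\<^esub> cls R q = cls R (p + q)"
    using ring_hom_add[OF hom lookup_carrier lookup_carrier, of p q] by (simp add: cls_def free_algebra_ops)
  show "\<one>\<^bsub>quot R\<^esub> = cls R 1"
    using ring_hom_one[OF hom] by (simp add: cls_def free_algebra_ops)
qed

lemma quot_zero: "\<zero>\<^bsub>quot R\<^esub> = cls R 0"
proof -
  interpret Q: ring "quot R" by (rule ring_quot)
  have "cls R 0 \<oplus>\<^bsub>quot R\<^esub> cls R 0 = cls R 0" by (simp add: quot_add)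
  then show ?thesis using Q.add.l_cancel_one'[of "cls R 0" "cls R 0"] by simp
qed

lemma finsum_quot:
  assumes "finite I" "\<And>i. i \<in> I \<Longrightarrow> g i = cls R (f i)"
  shows "finsum (quot R) g I = cls R (\<Sum>i\<in>I. f i)"
proof -
  interpret Q: ring "quot R" by (rule ring_quot)
  show ?thesis
    using assms
  proof (induction I rule: finite_induct)
    case empty
    then show ?case by (simp add: quot_zero)
  next
    case (insert i I)
    then show ?case by (subst Q.finsum_insert) (auto simp: quot_add)
  qed
qed

lemma induced_map_cls:
  assumes "nclinear \<phi>" "\<And>p. p \<in> gen_ideal R \<Longrightarrow> \<phi> p \<in> gen_ideal R'"
    and "\<And>p. \<psi> (coef p) = coef (\<phi> p)"
  shows "induced_map (lookup_ideal R') \<psi> (cls R p) = cls R' (\<phi> p)"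
proof -
  have "lookup_ideal R' +>\<^bsub>free_algebra\<^esub> \<psi> f = cls R' (\<phi> p)" if "f \<in> cls R p" for f
  proof -
    obtain q where q: "f = coef q" "eqv R q p" using \<open>f \<in> cls R p\<close> by (auto simp: mem_cls)
    then have "eqv R' (\<phi> q) (\<phi> p)" using assms(2)[of "q - p"] by (simp add: eqv_def ncp.linear_diff[OF assms(1)])
    then show ?thesis using q by (simp add: assms(3) cls_eq_iff flip: cls_def)
  qed
  moreover have "cls R p \<noteq> {}" using mem_cls[of "coef p" R p] by auto
  ultimately show ?thesis by (auto simp: induced_map_def)
qed

lemma symmetrization_lookup: "symmetrization (coef p) = coef (symmetrize p)"
proof
  fix w
  have "Poly_Mapping.keys p = {v. coef p v \<noteq> 0}" by (auto simp: in_keys_iff)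
  then show "symmetrization (coef p) w = coef (symmetrize p) w"
    by (simp add: symmetrization_def symmetrize_def lin_def symw_def lookup_sum lookup_mon)
qed

context lie_algebra_char_0
begin

lemma linear_relations_lookup: "linear_relations scale = coef ` lin_rels"
proof -
  have "coef (mon [x + y] - mon [x] - mon [y])
      = (\<lambda>w. ncs_monom [x + y] w - ncs_monom [x] w - ncs_monom [y] w :: 'k)" for x y :: 'g
    by (simp add: fun_eq_iff lookup_minus lookup_mon)
  moreover have "coef (mon [scale c x] - sc c (mon [x]))
      = (\<lambda>w. ncs_monom [scale c x] w - c * ncs_monom [x] w)" for c x
    by (simp add: fun_eq_iff lookup_minus lookup_mon)
  ultimately show ?thesis
    unfolding linear_relations_def lin_rels_def image_Un by (intro arg_cong2[of _ _ _ _ "(\<union>)"]) (auto simp: image_iff, metis+)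
qed

lemma sym_ideal_lookup: "sym_ideal scale = lookup_ideal sym_rels"
proof -
  have "coef (mon [x, y] - mon [y, x]) = (\<lambda>w. ncs_monom [x, y] w - ncs_monom [y, x] w :: 'k)" for x y :: 'g
    by (simp add: fun_eq_iff lookup_minus lookup_mon)
  then have "commutativity_relations = coef ` {mon [x, y] - mon [y, x] :: ('g, 'k) ncpoly | x y. True}"
    unfolding commutativity_relations_def by (auto simp: image_iff) metis+
  then show ?thesis
    unfolding sym_ideal_def genideal_free_algebra[symmetric] sym_rels_def image_Un by (simp add: linear_relations_lookup)
qed

lemma env_ideal_lookup: "env_ideal scale bracket = lookup_ideal env_rels"
proof -
  have "coef (mon [x, y] - mon [y, x] - mon [bracket x y])
      = (\<lambda>w. ncs_monom [x, y] w - ncs_monom [y, x] w - ncs_monom [bracket x y] w :: 'k)" for x y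
    by (simp add: fun_eq_iff lookup_minus lookup_mon)
  then have "bracket_relations bracket = coef ` {mon [x, y] - mon [y, x] - mon [bracket x y] :: ('g, 'k) ncpoly | x y. True}"
    unfolding bracket_relations_def by (auto simp: image_iff) metis+
  then show ?thesis
    unfolding env_ideal_def genideal_free_algebra[symmetric] env_rels_def image_Un by (simp add: linear_relations_lookup)
qed

lemma sym_algebra_quot: "sym_algebra scale = quot sym_rels"
  by (simp add: sym_algebra_def sym_ideal_lookup)

lemma env_algebra_quot: "env_algebra scale bracket = quot env_rels"
  by (simp add: env_algebra_def env_ideal_lookup)

lemma cring_quot: "cring (quot sym_rels)"
proof -
  interpret Q: ring "quot sym_rels" by (rule ring_quot)
  have "eqv sym_rels (p * q) (q * p)" for p q
  proof -
    have 1: "nclinear (\<lambda>p. p * q - q * p)" for q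
      by (rule nclinearI) (simp_all add: ring_distribs sc_mult_left sc_mult_right nc.scale_right_diff_distrib)
    have 2: "nclinear (\<lambda>q. p * q - q * p)" for p
      by (rule nclinearI) (simp_all add: ring_distribs sc_mult_left sc_mult_right nc.scale_right_diff_distrib)
    have "mon u * mon v - mon v * mon u \<in> gen_ideal sym_rels" for u v
      using eqv_mset[of "u @ v" "v @ u"] by (simp add: mon_mult eqv_def)
    then have "mon u * q - q * mon u \<in> gen_ideal sym_rels" for u
      by (rule gen_ideal_linear_mem[OF 2])
    then have "p * q - q * p \<in> gen_ideal sym_rels"
      by (rule gen_ideal_linear_mem[OF 1])
    then show ?thesis by (simp add: eqv_def)
  qed
  then have comm: "cls sym_rels p \<otimes>\<^bsub>quot sym_rels\<^esub> cls sym_rels q = cls sym_rels q \<otimes>\<^bsub>quot sym_rels\<^esub> cls sym_rels p" for p q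
    by (simp only: quot_mult cls_eq_iff)
  have "comm_monoid (quot sym_rels)"
  proof (rule Q.monoid_comm_monoidI)
    fix X Y assume "X \<in> carrier (quot sym_rels)" "Y \<in> carrier (quot sym_rels)"
    then show "X \<otimes>\<^bsub>quot sym_rels\<^esub> Y = Y \<otimes>\<^bsub>quot sym_rels\<^esub> X"
      by (metis quot_cases comm)
  qed
  then show ?thesis by (intro cring.intro ring_quot)
qed

lemma sym_incl_cls: "sym_incl scale x = cls sym_rels (mon [x])"
  by (simp add: sym_incl_def cls_def sym_ideal_lookup lookup_mon)

lemma sym_smult_cls: "sym_smult scale c (cls sym_rels p) = cls sym_rels (sc c p)"
proof -
  have "(ncs_const c :: ('g, 'k) ncs) = coef (Poly_Mapping.single [] c)"
    by (auto simp: ncs_const_def lookup_single when_def fun_eq_iff)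
  then have "sym_ideal scale +>\<^bsub>free_algebra\<^esub> ncs_const c = cls sym_rels (Poly_Mapping.single [] c)"
    by (simp add: cls_def sym_ideal_lookup)
  then show ?thesis by (simp add: sym_smult_def sym_algebra_quot quot_mult sc_def)
qed

lemma sym_proj_cls: "sym_proj scale n (cls sym_rels p) = cls sym_rels (proj n p)"
  unfolding sym_proj_def sym_ideal_lookup
  by (rule induced_map_cls[OF linear_proj proj_sym_ideal]) (auto simp: lookup_proj fun_eq_iff)

lemma gutt_q_cls: "gutt_q scale bracket (cls sym_rels p) = cls env_rels (symmetrize p)"
  unfolding gutt_q_def env_ideal_lookup
  by (rule induced_map_cls[OF linear_symmetrize symmetrize_sym_ideal]) (auto simp: symmetrization_lookup)

lemma gutt_q_inv_cls:
  assumes "eqv env_rels (symmetrize p) u"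
  shows "gutt_q_inv scale bracket (cls env_rels u) = cls sym_rels p"
  unfolding gutt_q_inv_def sym_algebra_quot
proof (rule inv_into_f_eq)
  show "inj_on (gutt_q scale bracket) (carrier (quot sym_rels))"
  proof (rule inj_onI)
    fix X Y assume "X \<in> carrier (quot sym_rels)" "Y \<in> carrier (quot sym_rels)" "gutt_q scale bracket X = gutt_q scale bracket Y"
    then obtain p q where "X = cls sym_rels p" "Y = cls sym_rels q" "eqv env_rels (symmetrize p) (symmetrize q)"
      by (metis quot_cases gutt_q_cls cls_eq_iff)
    then show "X = Y"
      using symmetrize_injective[of "p - q"] by (simp add: cls_eq_iff eqv_def ncp.linear_diff[OF linear_symmetrize])
  qed
  show "gutt_q scale bracket (cls sym_rels p) = cls env_rels u"
    using assms by (simp add: gutt_q_cls cls_eq_iff)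
qed simp

lemma finprod_sym_incl:
  "distinct is \<Longrightarrow> finprod (quot sym_rels) (\<lambda>i. sym_incl scale (x i)) (set is) = cls sym_rels (mon (map x is))"
proof (induction "is")
  case Nil
  interpret Q: cring "quot sym_rels" by (rule cring_quot)
  show ?case by (simp add: quot_one mon_Nil)
next
  case (Cons i "is")
  interpret Q: cring "quot sym_rels" by (rule cring_quot)
  show ?case
    using Cons by (simp add: Q.finprod_insert sym_incl_cls quot_mult mon_mult)
qed

lemma sym_product_cls: "sym_product scale k x = cls sym_rels (mon (map x [1..<Suc k]))"
proof -
  have "set [1..<Suc k] = {1..k}" by auto
  then show ?thesis
    using finprod_sym_incl[of "[1..<Suc k]" x] by (simp add: sym_product_def sym_algebra_quot del: upt_Suc One_nat_def)
qed

lemma gutt_star_homogeneous_cls: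
  assumes "eqv env_rels (symmetrize u) (symmetrize p * symmetrize q)"
  shows "gutt_star_homogeneous scale bracket z k l (cls sym_rels p) (cls sym_rels q)
    = cls sym_rels (\<Sum>n\<in>{0..k + l}. sc (z ^ n) (proj (k + l - n) u))"
  unfolding gutt_star_homogeneous_def sym_algebra_quot env_algebra_quot
  by (rule finsum_quot) (simp_all add: gutt_q_cls quot_mult gutt_q_inv_cls[OF assms] sym_proj_cls sym_smult_cls)

lemma gutt_star_cls:
  assumes u: "eqv env_rels (symmetrize u) (symmetrize (mon v) * symmetrize (mon w))"
    and len: "length v = k" "length w = l"
  shows "gutt_star scale bracket z (cls sym_rels (mon v)) (cls sym_rels (mon w))
    = cls sym_rels (\<Sum>n\<in>{0..k + l}. sc (z ^ n) (proj (k + l - n) u))"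
proof -
  interpret Q: ring "quot sym_rels" by (rule ring_quot)
  let ?h = "gutt_star_homogeneous scale bracket z k l (cls sym_rels (mon v)) (cls sym_rels (mon w))"
  let ?S = "{(k, l). sym_proj scale k (cls sym_rels (mon v)) \<noteq> \<zero>\<^bsub>quot sym_rels\<^esub> \<and>
     sym_proj scale l (cls sym_rels (mon w)) \<noteq> \<zero>\<^bsub>quot sym_rels\<^esub>}"
  have S: "?S = (if cls sym_rels (mon v) \<noteq> cls sym_rels 0 \<and> cls sym_rels (mon w) \<noteq> cls sym_rels 0 then {(k, l)} else {})"
    using len by (auto simp: sym_proj_cls proj_mon quot_zero)
  have h: "?h = cls sym_rels (\<Sum>n\<in>{0..k + l}. sc (z ^ n) (proj (k + l - n) u))"
    by (rule gutt_star_homogeneous_cls[OF u])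
  have star: "gutt_star scale bracket z (cls sym_rels (mon v)) (cls sym_rels (mon w))
     = finsum (quot sym_rels) (\<lambda>p. gutt_star_homogeneous scale bracket z (fst p) (snd p)
          (sym_proj scale (fst p) (cls sym_rels (mon v))) (sym_proj scale (snd p) (cls sym_rels (mon w)))) ?S"
    by (simp add: gutt_star_def sym_algebra_quot)
  show ?thesis
  proof (cases "cls sym_rels (mon v) \<noteq> cls sym_rels 0 \<and> cls sym_rels (mon w) \<noteq> cls sym_rels 0")
    case True
    then show ?thesis unfolding star S using len by (simp add: sym_proj_cls proj_mon h)
  next
    case False
    then have "mon v \<in> gen_ideal sym_rels \<or> mon w \<in> gen_ideal sym_rels"
      by (auto simp: cls_eq_iff eqv_def)
    then have "symmetrize (mon v) * symmetrize (mon w) \<in> gen_ideal env_rels"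
      using symmetrize_sym_ideal gen_ideal_mult_left gen_ideal_mult_right by blast
    from gen_ideal.add[OF u[unfolded eqv_def] this] have "symmetrize u \<in> gen_ideal env_rels" by simp
    then have "u \<in> gen_ideal sym_rels" by (rule symmetrize_injective)
    then have "(\<Sum>n\<in>{0..k + l}. sc (z ^ n) (proj (k + l - n) u)) \<in> gen_ideal sym_rels"
      by (intro gen_ideal_sum gen_ideal_sc proj_sym_ideal)
    then have "cls sym_rels (\<Sum>n\<in>{0..k + l}. sc (z ^ n) (proj (k + l - n) u)) = \<zero>\<^bsub>quot sym_rels\<^esub>"
      by (simp add: quot_zero cls_eq_iff eqv_def)
    then show ?thesis unfolding star S using False by auto
  qed
qed

end

context gutt
begin

lemma proj_part_sum: "proj m (part_sum r A B) = (if r = m then part_sum r A B else 0)"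
proof -
  have "proj m (part_sum r A B) = (\<Sum>P\<in>ordparts r A B. if r = m then mon (part_word P) else 0)"
    unfolding part_sum_def ncp.linear_sum[OF linear_proj]
    by (intro sum.cong refl) (simp add: proj_mon part_word_def ordparts_def)
  then show ?thesis by (simp add: part_sum_def)
qed

lemma bch_product_cls:
  assumes "sum_list (map fst J) = k" "sum_list (map snd J) = l"
  shows "bch_product scale bracket E (\<xi> \<circ> \<sigma>) (\<eta> \<circ> \<tau>) J
    = cls sym_rels (mon (blocks J (map \<sigma> [1..<Suc k]) (map \<tau> [1..<Suc l])))"
proof -
  have "map (\<lambda>i. bch_tilde scale bracket E (fst (J ! i)) (snd (J ! i))
      (\<lambda>m. (\<xi> \<circ> \<sigma>) ((\<Sum>j<i. fst (J ! j)) + m)) (\<lambda>m. (\<eta> \<circ> \<tau>) ((\<Sum>j<i. snd (J ! j)) + m))) [0..<length J]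
    = blocks J (map \<sigma> [1..<Suc k]) (map \<tau> [1..<Suc l])"
    by (rule blocks_conv_map) (use assms in \<open>auto simp del: upt_Suc\<close>)
  then show ?thesis
    using finprod_sym_incl[of "[0..<length J]"] by (simp add: bch_product_def sym_algebra_quot lessThan_atLeast0)
qed

lemma finsum_permutes_quot:
  assumes "\<And>\<sigma>. \<sigma> permutes {1..n::nat} \<Longrightarrow> g \<sigma> = cls R (f (map \<sigma> [1..<Suc n]))"
  shows "finsum (quot R) g {\<sigma>. \<sigma> permutes {1..n}} = cls R (\<Sum>xs\<in>perms {1..n}. f xs)"
  unfolding sum_permutes_interval[symmetric] using assms by (intro finsum_quot) (auto simp: finite_permutations)

lemma bch_product_sum_cls:
  assumes "J \<in> all_indices r k l"
  shows "finsum (quot sym_rels) (\<lambda>\<sigma>. finsum (quot sym_rels) (\<lambda>\<tau>. bch_product scale bracket E (\<xi> \<circ> \<sigma>) (\<eta> \<circ> \<tau>) J)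
     {\<tau>. \<tau> permutes {1..l}}) {\<sigma>. \<sigma> permutes {1..k}} = cls sym_rels (typed_sum J {1..k} {1..l})"
  (is "?L = _")
proof -
  have J: "sum_list (map fst J) = k" "sum_list (map snd J) = l" using assms by (auto simp: all_indices_alt)
  have "?L = cls sym_rels (\<Sum>xs\<in>perms {1..k}. \<Sum>ys\<in>perms {1..l}. mon (blocks J xs ys))"
    by (intro finsum_permutes_quot) (rule bch_product_cls[OF J])
  also have "\<dots> = cls sym_rels (typed_sum J {1..k} {1..l})"
    unfolding cls_eq_iff using J by (intro eqv_mono[OF lin_rels_sym_rels] sum_blocks_typed_sum) auto
  finally show ?thesis .
qed

lemma typed_sum_part_sum:
  "eqv sym_rels (sc c (\<Sum>J\<in>all_indices r k l. typed_sum J {1..k} {1..l})) (sc c (part_sum r {1..k} {1..l}))"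
  by (rule eqv_sc[OF eqv_sym[OF eqv_mono[OF lin_rels_sym_rels part_sum_typed_sum]]])

lemma gutt_C_cls:
  "gutt_C scale bracket E k l \<xi> \<eta> n = cls sym_rels (sc (1 / fact (k + l - n)) (part_sum (k + l - n) {1..k} {1..l}))"
proof -
  let ?r = "k + l - n"
  have sub: "G_indices ?r k l \<subseteq> all_indices ?r k l" by (auto simp: G_indices_alt)
  have "gutt_C scale bracket E k l \<xi> \<eta> n
    = cls sym_rels (\<Sum>J\<in>G_indices ?r k l. sc (1 / of_nat (G_factorial k l J)) (typed_sum J {1..k} {1..l}))"
    unfolding gutt_C_def sym_algebra_quot
  proof (rule finsum_quot)
    show "finite (G_indices ?r k l)" by (rule finite_subset[OF sub finite_all_indices])
    fix J assume "J \<in> G_indices ?r k l"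
    then have "J \<in> all_indices ?r k l" using sub by blast
    from bch_product_sum_cls[OF this]
    show "sym_smult scale (1 / of_nat (G_factorial k l J)) (finsum (quot sym_rels) (\<lambda>\<sigma>. finsum (quot sym_rels)
       (\<lambda>\<tau>. bch_product scale bracket E (\<xi> \<circ> \<sigma>) (\<eta> \<circ> \<tau>) J) {\<tau>. \<tau> permutes {1..l}}) {\<sigma>. \<sigma> permutes {1..k}})
      = cls sym_rels (sc (1 / of_nat (G_factorial k l J)) (typed_sum J {1..k} {1..l}))"
      by (simp only: sym_smult_cls)
  qed
  also have "\<dots> = cls sym_rels (sc (1 / fact ?r) (part_sum ?r {1..k} {1..l}))"
    unfolding cls_eq_iff by (rule eqv_trans[OF eqv_sym[OF typed_sum_G_indices] typed_sum_part_sum])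
  finally show ?thesis .
qed

lemma all_indices_product_cls:
  "finsum (quot sym_rels) (\<lambda>\<sigma>. finsum (quot sym_rels) (\<lambda>\<tau>. finsum (quot sym_rels)
      (\<lambda>J. bch_product scale bracket E (\<xi> \<circ> \<sigma>) (\<eta> \<circ> \<tau>) J) (all_indices r k l))
     {\<tau>. \<tau> permutes {1..l}}) {\<sigma>. \<sigma> permutes {1..k}} = cls sym_rels (part_sum r {1..k} {1..l})"
  (is "?L = _")
proof -
  have "?L = cls sym_rels (\<Sum>xs\<in>perms {1..k}. \<Sum>ys\<in>perms {1..l}. \<Sum>J\<in>all_indices r k l. mon (blocks J xs ys))"
    by (intro finsum_permutes_quot finsum_quot finite_all_indices bch_product_cls) (auto simp: all_indices_alt)
  also have "(\<Sum>xs\<in>perms {1..k}. \<Sum>ys\<in>perms {1..l}. \<Sum>J\<in>all_indices r k l. mon (blocks J xs ys))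
    = (\<Sum>xs\<in>perms {1..k}. \<Sum>J\<in>all_indices r k l. \<Sum>ys\<in>perms {1..l}. (mon (blocks J xs ys) :: ('g, 'k) ncpoly))"
    by (intro sum.cong refl sum.swap)
  also have "\<dots> = (\<Sum>J\<in>all_indices r k l. \<Sum>xs\<in>perms {1..k}. \<Sum>ys\<in>perms {1..l}. mon (blocks J xs ys))"
    by (rule sum.swap)
  also have "cls sym_rels \<dots> = cls sym_rels (\<Sum>J\<in>all_indices r k l. typed_sum J {1..k} {1..l})"
    unfolding cls_eq_iff
    by (intro eqv_sum eqv_mono[OF lin_rels_sym_rels] sum_blocks_typed_sum) (auto simp: all_indices_alt)
  also have "\<dots> = cls sym_rels (part_sum r {1..k} {1..l})"
    unfolding cls_eq_iff by (rule eqv_sym[OF eqv_mono[OF lin_rels_sym_rels part_sum_typed_sum]])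
  finally show ?thesis .
qed

lemma gutt_star_sym_product:
  assumes "k \<ge> 1"
  shows "gutt_star scale bracket z (sym_product scale k \<xi>) (sym_product scale l \<eta>)
    = cls sym_rels (\<Sum>n\<in>{0..k + l - 1}. sc (z ^ n) (sc (1 / fact (k + l - n)) (part_sum (k + l - n) {1..k} {1..l})))"
proof -
  let ?X = "\<lambda>r. part_sum r {1..k} {1..l}"
  let ?u = "\<Sum>r\<le>k + l. sc (1 / fact r) (?X r)"
  have proj: "proj m ?u = sc (1 / fact m) (?X m)" if "m \<le> k + l" for m
  proof -
    have "proj m ?u = (\<Sum>r\<le>k + l. if r = m then sc (1 / fact m) (?X m) else 0)"
      unfolding ncp.linear_sum[OF linear_proj] ncp.linear_scale[OF linear_proj] proj_part_sum
      by (intro sum.cong refl) auto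
    with that show ?thesis by simp
  qed
  have "?X 0 = 0" using assms by (simp add: part_sum_def ordparts_0)
  have "gutt_star scale bracket z (sym_product scale k \<xi>) (sym_product scale l \<eta>)
    = cls sym_rels (\<Sum>n\<in>{0..k + l}. sc (z ^ n) (proj (k + l - n) ?u))"
    unfolding sym_product_cls by (rule gutt_star_cls[OF eqv_sym[OF symmetrized_product]]) simp_all
  also have "(\<Sum>n\<in>{0..k + l}. sc (z ^ n) (proj (k + l - n) ?u)) = (\<Sum>n\<in>{0..k + l}. sc (z ^ n) (sc (1 / fact (k + l - n)) (?X (k + l - n))))"
    by (simp only: proj[OF diff_le_self])
  also have "\<dots> = (\<Sum>n\<in>{0..k + l - 1}. sc (z ^ n) (sc (1 / fact (k + l - n)) (?X (k + l - n))))"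
    using \<open>?X 0 = 0\<close> by (intro sum.mono_neutral_right) (auto simp: not_le)
  finally show ?thesis .
qed

end

theorem proposition4p1p11:
  fixes scale :: "'k::real_normed_field \<Rightarrow> 'g::ab_group_add \<Rightarrow> 'g"
    and br :: "'g \<Rightarrow> 'g \<Rightarrow> 'g"
    and E :: "nat \<Rightarrow> nat \<Rightarrow> lie_word \<Rightarrow>\<^sub>0 'k"
    and z :: 'k and k l :: nat and \<xi> \<eta> :: "nat \<Rightarrow> 'g"
  assumes "lie_algebra scale br"
    and "bch_expressions E"
    and "k \<ge> 1" and "l \<ge> 1"
  shows "gutt_star scale br z (sym_product scale k \<xi>) (sym_product scale l \<eta>)
           = (\<Oplus>\<^bsub>sym_algebra scale\<^esub>n\<in>{0..k + l - 1}.
                sym_smult scale (z ^ n) (gutt_C scale br E k l \<xi> \<eta> n))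
       \<and> (\<forall>n\<in>{0..k + l - 1}. gutt_C scale br E k l \<xi> \<eta> n =
           sym_smult scale (1 / fact (k + l - n))
             (\<Oplus>\<^bsub>sym_algebra scale\<^esub>\<sigma>\<in>{\<sigma>. \<sigma> permutes {1..k}}.
              \<Oplus>\<^bsub>sym_algebra scale\<^esub>\<tau>\<in>{\<tau>. \<tau> permutes {1..l}}.
              \<Oplus>\<^bsub>sym_algebra scale\<^esub>J\<in>all_indices (k + l - n) k l.
                bch_product scale br E (\<xi> \<circ> \<sigma>) (\<eta> \<circ> \<tau>) J))"
proof -
  interpret lie_algebra scale br by fact
  interpret gutt scale br E \<xi> \<eta>
    by unfold_locales (rule assms(2))
  show ?thesis
  proof (intro conjI ballI, goal_cases)
    case 1
    show ?case
      unfolding gutt_star_sym_product[OF assms(3)] sym_algebra_quot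
      by (rule finsum_quot[symmetric]) (simp_all only: finite_atLeastAtMost gutt_C_cls sym_smult_cls)
  next
    case (2 n)
    show ?case
      unfolding sym_algebra_quot all_indices_product_cls sym_smult_cls by (rule gutt_C_cls)
  qed
qed

end
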